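(* Let $n>1$ be an integer, $1\le q<\infty$ with $0\le 1-1/q\le 1/n$, and let $0<\eta<\infty$. Let $w\in V(\mathbf{R}_+)$. If $q>1$, assume moreover that $$\inf_{r\in(0,\eta]\cap Z[v_w]}K(r)>0 .$$ Then there exists a number $C=C(q,\eta,w)>0$ such that for every $u\in C_c^\infty(B_\eta\setminus\{0\})$ $$\int_{B_\eta}|\nabla u(x)|\,w(|x|)\,|x|^{1-n}\,dx\ \ge\ C\left(\int_{B_\eta}|u(x)|^q\,V_w^q(|x|;\eta)\,|x|^{1-n}\,dx\right)^{1/q}.$$
   Context: Let $\mathbf{R}_+=(0,\infty)$ and $B_\eta=\{x\in\mathbf{R}^n:|x|<\eta\}$. For $a\in[0,\infty]$, $W_a(\mathbf{R}_+)$ is the set of locally Lipschitz continuous functions $w:\mathbf{R}_+\to(0,\infty)$ (Lipschitz on each compact subset of $\mathbf{R}_+$) with $\lim_{t\to+0}w(t)=a$. Let $V(\mathbf{R}_+)$ be the union of $W_0(\mathbf{R}_+)$ and $W_\infty(\mathbf{R}_+)$, i.e. $V(\mathbf{R}_+)=W_0(\mathbf{R}_+)\cup W_\infty(\mathbf{R}_+)$: a weight in $V(\mathbf{R}_+)$ tends either to $0$ or to $\infty$ at the origin. For $w\in W_0(\mathbf{R}_+)$ define $\varphi_w(t;\eta)=\inf_{t\le s\le\eta}w(s)$ for $0<t\le\eta$ and $\varphi_w(t;\eta)=w(\eta)$ for $t\ge\eta$. For $w\in W_\infty(\mathbf{R}_+)$ define $\psi_w(t;\eta)=\inf_{0<s\le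 t}w(s)$ for $0<t\le\eta$ and $\psi_w(t;\eta)=\inf_{0<s\le\eta}w(s)$ for $t\ge\eta$. Put $v_w(t)=v_w(t;\eta)=\varphi_w(t;\eta)$ if $w\in W_0(\mathbf{R}_+)$ and $v_w(t)=v_w(t;\eta)=\psi_w(t;\eta)$ if $w\in W_\infty(\mathbf{R}_+)$. The function $v_w$ is monotone and locally Lipschitz, hence differentiable a.e. For $q\ge1$ define, for almost every $t\in(0,\eta)$, $V_w^q(t;\eta)=\frac{d}{dt}\big(\varphi_w(t;\eta)\big)^q$ if $w\in W_0(\mathbf{R}_+)$, and $V_w^q(t;\eta)=-\frac{d}{dt}\big(\psi_w(t;\eta)\big)^q$ if $w\in W_\infty(\mathbf{R}_+)$. Let $Z[v_w]=\{r\in\mathbf{R}_+: v_w \text{ is differentiable at } r \text{ and } v_w'(r)\neq0\}$, and for $r\in Z[v_w]$ let $K(r)=\left|\dfrac{w(r)}{r\,w'(r)}\right|$ (at such $r$ one has $w(r)=v_w(r)$ and $w'(r)=v_w'(r)$). *)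

theory Defs
  imports "HOL-Analysis.Analysis"
begin

section \<open>Weights on the positive half-line\<close>

text \<open>
  Functions on \<open>(0,\<infinity>)\<close> are represented by total functions on \<^typ>\<open>real\<close> whose values
  outside \<open>(0,\<infinity>)\<close> are never used.
\<close>

definition W_class :: "ennreal \<Rightarrow> (real \<Rightarrow> real) set" where
  "W_class a = {w. (\<forall>t>0. w t > 0) \<and>
     (\<forall>K. compact K \<and> K \<subseteq> {0<..} \<longrightarrow> (\<exists>L. L-lipschitz_on K w)) \<and>
     ((\<lambda>t. ennreal (w t)) \<longlongrightarrow> a) (at_right 0)}"

definition V_class :: "(real \<Rightarrow> real) set" where
  "V_class = W_class 0 \<union> W_class \<infinity>"

text \<open>
  All infima of \<open>w\<close> below are over nonempty sets on which \<open>w\<close> is bounded below by \<open>0\<close>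
  (for \<open>t > 0\<close>), so the conditionally complete infimum on \<^typ>\<open>real\<close> is the true one.
\<close>

definition phi :: "(real \<Rightarrow> real) \<Rightarrow> real \<Rightarrow> real \<Rightarrow> real" where
  "phi w \<eta> t = (if t \<le> \<eta> then (INF s\<in>{t..\<eta>}. w s) else w \<eta>)"

definition psi :: "(real \<Rightarrow> real) \<Rightarrow> real \<Rightarrow> real \<Rightarrow> real" where
  "psi w \<eta> t = (if t \<le> \<eta> then (INF s\<in>{0<..t}. w s) else (INF s\<in>{0<..\<eta>}. w s))"

text \<open>Only used for \<open>w \<in> V_class\<close>; the two classes composing it are disjoint.\<close>

definition v_fun :: "(real \<Rightarrow> real) \<Rightarrow> real \<Rightarrow> real \<Rightarrow> real" where
  "v_fun w \<eta> = (if w \<in> W_class 0 then phi w \<eta> else psi w \<eta>)"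

text \<open>
  At the null set of points where the derivative does not exist, \<^const>\<open>deriv\<close> has an
  unspecified value, which does not affect integrals.
\<close>

definition V_weight :: "real \<Rightarrow> (real \<Rightarrow> real) \<Rightarrow> real \<Rightarrow> real \<Rightarrow> real" where
  "V_weight q w \<eta> t =
     (if w \<in> W_class 0 then deriv (\<lambda>s. phi w \<eta> s powr q) t
      else - deriv (\<lambda>s. psi w \<eta> s powr q) t)"

definition Z_set :: "(real \<Rightarrow> real) \<Rightarrow> real set" where
  "Z_set v = {r. r > 0 \<and> v differentiable (at r) \<and> deriv v r \<noteq> 0}"

definition K_fun :: "(real \<Rightarrow> real) \<Rightarrow> real \<Rightarrow> real" where
  "K_fun w r = \<bar>w r / (r * deriv w r)\<bar>"

section \<open>Test functions and the gradient\<close>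

text \<open>\<open>Ck k f\<close>: \<open>f\<close> has continuous partial derivatives up to order \<open>k\<close> on the whole space.\<close>

primrec Ck :: "nat \<Rightarrow> ('a::euclidean_space \<Rightarrow> real) \<Rightarrow> bool" where
  "Ck 0 f \<longleftrightarrow> continuous_on UNIV f"
| "Ck (Suc k) f \<longleftrightarrow> f differentiable_on UNIV \<and>
     (\<forall>i\<in>Basis. Ck k (\<lambda>x. frechet_derivative f (at x) i))"

text \<open>Elements of \<open>C_c\<^sup>\<infinity>(\<Omega>)\<close>, extended by zero to the whole space (\<open>\<Omega>\<close> open).\<close>

definition test_fun :: "'a::euclidean_space set \<Rightarrow> ('a \<Rightarrow> real) set" where
  "test_fun \<Omega> = {u. (\<forall>k. Ck k u) \<and>
     compact (closure {x. u x \<noteq> 0}) \<and> closure {x. u x \<noteq> 0} \<subseteq> \<Omega>}"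

definition grad :: "('a::euclidean_space \<Rightarrow> real) \<Rightarrow> 'a \<Rightarrow> 'a" where
  "grad u x = (\<Sum>i\<in>Basis. frechet_derivative u (at x) i *\<^sub>R i)"

end

theory Submission
  imports Defs
begin

text \<open>
  Write \<open>v\<close> for the monotone minorant \<open>v_w\<close> of \<open>w\<close> and \<open>d = \<bar>v'\<bar>\<close>, so that the right-hand weight is
  \<open>q v\<^sup>q\<^sup>-\<^sup>1 d\<close>. Along each ray, monotonicity of \<open>v\<close> gives the one-dimensional bounds
  \<open>v \<bar>u\<bar> \<le> \<integral> v \<bar>\<nabla>u\<bar> dr\<close> and \<open>\<integral> \<bar>u\<bar> d dr \<le> \<integral> v \<bar>\<nabla>u\<bar> dr\<close>; the second one is the case \<open>q = 1\<close>.
  For the critical exponent \<open>n / (n - 1)\<close> one works in each of the \<open>2n\<close> cones around the coordinate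
  half-axes, with the distance \<open>r\<close> to the origin and the \<open>n - 1\<close> slopes as coordinates. In every slope
  direction \<open>\<bar>u\<bar> d\<close> is bounded by its mean plus the integral of \<open>2 r d \<bar>\<nabla>u\<bar>\<close>, and the hypothesis on \<open>K\<close> says
  precisely that \<open>r d \<le> v / k\<close>; hence all \<open>n\<close> directional bounds are controlled by \<open>\<integral> v \<bar>\<nabla>u\<bar>\<close> and a
  Loomis--Whitney argument multiplies them together. Intermediate \<open>q\<close> follow by pointwise interpolation.
  Averages over slopes are taken at fixed \<open>r\<close>, where the radial weight is constant, so no comparison of
  \<open>v\<close> or \<open>d\<close> at different radii is needed.
\<close>

section \<open>Differentiability of Lipschitz functions almost everywhere\<close>

text \<open>The weight |x|^(1-n) makes the problem one-dimensional along rays: in cone coordinates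
  it cancels the Jacobian and leaves dr times a factor between n^(-n) and 1. The obstacle is the
  slope directions, where \<open>u\<close> has no boundary condition: the derivative alone cannot
  bound |u| there, and the mean term that appears is paid for by the radial inequality of the case q
  = 1. With m = n - 1 the exponents fit because ((v|u|)^(1/m) |u| d)^m = v|u| (|u| d)^m is one
  radial factor times m angular ones, one per slope. The condition 1 - 1/q <= 1/n means q - 1 <=
  1/m, so (v|u|)^(q-1) lies between the powers 0 and 1/m of v|u|; splitting at a threshold N
  comparable to the gradient integral makes both pieces scale like N^q. The hypothesis on K speaks
  of w and transfers to v because v can vary only where it touches w, and there the derivatives
  agree. As v' exists only almost everywhere, differentiability of Lipschitz functions is derived
  from a Radon-Nikodym density and Lebesgue differentiation.\<close>

lemma interval_measure_absolutely_continuous: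
  fixes G :: "real \<Rightarrow> real"
  assumes mono: "\<And>x y. x \<le> y \<Longrightarrow> G x \<le> G y"
    and lip: "\<And>x y. x \<le> y \<Longrightarrow> G y - G x \<le> y - x"
  shows "absolutely_continuous lborel (interval_measure G)"
proof -
  \<comment> \<open>\<open>G\<close> and \<open>H\<close> are both nondecreasing and add up to the
    identity, so their interval measures add up to Lebesgue measure. Each summand is dominated by
    the sum, and absolute continuity follows.\<close>
  define H where "H = (\<lambda>x. x - G x)"
  have monoH: "\<And>x y. x \<le> y \<Longrightarrow> H x \<le> H y"
    using lip by (auto simp: H_def algebra_simps)
  have contG: "continuous_on UNIV G"
  proof (rule continuous_onI)
    fix x e :: real assume "e > 0"
    have "dist (G y) (G x) \<le> dist y x" for y
      using mono[of x y] mono[of y x] lip[of x y] lip[of y x]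
      by (cases "x \<le> y") (auto simp: dist_real_def)
    with \<open>e > 0\<close> show "\<exists>d>0. \<forall>y\<in>UNIV. dist y x < d \<longrightarrow> dist (G y) (G x) \<le> e"
      by (meson dual_order.trans less_imp_le)
  qed
  then have contH: "continuous_on UNIV H"
    unfolding H_def by (intro continuous_intros)
  have Ioo: "emeasure (interval_measure F) {l<..<u} = ennreal (F u - F l)"
    if le: "l \<le> u" and F: "\<And>x y. x \<le> y \<Longrightarrow> F x \<le> F y" and c: "continuous_on UNIV F"
    for l u and F :: "real \<Rightarrow> real"
  proof -
    have c': "continuous (at_right a) F" for a
      using c by (meson UNIV_I continuous_on_eq_continuous_within continuous_within_subset subset_UNIV)
    have "emeasure (interval_measure F) {u..u} = F u - F u"
      by (rule emeasure_interval_measure_Icc) (use F c in auto)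
    then have "{u} \<in> null_sets (interval_measure F)" by auto
    moreover have "{l<..<u} = {l<..u} - {u}" by auto
    ultimately have "emeasure (interval_measure F) {l<..<u} = emeasure (interval_measure F) {l<..u}"
      by (simp add: emeasure_Diff_null_set)
    then show ?thesis
      using emeasure_interval_measure_Ioc[OF le, of F] F c' by simp
  qed
  define S where "S = measure_of UNIV (sets borel)
      (\<lambda>A. emeasure (interval_measure G) A + emeasure (interval_measure H) A)"
  have em: "emeasure S A = emeasure (interval_measure G) A + emeasure (interval_measure H) A"
    if "A \<in> sets borel" for A
    unfolding S_def
  proof (rule emeasure_measure_of_sigma)
    show "sigma_algebra UNIV (sets (borel :: real measure))"
      using sets.sigma_algebra_axioms[of "borel :: real measure"] by simp
    show "positive (sets borel) (\<lambda>A. emeasure (interval_measure G) A + emeasure (interval_measure H) A)"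
      by (auto simp: positive_def)
    show "countably_additive (sets borel) (\<lambda>A. emeasure (interval_measure G) A + emeasure (interval_measure H) A)"
      unfolding countably_additive_def
      by (auto simp: suminf_add[symmetric] suminf_emeasure)
  qed fact
  have "lborel = S"
  proof (rule lborel_eqI)
    fix l u :: real
    assume "\<And>b. b \<in> Basis \<Longrightarrow> l \<bullet> b \<le> u \<bullet> b"
    then have le: "l \<le> u" by simp
    then have "emeasure S (box l u) = ennreal (G u - G l) + ennreal (H u - H l)"
      by (simp add: em box_real Ioo mono monoH contG contH)
    also have "\<dots> = ennreal (u - l)"
      using mono[OF le] monoH[OF le] by (simp add: ennreal_plus[symmetric] H_def del: ennreal_plus)
    finally show "emeasure S (box l u) = (\<Prod>b\<in>Basis. (u - l) \<bullet> b)" by simp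
  qed (simp add: S_def sets.sigma_sets_eq[of borel, simplified])
  then show ?thesis
    unfolding absolutely_continuous_def
    by (auto simp: null_sets_def dest: em)
qed

text \<open>\<open>f\<close> need not be monotone, so it defines no measure directly. Adding a
  linear term and rescaling gives \<open>G\<close> with slopes in [0, 1]; the Radon-Nikodym density
  of its interval measure is then transformed back to \<open>f\<close>.\<close>

lemma lipschitz_eq_integral:
  fixes f :: "real \<Rightarrow> real"
  assumes "L-lipschitz_on UNIV f"
  obtains g where "g \<in> borel_measurable borel"
    "\<And>a b. a \<le> b \<Longrightarrow> has_bochner_integral lborel (\<lambda>x. g x * indicator {a..b} x) (f b - f a)"
proof -
  \<comment> \<open>\<open>L\<close> may be \<open>0\<close>; the shift makes division by
    \<open>K\<close> legitimate.\<close>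
  define K where "K = L + 1"
  have "L \<ge> 0" using assms lipschitz_on_nonneg by blast
  then have K: "K > 0" by (simp add: K_def)
  have lip: "\<bar>f x - f y\<bar> \<le> K * \<bar>x - y\<bar>" for x y
  proof -
    have "\<bar>f x - f y\<bar> \<le> L * \<bar>x - y\<bar>"
      using lipschitz_onD[OF assms, of x y] by (simp add: dist_real_def)
    also have "\<dots> \<le> K * \<bar>x - y\<bar>" by (simp add: K_def mult_right_mono)
    finally show ?thesis .
  qed
  define F where "F x = f x / K" for x
  define G where "G x = (x + F x) / 2" for x
  have mono: "G x \<le> G y" if "x \<le> y" for x y
  proof -
    have "f x - f y \<le> K * (y - x)" using lip[of x y] that by (simp add: abs_if split: if_splits)
    then have "(f x - f y) / K \<le> y - x" using K by (simp add: pos_divide_le_eq mult.commute)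
    then have "F x - F y \<le> y - x" by (simp only: diff_divide_distrib F_def)
    then have "F x + x \<le> F y + y" by (simp add: algebra_simps)
    then show ?thesis by (simp add: G_def add.commute)
  qed
  have lipG: "G y - G x \<le> y - x" if "x \<le> y" for x y
  proof -
    have "f y - f x \<le> K * (y - x)" using lip[of x y] that by (simp add: abs_if split: if_splits)
    then have "(f y - f x) / K \<le> y - x" using K by (simp add: pos_divide_le_eq mult.commute)
    then have "F y - F x \<le> y - x" by (simp only: diff_divide_distrib F_def)
    then have "F y + x \<le> F x + y" by (simp add: algebra_simps)
    then show ?thesis by (simp add: G_def field_simps)
  qed
  have contf: "continuous_on UNIV f" using assms by (rule lipschitz_on_continuous_on)
  then have cont: "continuous_on UNIV G"
    unfolding G_def F_def by (intro continuous_intros) (use K in auto)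
  from interval_measure_absolutely_continuous[of G, OF mono lipG]
  obtain h where h[measurable]: "h \<in> borel_measurable lborel" and dens: "density lborel h = interval_measure G"
    using sigma_finite_measure.Radon_Nikodym[OF sigma_finite_lborel, of "interval_measure G"] by auto
  have hG: "(\<integral>\<^sup>+x. h x * indicator {a..b} x \<partial>lborel) = ennreal (G b - G a)" if "a \<le> b" for a b
  proof -
    have "ennreal (G b - G a) = emeasure (density lborel h) {a..b}"
      unfolding dens by (rule emeasure_interval_measure_Icc[symmetric]) (use that mono cont in auto)
    then show ?thesis by (simp add: emeasure_density)
  qed
  define g0 where "g0 x = enn2real (h x)" for x
  have [measurable]: "g0 \<in> borel_measurable borel" unfolding g0_def by measurable
  have g0: "has_bochner_integral lborel (\<lambda>x. g0 x * indicator {a..b} x) (G b - G a)" if ab: "a \<le> b" for a b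
  proof (rule has_bochner_integral_nn_integral)
    have "AE x in lborel. h x * indicator {a..b} x \<noteq> \<infinity>"
      by (rule nn_integral_PInf_AE) (use hG[OF ab] in auto)
    then have "AE x in lborel. ennreal (g0 x * indicator {a..b} x) = h x * indicator {a..b} x"
      by eventually_elim (auto simp: g0_def indicator_def less_top)
    then show "(\<integral>\<^sup>+x. ennreal (g0 x * indicator {a..b} x) \<partial>lborel) = ennreal (G b - G a)"
      using hG[OF ab] by (simp cong: nn_integral_cong_AE)
  qed (use mono[OF ab] in \<open>auto simp: g0_def\<close>)
  define g where "g x = 2 * K * g0 x - K" for x
  show ?thesis
  proof
    show "g \<in> borel_measurable borel" unfolding g_def by measurable
    fix a b :: real assume ab: "a \<le> b"
    have "has_bochner_integral lborel (\<lambda>x. 2 * K * (g0 x * indicator {a..b} x) - K * indicator {a..b} x)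
       (2 * K * (G b - G a) - K * (b - a))"
      using ab by (intro has_bochner_integral_diff has_bochner_integral_mult_right g0 has_bochner_integral_real_indicator[THEN has_bochner_integral_cong[THEN iffD1,rotated -1]])
        (auto simp: ennreal_eq_0_iff measure_def)
    moreover have "2 * K * (G b - G a) - K * (b - a) = f b - f a"
      using K by (simp add: G_def F_def field_simps)
    moreover have "(\<lambda>x. 2 * K * (g0 x * indicator {a..b} x) - K * indicator {a..b} x) = (\<lambda>x. g x * indicator {a..b} x)"
      by (auto simp: g_def algebra_simps)
    ultimately show "has_bochner_integral lborel (\<lambda>x. g x * indicator {a..b} x) (f b - f a)" by simp
  qed
qed

text \<open>Lebesgue differentiation with intervals that have \<open>x\<close> as left end point:
  the averages of \<open>g\<close> over \<open>{x..x + h}\<close> are exactly the right difference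
  quotients of \<open>f\<close>.\<close>

lemma right_derivative_AE:
  fixes f g :: "real \<Rightarrow> real"
  assumes I: "\<And>a b. a \<le> b \<Longrightarrow> has_bochner_integral lborel (\<lambda>x. g x * indicator {a..b} x) (f b - f a)"
  shows "AE x in lborel. ((\<lambda>h. (f (x + h) - f x) / h) \<longlongrightarrow> g x) (at_right 0)"
proof -
  have HI: "(g has_integral (f b - f a)) {a..b}" if "a \<le> b" for a b
  proof -
    have "((\<lambda>x. g x * indicator {a..b} x) has_integral (f b - f a)) UNIV"
      using has_integral_integral_lborel[of "\<lambda>x. g x * indicator {a..b} x"] I[OF that]
      by (simp add: has_bochner_integral_iff)
    moreover have "(\<lambda>x. g x * indicator {a..b} x) = (\<lambda>x. if x \<in> {a..b} then g x else 0)"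
      by auto
    ultimately show ?thesis by (simp add: has_integral_restrict_UNIV del: atLeastAtMost_iff)
  qed
  have "g integrable_on cbox a b" for a b
    using HI[of a b] by (cases "a \<le> b") (auto simp: integrable_on_def)
  from integrable_ccontinuous_explicit[of g, OF this] obtain N where
    N: "negligible N" "\<And>x e. \<lbrakk>x \<notin> N; 0 < e\<rbrakk> \<Longrightarrow> \<exists>d>0. \<forall>h. 0 < h \<and> h < d \<longrightarrow>
        norm(integral (cbox x (x + h *\<^sub>R One)) g /\<^sub>R h ^ DIM(real) - g x) < e" by blast
  have lim: "((\<lambda>h. (f (x + h) - f x) / h) \<longlongrightarrow> g x) (at_right 0)" if "x \<notin> N" for x
  proof (rule tendstoI)
    fix e :: real assume "e > 0"
    from N(2)[OF that this] obtain d where d: "d > 0"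
      "\<And>h. 0 < h \<Longrightarrow> h < d \<Longrightarrow> norm(integral (cbox x (x + h *\<^sub>R One)) g /\<^sub>R h ^ DIM(real) - g x) < e"
      by blast
    have "dist ((f (x + h) - f x) / h) (g x) < e" if h: "0 < h" "h < d" for h
      using d(2)[OF h] integral_unique[OF HI[of x "x + h"]] h
      by (simp add: dist_real_def divide_inverse mult.commute)
    then show "\<forall>\<^sub>F h in at_right 0. dist ((f (x + h) - f x) / h) (g x) < e"
      using d(1) unfolding eventually_at_right_field by auto
  qed
  have "N \<in> null_sets lebesgue" using N(1) by (simp add: negligible_iff_null_sets)
  then have "AE x in lebesgue. x \<notin> N" by (rule AE_not_in)
  then have "AE x in lborel. x \<notin> N" by (simp add: AE_completion_iff)
  then show ?thesis by eventually_elim (rule lim)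
qed

lemma AE_lborel_uminus:
  assumes "AE x::real in lborel. P x"
  shows "AE x in lborel. P (- x)"
proof -
  from assms obtain N where N: "N \<in> null_sets lborel" "{x. \<not> P x} \<subseteq> N"
    by (auto elim!: AE_E simp: null_sets_def)
  have "AE x in distr lborel borel uminus. x \<notin> N"
    using AE_not_in[OF N(1)] by (simp only: lborel_distr_uminus)
  then have "AE x in lborel. - x \<notin> N"
    using N(1) by (subst (asm) AE_distr_iff) (auto simp: null_sets_def)
  then show ?thesis by eventually_elim (use N(2) in auto)
qed

text \<open>Left difference quotients of \<open>f\<close> are right difference quotients of the
  reflected function \<open>- f (- x)\<close>, whose density is \<open>g (- x)\<close>. Both
  one-sided limits are therefore \<open>g x\<close> almost everywhere.\<close>

lemma lipschitz_AE_derivative: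
  fixes f :: "real \<Rightarrow> real"
  assumes "L-lipschitz_on UNIV f"
  obtains g where "g \<in> borel_measurable borel" "AE x in lborel. (f has_real_derivative g x) (at x)"
    "\<And>a b. a \<le> b \<Longrightarrow> has_bochner_integral lborel (\<lambda>x. g x * indicator {a..b} x) (f b - f a)"
proof -
  from lipschitz_eq_integral[OF assms] obtain g where g[measurable]: "g \<in> borel_measurable borel"
    and I: "\<And>a b. a \<le> b \<Longrightarrow> has_bochner_integral lborel (\<lambda>x. g x * indicator {a..b} x) (f b - f a)"
    by blast
  have I': "has_bochner_integral lborel (\<lambda>x. g (- x) * indicator {a..b} x) (- f (- b) - - f (- a))"
    if "a \<le> b" for a b
  proof -
    have "has_bochner_integral lborel (\<lambda>x. g (0 + (-1) * x) * indicator {-b..-a} (0 + (-1) * x)) ((f (-a) - f (-b)) /\<^sub>R \<bar>-1\<bar>)"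
      using lborel_has_bochner_integral_real_affine_iff[of "-1" "\<lambda>x. g x * indicator {-b..-a} x" "f (-a) - f (-b)" 0]
        I[of "-b" "-a"] that by simp
    moreover have "(\<lambda>x. g (0 + (-1) * x) * indicator {-b..-a} (0 + (-1) * x)) = (\<lambda>x. g (- x) * indicator {a..b} x)"
      by (auto simp: indicator_def)
    ultimately show ?thesis by simp
  qed
  from AE_lborel_uminus[OF right_derivative_AE[of "\<lambda>x. g (- x)" "\<lambda>x. - f (- x)", OF I']]
  have left: "AE x in lborel. ((\<lambda>h. (- f (x - h) + f x) / h) \<longlongrightarrow> g x) (at_right 0)"
    by simp
  have right: "AE x in lborel. ((\<lambda>h. (f (x + h) - f x) / h) \<longlongrightarrow> g x) (at_right 0)"
    using I by (rule right_derivative_AE)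
  have "AE x in lborel. (f has_real_derivative g x) (at x)"
    using left right
  proof eventually_elim
    case (elim x)
    have "((\<lambda>h. (f (x + h) - f x) / h) \<longlongrightarrow> g x) (at_left 0)"
      unfolding at_left_minus[of 0] filterlim_filtermap
      using elim(1) by (simp add: minus_divide_left)
    with elim(2) have "((\<lambda>h. (f (x + h) - f x) / h) \<longlongrightarrow> g x) (at 0)"
      using filterlim_split_at by blast
    then show ?case by (simp add: DERIV_def)
  qed
  with g I show ?thesis using that by blast
qed

section \<open>Hoelder and Loomis--Whitney inequalities\<close>

lemma ennreal_power_mono_iff:
  fixes a b :: ennreal
  assumes "m > 0"
  shows "a ^ m \<le> b ^ m \<longleftrightarrow> a \<le> b"
proof
  assume le: "a ^ m \<le> b ^ m"
  show "a \<le> b"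
  proof (cases a; cases b)
    fix x y assume "0 \<le> x" "a = ennreal x" "0 \<le> y" "b = ennreal y"
    with le assms show ?thesis by (simp add: ennreal_power)
  next
    fix y assume "a = top" "0 \<le> y" "b = ennreal y"
    with le assms show ?thesis by (simp add: ennreal_power top_power_ennreal top_unique split: if_splits)
  qed auto
qed (rule power_mono, auto)

text \<open>Hoelder's inequality with \<open>m\<close> equal exponents, kept in \<open>m\<close>-th
  powers so that no roots of extended reals occur. The factor \<open>c\<close> does not depend on
  the integration variable; in the Loomis-Whitney induction it is the factor already integrated in
  that variable.\<close>

lemma nn_integral_Hoelder_prod:
  fixes A :: "'a \<Rightarrow> ennreal" and B :: "'b \<Rightarrow> 'a \<Rightarrow> ennreal" and c :: ennreal
  assumes S: "finite S" "card S = m" "m > 0"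
    and [measurable]: "A \<in> borel_measurable M" "\<And>l. l \<in> S \<Longrightarrow> B l \<in> borel_measurable M"
    and le: "\<And>x. x \<in> space M \<Longrightarrow> A x ^ m \<le> c * (\<Prod>l\<in>S. B l x)"
  shows "(\<integral>\<^sup>+x. A x \<partial>M) ^ m \<le> c * (\<Prod>l\<in>S. \<integral>\<^sup>+x. B l x \<partial>M)"
proof -
  define \<beta> where "\<beta> l = (\<integral>\<^sup>+x. B l x \<partial>M)" for l
  have zero: ?thesis if "AE x in M. A x = 0"
  proof -
    have "(\<integral>\<^sup>+x. A x \<partial>M) = 0" using that by (simp add: nn_integral_0_iff_AE)
    then show ?thesis using S by (simp add: zero_power)
  qed
  \<comment> \<open>Zero times infinity is zero in \<open>ennreal\<close>, so an infinite factor
    settles the claim only once vanishing ones are excluded; a vanishing factor forces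
    \<open>A\<close> to vanish almost everywhere.\<close>
  consider (c0) "c = 0" | (b0) l where "l \<in> S" "\<beta> l = 0"
    | (top) "c \<noteq> 0" "\<forall>l\<in>S. \<beta> l \<noteq> 0" "c = \<infinity> \<or> (\<exists>l\<in>S. \<beta> l = \<infinity>)"
    | (fin) "c \<noteq> 0" "c \<noteq> \<infinity>" "\<forall>l\<in>S. \<beta> l \<noteq> 0 \<and> \<beta> l \<noteq> \<infinity>" by blast
  then show ?thesis
  proof cases
    case c0
    then show ?thesis using le S by (intro zero AE_I2) (force)
  next
    case b0
    then have "AE x in M. B l x = 0" by (simp add: \<beta>_def nn_integral_0_iff_AE)
    then have "AE x in M. A x = 0"
      using AE_space
    proof eventually_elim
      case (elim x)
      then have "(\<Prod>l\<in>S. B l x) = 0" using b0 S by (auto simp: prod_zero_iff)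
      with le[of x] elim show ?case using S by simp
    qed
    then show ?thesis by (rule zero)
  next
    case top
    have "c * (\<Prod>l\<in>S. \<beta> l) = \<infinity>"
    proof -
      have "(\<Prod>l\<in>S. \<beta> l) \<noteq> 0" using top S by (simp add: prod_zero_iff)
      moreover have "(\<Prod>l\<in>S. \<beta> l) = \<infinity>" if "\<exists>l\<in>S. \<beta> l = \<infinity>"
        using that top S ennreal_prod_eq_top[of \<beta> S] by auto
      ultimately show ?thesis using top by (auto simp: ennreal_mult_eq_top_iff)
    qed
    then show ?thesis by (simp add: \<beta>_def)
  next
    case fin
    define c' where "c' = enn2real c"
    define b where "b l = enn2real (\<beta> l)" for l
    have c': "c = ennreal c'" "c' > 0"
      using fin by (auto simp: c'_def enn2real_positive_iff less_top zero_less_iff_neq_zero)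
    have b: "\<beta> l = ennreal (b l)" "b l > 0" if "l \<in> S" for l
      using fin that by (auto simp: b_def enn2real_positive_iff less_top zero_less_iff_neq_zero)
    \<comment> \<open>\<alpha> is the bound sought for the integral of \<open>A\<close>. By the
      inequality of arithmetic and geometric means, \<open>A\<close> is at most \<alpha> times the
      mean of the quotients \<open>B l x / \<beta> l\<close>, each of which has integral 1.\<close>
    define \<alpha> where "\<alpha> = root m (c' * (\<Prod>l\<in>S. b l))"
    have pb: "(\<Prod>l\<in>S. b l) > 0" using b by (intro prod_pos) auto
    have \<alpha>: "\<alpha> > 0" "\<alpha> ^ m = c' * (\<Prod>l\<in>S. b l)"
      using S c' pb by (auto simp: \<alpha>_def)
    have amgm: "A x \<le> (\<Sum>l\<in>S. ennreal (\<alpha> / (m * b l)) * B l x)" if x: "x \<in> space M" for x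
    proof (cases "\<exists>l\<in>S. B l x = \<infinity>")
      case True
      then obtain l where l: "l \<in> S" "B l x = \<infinity>" by blast
      then have "ennreal (\<alpha> / (m * b l)) * B l x = \<infinity>"
        using \<alpha> b[of l] S by (simp add: ennreal_mult_eq_top_iff)
      then have "(\<Sum>l\<in>S. ennreal (\<alpha> / (m * b l)) * B l x) = \<infinity>"
        using S(1) l(1) unfolding infinity_ennreal_def ennreal_sum_eq_top[OF S(1)] by blast
      then show ?thesis by simp
    next
      case False
      define z where "z l = enn2real (B l x)" for l
      have z: "B l x = ennreal (z l)" "z l \<ge> 0" if "l \<in> S" for l
        using False that by (auto simp: z_def less_top)
      have A: "A x ^ m \<le> ennreal (c' * (\<Prod>l\<in>S. z l))"
        using le[OF x] z c' by (simp add: prod_ennreal ennreal_mult prod_nonneg)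
      have "c' * (\<Prod>l\<in>S. z l) = \<alpha> ^ m * (\<Prod>l\<in>S. z l / b l)"
        using pb by (simp add: \<alpha> prod_dividef)
      also have "\<dots> \<le> (\<Sum>l\<in>S. \<alpha> / (m * b l) * z l) ^ m"
      proof -
        have nn: "(\<Prod>l\<in>S. z l / b l) \<ge> 0" using z b by (intro prod_nonneg) (auto simp: less_imp_le)
        have "(\<Prod>l\<in>S. z l / b l) powr (1 / m) \<le> (\<Sum>l\<in>S. z l / b l / m)"
          using arith_geom_mean[of S "\<lambda>l. z l / b l"] S z b by (fastforce simp: less_imp_le)
        then have "((\<Prod>l\<in>S. z l / b l) powr (1 / m)) ^ m \<le> (\<Sum>l\<in>S. z l / b l / m) ^ m"
          by (intro power_mono) auto
        moreover have "((\<Prod>l\<in>S. z l / b l) powr (1 / m)) ^ m = (\<Prod>l\<in>S. z l / b l)"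
        proof -
          have "(t powr (1 / m)) ^ m = t" if "t \<ge> 0" for t :: real
            using that S by (cases "t = 0") (auto simp: powr_realpow[symmetric] powr_powr zero_power)
          then show ?thesis using nn by blast
        qed
        ultimately have "\<alpha> ^ m * (\<Prod>l\<in>S. z l / b l) \<le> (\<alpha> * (\<Sum>l\<in>S. z l / b l / m)) ^ m"
          using \<alpha>(1) by (simp add: power_mult_distrib)
        then show ?thesis by (simp add: sum_distrib_left field_simps)
      qed
      finally have "ennreal (c' * (\<Prod>l\<in>S. z l)) \<le> ennreal ((\<Sum>l\<in>S. \<alpha> / (m * b l) * z l) ^ m)"
        by (rule ennreal_leI)
      with A have "A x ^ m \<le> ennreal ((\<Sum>l\<in>S. \<alpha> / (m * b l) * z l) ^ m)"
        by (rule order_trans)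
      then have "A x ^ m \<le> ennreal (\<Sum>l\<in>S. \<alpha> / (m * b l) * z l) ^ m"
        using z b \<alpha> by (subst ennreal_power) (auto intro!: sum_nonneg mult_nonneg_nonneg divide_nonneg_nonneg simp: less_imp_le)
      then have "A x \<le> ennreal (\<Sum>l\<in>S. \<alpha> / (m * b l) * z l)"
        using S by (simp add: ennreal_power_mono_iff)
      also have "\<dots> = (\<Sum>l\<in>S. ennreal (\<alpha> / (m * b l) * z l))"
        using z b \<alpha> by (subst sum_ennreal) (auto intro!: mult_nonneg_nonneg divide_nonneg_nonneg simp: less_imp_le)
      also have "\<dots> = (\<Sum>l\<in>S. ennreal (\<alpha> / (m * b l)) * B l x)"
        using z b \<alpha> by (intro sum.cong refl) (simp add: ennreal_mult[symmetric] less_imp_le)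
      finally show ?thesis .
    qed
    have "(\<integral>\<^sup>+x. A x \<partial>M) \<le> (\<integral>\<^sup>+x. (\<Sum>l\<in>S. ennreal (\<alpha> / (m * b l)) * B l x) \<partial>M)"
      by (intro nn_integral_mono amgm)
    also have "\<dots> = (\<Sum>l\<in>S. ennreal (\<alpha> / (m * b l)) * \<beta> l)"
      by (subst nn_integral_sum) (auto simp: nn_integral_cmult \<beta>_def)
    also have "\<dots> = (\<Sum>l\<in>S. ennreal (\<alpha> / m))"
      using b \<alpha> S by (intro sum.cong refl) (force simp: ennreal_mult'[symmetric] less_imp_le)
    also have "\<dots> = ennreal \<alpha>"
      using S \<alpha>(1) by (simp add: ennreal_of_nat_eq_real_of_nat ennreal_mult'[symmetric])
    finally have "(\<integral>\<^sup>+x. A x \<partial>M) ^ m \<le> ennreal \<alpha> ^ m" by (rule power_mono) simp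
    also have "\<dots> = ennreal (c' * (\<Prod>l\<in>S. b l))" using \<alpha> by (simp add: ennreal_power)
    also have "\<dots> = c * (\<Prod>l\<in>S. \<beta> l)"
      using c' b by (simp add: ennreal_mult' prod_ennreal[symmetric] less_imp_le)
    finally show ?thesis by (simp add: \<beta>_def)
  qed
qed

text \<open>Induction on the set \<open>K\<close> of variables still to be integrated. A factor with
  index in \<open>K\<close> appears integrated in its own variable; when that variable is integrated
  out, this factor is constant in it, and Hoelder separates the other \<open>m\<close> of the
  \<open>Suc m\<close> factors. Indices of \<open>I\<close> that are not variables are allowed: in
  the application the radial direction is one, integrated beforehand.\<close>

lemma (in product_sigma_finite) nn_integral_Loomis_Whitney:
  fixes A :: "('i \<Rightarrow> 'a) \<Rightarrow> ennreal" and G :: "'i \<Rightarrow> ('i \<Rightarrow> 'a) \<Rightarrow> ennreal"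
  assumes "finite K" "finite I" "card I = Suc m" "m > 0" "K \<subseteq> I"
    and "A \<in> borel_measurable (PiM K M)" "\<And>l. l \<in> I \<Longrightarrow> G l \<in> borel_measurable (PiM K M)"
    and "\<And>y. y \<in> space (PiM K M) \<Longrightarrow>
      A y ^ m \<le> (\<Prod>l\<in>I - K. G l y) * (\<Prod>i\<in>K. \<integral>\<^sup>+t. G i (y(i := t)) \<partial>M i)"
  shows "(\<integral>\<^sup>+y. A y \<partial>PiM K M) ^ m \<le> (\<Prod>l\<in>I. \<integral>\<^sup>+y. G l y \<partial>PiM K M)"
  using assms
proof (induction K arbitrary: A G rule: finite_induct)
  case empty
  then show ?case by (simp add: nn_integral_empty space_PiM)
next
  case (insert i K)
  note [measurable] = insert.prems(5,6)
  interpret sf: sigma_finite_measure "M j" for j by (rule sigma_finite_measures)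
  interpret finite_product_sigma_finite M K by standard fact
  have i: "i \<in> I" "i \<notin> K" "K \<subseteq> I" using insert by auto
  define A' where "A' y = (\<integral>\<^sup>+t. A (y(i := t)) \<partial>M i)" for y
  define G' where "G' l y = (\<integral>\<^sup>+t. G l (y(i := t)) \<partial>M i)" for l y
  have upd: "(\<lambda>(y, t). y(i := t)) \<in> (PiM K M \<Otimes>\<^sub>M M i) \<rightarrow>\<^sub>M PiM (insert i K) M"
    by (rule measurable_add_dim)
  have A': "A' \<in> borel_measurable (PiM K M)"
    unfolding A'_def by measurable
  have G': "G' l \<in> borel_measurable (PiM K M)" if "l \<in> I" for l
    unfolding G'_def using insert.prems(6)[OF that, measurable] by measurable
  have "(\<integral>\<^sup>+y. A' y \<partial>PiM K M) ^ m \<le> (\<Prod>l\<in>I. \<integral>\<^sup>+y. G' l y \<partial>PiM K M)"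
  proof (rule insert.IH)
    fix y assume y: "y \<in> space (PiM K M)"
    have yt: "y(i := t) \<in> space (PiM (insert i K) M)" if "t \<in> space (M i)" for t
      using y that by (auto simp: space_PiM PiE_def extensional_def)
    have meas_upd: "(\<lambda>t. y(i := t)) \<in> M i \<rightarrow>\<^sub>M PiM (insert i K) M"
      using y i by (intro measurable_component_update)
    define B where "B l t = (if l \<in> K then \<integral>\<^sup>+s. G l (y(i := t, l := s)) \<partial>M l else G l (y(i := t)))" for l t
    have upd2: "(\<lambda>(t, s). y(i := t, l := s)) \<in> (M i \<Otimes>\<^sub>M M l) \<rightarrow>\<^sub>M PiM (insert i K) M" if "l \<in> K" for l
    proof (rule measurable_PiM_single')
      fix j assume "j \<in> insert i K"
      then show "(\<lambda>x. (case x of (t, s) \<Rightarrow> y(i := t, l := s)) j) \<in> M i \<Otimes>\<^sub>M M l \<rightarrow>\<^sub>M M j"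
        using y i that by (cases "j = l"; cases "j = i") (auto simp: space_PiM PiE_def Pi_def split_beta')
    next
      show "(\<lambda>x. case x of (t, s) \<Rightarrow> y(i := t, l := s)) \<in> space (M i \<Otimes>\<^sub>M M l) \<rightarrow> (\<Pi>\<^sub>E j\<in>insert i K. space (M j))"
        using y i that by (auto simp: space_PiM PiE_def extensional_def space_pair_measure)
    qed
    have GG: "(\<lambda>(t, s). G l (y(i := t, l := s))) \<in> borel_measurable (M i \<Otimes>\<^sub>M M l)" if "l \<in> K" for l
      using measurable_compose[OF upd2[OF that] insert.prems(6)[of l]] that i
      by (auto simp: split_beta' simp del: fun_upd_apply)
    have Bm: "B l \<in> borel_measurable (M i)" if "l \<in> I" for l
    proof (cases "l \<in> K")
      case True
      then show ?thesis
        unfolding B_def using sigma_finite_measure.borel_measurable_nn_integral[OF sigma_finite_measures GG[OF True]] True by simp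
    next
      case False
      then show ?thesis unfolding B_def using measurable_compose[OF meas_upd insert.prems(6)[OF that]] by (simp del: fun_upd_apply)
    qed
    have Am: "(\<lambda>t. A (y(i := t))) \<in> borel_measurable (M i)"
      using measurable_compose[OF meas_upd insert.prems(5)] by (simp del: fun_upd_apply)
    have "(\<integral>\<^sup>+t. A (y(i := t)) \<partial>M i) ^ m \<le> G' i y * (\<Prod>l\<in>I - {i}. \<integral>\<^sup>+t. B l t \<partial>M i)"
    proof (rule nn_integral_Hoelder_prod)
      fix t assume t: "t \<in> space (M i)"
      have "A (y(i := t)) ^ m \<le> (\<Prod>l\<in>I - insert i K. G l (y(i := t))) *
          (\<Prod>j\<in>insert i K. \<integral>\<^sup>+s. G j (y(i := t, j := s)) \<partial>M j)"
        by (rule insert.prems(7)[OF yt[OF t]])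
      also have "\<dots> = G' i y * ((\<Prod>l\<in>I - insert i K. B l t) * (\<Prod>j\<in>K. B j t))"
        using i insert.hyps by (simp add: G'_def B_def mult_ac)
      also have "(\<Prod>l\<in>I - insert i K. B l t) * (\<Prod>j\<in>K. B j t) = (\<Prod>l\<in>I - {i}. B l t)"
        using i insert.prems(1) insert.hyps
        by (subst prod.union_disjoint[symmetric]) (auto intro!: prod.cong)
      finally show "A (y(i := t)) ^ m \<le> G' i y * (\<Prod>l\<in>I - {i}. B l t)" .
    qed (use insert.prems(1-3) i Bm Am in auto)
    \<comment> \<open>Fubini exchanges the integration in \<open>i\<close> with the one in
      \<open>j\<close> already present in \<open>B j\<close>, which turns \<open>G\<close> into
      \<open>G'\<close>.\<close>
    also have "(\<Prod>l\<in>I - {i}. \<integral>\<^sup>+t. B l t \<partial>M i) =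
        (\<Prod>l\<in>I - insert i K. G' l y) * (\<Prod>j\<in>K. \<integral>\<^sup>+t. G' j (y(j := t)) \<partial>M j)"
    proof -
      have "(\<integral>\<^sup>+t. B j t \<partial>M i) = (\<integral>\<^sup>+t. G' j (y(j := t)) \<partial>M j)" if j: "j \<in> K" for j
      proof -
        interpret p: pair_sigma_finite "M i" "M j" ..
        have "(\<integral>\<^sup>+t. B j t \<partial>M i) = (\<integral>\<^sup>+t. (\<integral>\<^sup>+s. G j (y(i := t, j := s)) \<partial>M j) \<partial>M i)"
          using j by (simp add: B_def)
        also have "\<dots> = (\<integral>\<^sup>+s. (\<integral>\<^sup>+t. G j (y(i := t, j := s)) \<partial>M i) \<partial>M j)"
          using p.Fubini'[OF GG[OF j]] by simp
        also have "\<dots> = (\<integral>\<^sup>+s. G' j (y(j := s)) \<partial>M j)"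
        proof -
          have "i \<noteq> j" using i j by blast
          then show ?thesis by (simp add: G'_def fun_upd_twist[of i j])
        qed
        finally show ?thesis .
      qed
      then have "(\<Prod>l\<in>K. \<integral>\<^sup>+t. B l t \<partial>M i) = (\<Prod>j\<in>K. \<integral>\<^sup>+t. G' j (y(j := t)) \<partial>M j)"
        by (intro prod.cong refl)
      moreover have "(\<Prod>l\<in>I - insert i K. \<integral>\<^sup>+t. B l t \<partial>M i) = (\<Prod>l\<in>I - insert i K. G' l y)"
        by (intro prod.cong refl) (simp add: B_def G'_def)
      moreover have "(\<Prod>l\<in>(I - insert i K) \<union> K. \<integral>\<^sup>+t. B l t \<partial>M i) =
          (\<Prod>l\<in>I - insert i K. \<integral>\<^sup>+t. B l t \<partial>M i) * (\<Prod>l\<in>K. \<integral>\<^sup>+t. B l t \<partial>M i)"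
        using insert.prems(1) insert.hyps by (intro prod.union_disjoint) auto
      moreover have "I - {i} = (I - insert i K) \<union> K" using i by auto
      ultimately show ?thesis by (simp only:)
    qed
    also have "G' i y * ((\<Prod>l\<in>I - insert i K. G' l y) * (\<Prod>j\<in>K. \<integral>\<^sup>+t. G' j (y(j := t)) \<partial>M j)) =
        (\<Prod>l\<in>I - K. G' l y) * (\<Prod>j\<in>K. \<integral>\<^sup>+t. G' j (y(j := t)) \<partial>M j)"
    proof -
      have eq: "I - K = insert i (I - insert i K)" using i by auto
      have "(\<Prod>l\<in>I - K. G' l y) = G' i y * (\<Prod>l\<in>I - insert i K. G' l y)"
        unfolding eq by (rule prod.insert) (use insert.prems(1) in auto)
      then show ?thesis by (simp only: mult.assoc)
    qed
    finally show "A' y ^ m \<le> (\<Prod>l\<in>I - K. G' l y) * (\<Prod>j\<in>K. \<integral>\<^sup>+t. G' j (y(j := t)) \<partial>M j)"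
      unfolding A'_def .
  qed (use insert.prems(1-3) i A' G' in auto)
  moreover have "(\<integral>\<^sup>+y. A y \<partial>PiM (insert i K) M) = (\<integral>\<^sup>+y. A' y \<partial>PiM K M)"
    unfolding A'_def by (rule product_nn_integral_insert[OF insert.hyps insert.prems(5)])
  moreover have "(\<integral>\<^sup>+y. G l y \<partial>PiM (insert i K) M) = (\<integral>\<^sup>+y. G' l y \<partial>PiM K M)" if "l \<in> I" for l
    unfolding G'_def by (rule product_nn_integral_insert[OF insert.hyps insert.prems(6)[OF that]])
  ultimately show ?case by (simp cong: prod.cong)
qed

section \<open>Integration in cones\<close>

interpretation lborel_product: product_sigma_finite "\<lambda>_::'a. lborel :: real measure"
  by standard

lemma measurable_upd_lborel:
  assumes "i \<notin> I" "f \<in> borel_measurable (PiM (insert i I) (\<lambda>_. lborel :: real measure))"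
  shows "(\<lambda>(x, t). f (x(i := t))) \<in> borel_measurable (PiM I (\<lambda>_. lborel) \<Otimes>\<^sub>M lborel)"
  using measurable_compose[OF measurable_add_dim assms(2)] by (simp add: split_beta' del: fun_upd_apply)

lemma nn_integral_scale_interval:
  fixes h :: "real \<Rightarrow> ennreal"
  assumes [measurable]: "h \<in> borel_measurable borel" and s: "s > 0"
  shows "(\<integral>\<^sup>+t. indicator {-s..s} t * h t \<partial>lborel) = ennreal s * (\<integral>\<^sup>+t. indicator {-1..1} t * h (s * t) \<partial>lborel)"
proof -
  have "(\<integral>\<^sup>+t. indicator {-s..s} t * h t \<partial>lborel) = ennreal \<bar>s\<bar> * (\<integral>\<^sup>+t. indicator {-s..s} (0 + s * t) * h (0 + s * t) \<partial>lborel)"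
    by (rule nn_integral_real_affine) (use s in auto)
  moreover have "(indicator {-s..s} (s * t) :: ennreal) = indicator {-1..1} t" for t
  proof -
    have "- s \<le> s * t \<longleftrightarrow> - 1 \<le> t" using s mult_le_cancel_left_pos[of s "-1" t] by simp
    moreover have "s * t \<le> s \<longleftrightarrow> t \<le> 1" using s mult_le_cancel_left_pos[of s t 1] by simp
    ultimately show ?thesis by (auto simp: indicator_def)
  qed
  ultimately show ?thesis using s by simp
qed

text \<open>The one-variable substitution is applied to one coordinate after the other, each
  contributing a factor \<open>s\<close>. This power of \<open>s\<close> becomes the Jacobian of the
  cone coordinates.\<close>

lemma nn_integral_PiM_scale_cube:
  fixes f :: "('i \<Rightarrow> real) \<Rightarrow> ennreal"
  assumes "finite I" and s: "s > 0" and "f \<in> borel_measurable (PiM I (\<lambda>_. lborel))"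
  shows "(\<integral>\<^sup>+y. (\<Prod>b\<in>I. indicator {-s..s} (y b)) * f y \<partial>PiM I (\<lambda>_. lborel)) =
    ennreal (s ^ card I) *
    (\<integral>\<^sup>+y. (\<Prod>b\<in>I. indicator {-1..1} (y b)) * f (\<lambda>b\<in>I. s * y b) \<partial>PiM I (\<lambda>_. lborel))"
  using assms(1,3)
proof (induction I arbitrary: f rule: finite_induct)
  case empty
  then show ?case by (simp add: lborel_product.nn_integral_empty restrict_def space_PiM)
next
  case (insert i I)
  note f[measurable] = insert.prems
  have m1[measurable]: "(\<lambda>y. \<Prod>b\<in>I. indicator {-s..s} (y b) :: ennreal) \<in> borel_measurable (PiM J (\<lambda>_. lborel))"
    if "I \<subseteq> J" for s :: real and J using that
    by (intro borel_measurable_prod_ennreal) (auto intro!: measurable_compose[OF measurable_component_singleton] borel_measurable_indicator)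
  have sc[measurable]: "(\<lambda>y. \<lambda>b\<in>J. s * y b) \<in> PiM J (\<lambda>_. lborel) \<rightarrow>\<^sub>M PiM J (\<lambda>_. lborel)" for J :: "'i set"
    by (rule measurable_restrict) (auto intro!: borel_measurable_times)
  have upd: "(\<lambda>t. y(i := t)) \<in> lborel \<rightarrow>\<^sub>M PiM (insert i I) (\<lambda>_. lborel :: real measure)"
    if "y \<in> space (PiM I (\<lambda>_. lborel :: real measure))" for y
    using that insert by (intro measurable_component_update)
  define F where "F y = (\<integral>\<^sup>+t. indicator {-1..1} t * f (y(i := s * t)) \<partial>lborel)" for y
  have fm: "(\<lambda>(y, t). f (y(i := t))) \<in> borel_measurable (PiM I (\<lambda>_. lborel) \<Otimes>\<^sub>M lborel)"
    by (rule measurable_upd_lborel) (use insert in auto)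
  have "(\<lambda>(y, t). f (y(i := s * t))) \<in> borel_measurable (PiM I (\<lambda>_. lborel) \<Otimes>\<^sub>M lborel)"
    using measurable_compose[OF _ fm, of "\<lambda>(y, t). (y, s * t)" "PiM I (\<lambda>_. lborel) \<Otimes>\<^sub>M lborel"]
    by (simp add: split_beta')
  then have Fm: "F \<in> borel_measurable (PiM I (\<lambda>_. lborel))"
    unfolding F_def by measurable
  have I: "I \<subseteq> insert i I" by auto
  have "(\<integral>\<^sup>+y. (\<Prod>b\<in>insert i I. indicator {-s..s} (y b)) * f y \<partial>PiM (insert i I) (\<lambda>_. lborel)) =
     (\<integral>\<^sup>+y. \<integral>\<^sup>+t. (\<Prod>b\<in>insert i I. indicator {-s..s} ((y(i := t)) b)) * f (y(i := t)) \<partial>lborel \<partial>PiM I (\<lambda>_. lborel))"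
    using insert.hyps m1[OF I, of s] by (intro lborel_product.product_nn_integral_insert) auto
  also have "\<dots> = (\<integral>\<^sup>+y. (\<Prod>b\<in>I. indicator {-s..s} (y b)) * (ennreal s * F y) \<partial>PiM I (\<lambda>_. lborel))"
  proof (rule nn_integral_cong)
    fix y assume y: "y \<in> space (PiM I (\<lambda>_. lborel :: real measure))"
    have fy: "(\<lambda>t. f (y(i := t))) \<in> borel_measurable borel"
      using measurable_compose[OF upd[OF y] f] by (simp del: fun_upd_apply)
    have "(\<integral>\<^sup>+t. (\<Prod>b\<in>insert i I. indicator {-s..s} ((y(i := t)) b)) * f (y(i := t)) \<partial>lborel) =
      (\<integral>\<^sup>+t. (\<Prod>b\<in>I. indicator {-s..s} (y b)) * (indicator {-s..s} t * f (y(i := t))) \<partial>lborel)"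
    proof (rule nn_integral_cong)
      fix t
      have "(\<Prod>b\<in>I. indicator {-s..s} ((y(i := t)) b)) = (\<Prod>b\<in>I. indicator {-s..s} (y b) :: ennreal)"
        using insert.hyps by (intro prod.cong) auto
      then show "(\<Prod>b\<in>insert i I. indicator {-s..s} ((y(i := t)) b)) * f (y(i := t)) =
         (\<Prod>b\<in>I. indicator {-s..s} (y b)) * (indicator {-s..s} t * f (y(i := t)))"
        using insert.hyps by (simp add: mult_ac)
    qed
    also have "\<dots> = (\<Prod>b\<in>I. indicator {-s..s} (y b)) * (ennreal s * F y)"
      unfolding F_def nn_integral_scale_interval[OF fy s, symmetric]
      using fy by (intro nn_integral_cmult) auto
    finally show "(\<integral>\<^sup>+t. (\<Prod>b\<in>insert i I. indicator {-s..s} ((y(i := t)) b)) * f (y(i := t)) \<partial>lborel) =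
       (\<Prod>b\<in>I. indicator {-s..s} (y b)) * (ennreal s * F y)" .
  qed
  also have "\<dots> = ennreal (s ^ card I) *
    (\<integral>\<^sup>+y. (\<Prod>b\<in>I. indicator {-1..1} (y b)) * (ennreal s * F (\<lambda>b\<in>I. s * y b)) \<partial>PiM I (\<lambda>_. lborel))"
    using Fm by (intro insert.IH) simp
  also have "\<dots> = ennreal (s ^ card (insert i I)) *
    (\<integral>\<^sup>+y. (\<Prod>b\<in>I. indicator {-1..1} (y b)) * F (\<lambda>b\<in>I. s * y b) \<partial>PiM I (\<lambda>_. lborel))"
    using measurable_compose[OF sc Fm] s insert.hyps m1[of I 1]
    by (subst mult.left_commute, subst nn_integral_cmult) (auto simp: ennreal_mult mult_ac)
  also have "(\<integral>\<^sup>+y. (\<Prod>b\<in>I. indicator {-1..1} (y b)) * F (\<lambda>b\<in>I. s * y b) \<partial>PiM I (\<lambda>_. lborel)) =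
    (\<integral>\<^sup>+y. \<integral>\<^sup>+t. (\<Prod>b\<in>insert i I. indicator {-1..1} ((y(i := t)) b)) * f (\<lambda>b\<in>insert i I. s * (y(i := t)) b) \<partial>lborel \<partial>PiM I (\<lambda>_. lborel))"
  proof (rule nn_integral_cong)
    fix y assume y: "y \<in> space (PiM I (\<lambda>_. lborel :: real measure))"
    have y': "(\<lambda>b\<in>I. s * y b) \<in> space (PiM I (\<lambda>_. lborel :: real measure))"
      by (simp add: space_PiM)
    have fy: "(\<lambda>t. f ((\<lambda>b\<in>I. s * y b)(i := t))) \<in> borel_measurable borel"
      using measurable_compose[OF upd[OF y'] f] by (simp del: fun_upd_apply)
    have fy': "(\<lambda>t. f ((\<lambda>b\<in>I. s * y b)(i := s * t))) \<in> borel_measurable borel"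
      using measurable_compose[OF _ fy, of "\<lambda>t. s * t" borel] by simp
    have "(\<Prod>b\<in>I. indicator {-1..1} (y b)) * F (\<lambda>b\<in>I. s * y b) =
      (\<integral>\<^sup>+t. (\<Prod>b\<in>I. indicator {-1..1} (y b)) * (indicator {-1..1} t * f ((\<lambda>b\<in>I. s * y b)(i := s * t))) \<partial>lborel)"
      unfolding F_def using fy' by (intro nn_integral_cmult[symmetric]) auto
    also have "\<dots> = (\<integral>\<^sup>+t. (\<Prod>b\<in>insert i I. indicator {-1..1} ((y(i := t)) b)) * f (\<lambda>b\<in>insert i I. s * (y(i := t)) b) \<partial>lborel)"
    proof (rule nn_integral_cong)
      fix t
      have "(\<Prod>b\<in>I. indicator {-1..1} ((y(i := t)) b)) = (\<Prod>b\<in>I. indicator {-1..1} (y b) :: ennreal)"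
        using insert.hyps by (intro prod.cong) auto
      moreover have "(\<lambda>b\<in>I. s * y b)(i := s * t) = (\<lambda>b\<in>insert i I. s * (y(i := t)) b)"
        using insert.hyps by (auto simp: fun_eq_iff)
      ultimately show "(\<Prod>b\<in>I. indicator {-1..1} (y b)) * (indicator {-1..1} t * f ((\<lambda>b\<in>I. s * y b)(i := s * t))) =
        (\<Prod>b\<in>insert i I. indicator {-1..1} ((y(i := t)) b)) * f (\<lambda>b\<in>insert i I. s * (y(i := t)) b)"
        using insert.hyps by (simp add: mult_ac)
    qed
    finally show "(\<Prod>b\<in>I. indicator {-1..1} (y b)) * F (\<lambda>b\<in>I. s * y b) =
      (\<integral>\<^sup>+t. (\<Prod>b\<in>insert i I. indicator {-1..1} ((y(i := t)) b)) * f (\<lambda>b\<in>insert i I. s * (y(i := t)) b) \<partial>lborel)" .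
  qed
  also have "\<dots> = (\<integral>\<^sup>+y. (\<Prod>b\<in>insert i I. indicator {-1..1} (y b)) * f (\<lambda>b\<in>insert i I. s * y b) \<partial>PiM (insert i I) (\<lambda>_. lborel))"
    using insert.hyps m1[OF I, of 1] measurable_compose[OF sc f]
    by (intro lborel_product.product_nn_integral_insert[symmetric]) auto
  finally show ?case .
qed

section \<open>Cone coordinates: height along the axis, slopes, and distance to the origin\<close>

definition axis_cone :: "'a::euclidean_space \<Rightarrow> 'a set" where
  "axis_cone e = {x. 0 < x \<bullet> e \<and> (\<forall>b\<in>Basis. \<bar>x \<bullet> b\<bar> \<le> x \<bullet> e)}"

text \<open>The point of the cone at height 1 with slopes \<open>y\<close>; its multiple by
  \<open>s\<close> is the point at height \<open>s\<close> on the same ray.\<close>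

definition slope :: "'a::euclidean_space \<Rightarrow> ('a \<Rightarrow> real) \<Rightarrow> 'a" where
  "slope e y = e + (\<Sum>b\<in>Basis - {e}. y b *\<^sub>R b)"

definition dir :: "'a::euclidean_space \<Rightarrow> ('a \<Rightarrow> real) \<Rightarrow> 'a" where
  "dir e y = slope e y /\<^sub>R norm (slope e y)"

definition cube :: "'a::euclidean_space \<Rightarrow> ('a \<Rightarrow> real) \<Rightarrow> ennreal" where
  "cube e y = (\<Prod>b\<in>Basis - {e}. indicator {-1..1} (y b))"

abbreviation slopes :: "'a::euclidean_space \<Rightarrow> ('a \<Rightarrow> real) measure" where
  "slopes e \<equiv> PiM (Basis - {e}) (\<lambda>_. lborel)"

lemma axis_cone_measurable [measurable]: "axis_cone e \<in> sets borel"
  unfolding axis_cone_def by measurable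

lemma slope_measurable [measurable]: "slope e \<in> borel_measurable (slopes e)"
  unfolding slope_def by measurable

lemma dir_measurable [measurable]: "dir e \<in> borel_measurable (slopes e)"
  unfolding dir_def by measurable

lemma cube_measurable [measurable]: "cube e \<in> borel_measurable (slopes e)"
  unfolding cube_def
  by (intro borel_measurable_prod_ennreal) (auto intro!: measurable_compose[OF measurable_component_singleton] borel_measurable_indicator)

lemma slope_inner:
  assumes "e \<in> Basis" "b \<in> Basis"
  shows "slope e y \<bullet> b = (if b = e then 1 else y b)"
proof -
  have "(\<Sum>c\<in>Basis - {e}. y c *\<^sub>R c) \<bullet> b = (\<Sum>c\<in>Basis - {e}. if c = b then y b else 0)"
    unfolding inner_sum_left using assms by (intro sum.cong) (auto simp: inner_Basis)
  then show ?thesis using assms by (auto simp: slope_def inner_add_left inner_Basis)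
qed

lemma norm_slope_ge_1: "e \<in> Basis \<Longrightarrow> norm (slope e y) \<ge> 1"
  using Basis_le_norm[of e "slope e y"] slope_inner[of e e y] by simp

lemma norm_dir: "e \<in> Basis \<Longrightarrow> norm (dir e y) = 1"
  using norm_slope_ge_1[of e y] by (cases "slope e y = 0") (auto simp: dir_def)

lemma norm_slope_le:
  fixes e :: "'a::euclidean_space"
  assumes "e \<in> Basis" "cube e y \<noteq> 0"
  shows "norm (slope e y) \<le> DIM('a)"
proof -
  have "\<bar>slope e y \<bullet> b\<bar> \<le> 1" if "b \<in> Basis" for b
    using assms that by (auto simp: slope_inner cube_def indicator_def abs_le_iff split: if_splits)
  then have "(\<Sum>b\<in>Basis. \<bar>slope e y \<bullet> b\<bar>) \<le> (\<Sum>b\<in>(Basis::'a set). 1)"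
    by (intro sum_mono)
  then show ?thesis using norm_le_l1[of "slope e y"] by simp
qed

text \<open>At fixed height \<open>s\<close> along \<open>e\<close> the cone is the cube of
  half-side \<open>s\<close> in the remaining coordinates. Rescaling it to the unit cube replaces
  these coordinates by slopes and produces \<open>s ^ (n - 1)\<close>.\<close>

lemma nn_integral_cone_slopes:
  fixes f :: "'a::euclidean_space \<Rightarrow> ennreal"
  assumes [measurable]: "f \<in> borel_measurable borel" and e: "e \<in> Basis"
  shows "(\<integral>\<^sup>+x. indicator (axis_cone e) x * f x \<partial>lborel) =
    (\<integral>\<^sup>+y. cube e y * (\<integral>\<^sup>+s. indicator {0<..} s * (ennreal (s ^ (DIM('a) - 1)) * f (s *\<^sub>R slope e y)) \<partial>lborel) \<partial>slopes e)"
proof -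
  let ?J = "Basis - {e} :: 'a set"
  have J: "finite ?J" "e \<notin> ?J" "insert e ?J = Basis" "card ?J = DIM('a) - 1" using e by auto
  define g where "g x = indicator (axis_cone e) x * f x" for x
  have g[measurable]: "g \<in> borel_measurable borel" unfolding g_def by measurable
  define emb where "emb y = (\<Sum>b\<in>Basis. y b *\<^sub>R b)" for y :: "'a \<Rightarrow> real"
  have emb[measurable]: "emb \<in> borel_measurable (PiM Basis (\<lambda>_. lborel))"
    unfolding emb_def by measurable
  have emb_upd: "emb (y(e := s)) = s *\<^sub>R e + (\<Sum>b\<in>?J. y b *\<^sub>R b)" for y s
    unfolding emb_def using e by (subst sum.remove[of _ e]) (auto intro!: sum.cong)
  have emb_inner: "emb y \<bullet> b = y b" if "b \<in> Basis" for y b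
    using that by (simp add: emb_def)
  have "(\<integral>\<^sup>+x. g x \<partial>lborel) = (\<integral>\<^sup>+y. g (emb y) \<partial>PiM Basis (\<lambda>_. lborel))"
    by (subst lborel_eq) (simp add: nn_integral_distr emb_def[symmetric] emb_def[abs_def, symmetric])
  also have "\<dots> = (\<integral>\<^sup>+y. g (emb y) \<partial>PiM (insert e ?J) (\<lambda>_. lborel))" by (simp only: J(3))
  also have "\<dots> = (\<integral>\<^sup>+s. \<integral>\<^sup>+y. g (emb (y(e := s))) \<partial>PiM ?J (\<lambda>_. lborel) \<partial>lborel)"
    using J(1,2) measurable_compose[OF emb g] by (intro lborel_product.product_nn_integral_insert_rev) (simp_all only: J(3) not_False_eq_True)
  also have "\<dots> = (\<integral>\<^sup>+s. \<integral>\<^sup>+y. cube e y * (indicator {0<..} s * (ennreal (s ^ (DIM('a) - 1)) * f (s *\<^sub>R slope e y))) \<partial>slopes e \<partial>lborel)"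
  proof (rule nn_integral_cong)
    fix s :: real
    show "(\<integral>\<^sup>+y. g (emb (y(e := s))) \<partial>PiM ?J (\<lambda>_. lborel)) =
      (\<integral>\<^sup>+y. cube e y * (indicator {0<..} s * (ennreal (s ^ (DIM('a) - 1)) * f (s *\<^sub>R slope e y))) \<partial>slopes e)"
    proof (cases "s > 0")
      case False
      then have "g (emb (y(e := s))) = 0" for y
        using e by (simp add: g_def axis_cone_def emb_inner)
      then show ?thesis using False by simp
    next
      case True
      define h where "h y = f (s *\<^sub>R e + (\<Sum>b\<in>?J. y b *\<^sub>R b))" for y
      have h: "h \<in> borel_measurable (PiM ?J (\<lambda>_. lborel))" unfolding h_def by measurable
      have "g (emb (y(e := s))) = (\<Prod>b\<in>?J. indicator {-s..s} (y b)) * h y" for y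
      proof -
        have "emb (y(e := s)) \<in> axis_cone e \<longleftrightarrow> (\<forall>b\<in>?J. y b \<in> {-s..s})"
          using e True by (auto simp: axis_cone_def emb_inner abs_le_iff minus_le_iff)
        then have "(indicator (axis_cone e) (emb (y(e := s))) :: ennreal) = (\<Prod>b\<in>?J. indicator {-s..s} (y b))"
          by (auto simp: indicator_def)
        then show ?thesis by (simp add: g_def h_def emb_upd del: fun_upd_apply)
      qed
      then have "(\<integral>\<^sup>+y. g (emb (y(e := s))) \<partial>PiM ?J (\<lambda>_. lborel)) =
          ennreal (s ^ card ?J) * (\<integral>\<^sup>+y. cube e y * h (\<lambda>b\<in>?J. s * y b) \<partial>slopes e)"
        using nn_integral_PiM_scale_cube[OF J(1) True h] by (simp add: cube_def)
      also have "(\<lambda>y. h (\<lambda>b\<in>?J. s * y b)) = (\<lambda>y. f (s *\<^sub>R slope e y))"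
        by (simp add: h_def slope_def scaleR_add_right scaleR_sum_right)
      also have "ennreal (s ^ card ?J) * (\<integral>\<^sup>+y. cube e y * f (s *\<^sub>R slope e y) \<partial>slopes e) =
         (\<integral>\<^sup>+y. ennreal (s ^ card ?J) * (cube e y * f (s *\<^sub>R slope e y)) \<partial>slopes e)"
        by (intro nn_integral_cmult[symmetric]) measurable
      finally show ?thesis using True J(4) by (simp add: mult_ac del: fun_upd_apply)
    qed
  qed
  also have "\<dots> = (\<integral>\<^sup>+y. \<integral>\<^sup>+s. cube e y * (indicator {0<..} s * (ennreal (s ^ (DIM('a) - 1)) * f (s *\<^sub>R slope e y))) \<partial>lborel \<partial>slopes e)"
  proof -
    interpret p: pair_sigma_finite "lborel :: real measure" "slopes e"
      by (intro pair_sigma_finite.intro sigma_finite_lborel lborel_product.sigma_finite J)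
    show ?thesis by (rule p.Fubini'[symmetric]) measurable
  qed
  also have "\<dots> = (\<integral>\<^sup>+y. cube e y * (\<integral>\<^sup>+s. indicator {0<..} s * (ennreal (s ^ (DIM('a) - 1)) * f (s *\<^sub>R slope e y)) \<partial>lborel) \<partial>slopes e)"
    by (intro nn_integral_cong nn_integral_cmult) measurable
  finally show ?thesis by (simp add: g_def)
qed

text \<open>With \<open>r = s * norm (slope e y)\<close> in place of the height \<open>s\<close>,
  the weight |x|^(1-n) cancels the Jacobian and leaves the power 1 - n of
  \<open>norm (slope e y)\<close>; the substitution adds one more inverse factor. The inner integral
  is then unweighted in \<open>r\<close>, as the one-dimensional inequalities require.\<close>

lemma nn_integral_cone:
  fixes f :: "'a::euclidean_space \<Rightarrow> ennreal"
  assumes [measurable]: "f \<in> borel_measurable borel" and e: "e \<in> Basis"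
  shows "(\<integral>\<^sup>+x. indicator (axis_cone e) x * (f x * ennreal (norm x powr (1 - real DIM('a)))) \<partial>lborel) =
    (\<integral>\<^sup>+y. cube e y * ennreal (1 / norm (slope e y) ^ DIM('a)) *
      (\<integral>\<^sup>+r. indicator {0<..} r * f (r *\<^sub>R dir e y) \<partial>lborel) \<partial>slopes e)"
  unfolding nn_integral_cone_slopes[OF borel_measurable_times_ennreal[OF assms(1)] e]
proof (subst nn_integral_cone_slopes)
  show "e \<in> Basis" by fact
  show "(\<integral>\<^sup>+y. cube e y * (\<integral>\<^sup>+s. indicator {0<..} s * (ennreal (s ^ (DIM('a) - 1)) *
        (f (s *\<^sub>R slope e y) * ennreal (norm (s *\<^sub>R slope e y) powr (1 - real DIM('a))))) \<partial>lborel) \<partial>slopes e) =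
    (\<integral>\<^sup>+y. cube e y * ennreal (1 / norm (slope e y) ^ DIM('a)) *
      (\<integral>\<^sup>+r. indicator {0<..} r * f (r *\<^sub>R dir e y) \<partial>lborel) \<partial>slopes e)"
  proof (rule nn_integral_cong)
    fix y assume "y \<in> space (slopes e)"
    define c where "c = norm (slope e y)"
    have c: "c > 0" using norm_slope_ge_1[OF e, of y] unfolding c_def by linarith
    have "(\<integral>\<^sup>+s. indicator {0<..} s * (ennreal (s ^ (DIM('a) - 1)) *
        (f (s *\<^sub>R slope e y) * ennreal (norm (s *\<^sub>R slope e y) powr (1 - real DIM('a))))) \<partial>lborel) =
      (\<integral>\<^sup>+s. ennreal (c / c ^ DIM('a)) * (indicator {0<..} s * f (s *\<^sub>R slope e y)) \<partial>lborel)"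
    proof (rule nn_integral_cong)
      fix s :: real
      show "indicator {0<..} s * (ennreal (s ^ (DIM('a) - 1)) *
        (f (s *\<^sub>R slope e y) * ennreal (norm (s *\<^sub>R slope e y) powr (1 - real DIM('a))))) =
        ennreal (c / c ^ DIM('a)) * (indicator {0<..} s * f (s *\<^sub>R slope e y))"
      proof (cases "s > 0")
        case True
        have "(s * c) powr (1 - real DIM('a)) = s powr (1 - real DIM('a)) * c powr (1 - real DIM('a))"
          using True c by (simp add: powr_mult)
        moreover have "c powr (1 - real DIM('a)) = c / c ^ DIM('a)"
          using c by (simp add: powr_diff powr_realpow)
        moreover have "s ^ (DIM('a) - 1) * s powr (1 - real DIM('a)) = 1"
        proof -
          have "s ^ (DIM('a) - 1) = s powr (real DIM('a) - 1)"
            using True by (simp add: powr_realpow[symmetric] of_nat_diff Suc_le_eq)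
          then show ?thesis using True by (simp add: powr_add[symmetric])
        qed
        ultimately have "s ^ (DIM('a) - 1) * norm (s *\<^sub>R slope e y) powr (1 - real DIM('a)) = c / c ^ DIM('a)"
          using True by (simp add: c_def mult_ac)
        then have "ennreal (s ^ (DIM('a) - 1)) * ennreal (norm (s *\<^sub>R slope e y) powr (1 - real DIM('a))) = ennreal (c / c ^ DIM('a))"
          using True by (simp add: ennreal_mult[symmetric])
        then show ?thesis using True by (simp add: mult.assoc[symmetric]) (simp add: mult_ac)
      qed simp
    qed
    also have "\<dots> = ennreal (c / c ^ DIM('a)) * (\<integral>\<^sup>+s. indicator {0<..} s * f (s *\<^sub>R slope e y) \<partial>lborel)"
      by (intro nn_integral_cmult) measurable
    also have "(\<integral>\<^sup>+s. indicator {0<..} s * f (s *\<^sub>R slope e y) \<partial>lborel) =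
        ennreal \<bar>1 / c\<bar> * (\<integral>\<^sup>+r. indicator {0<..} (0 + (1 / c) * r) * f ((0 + (1 / c) * r) *\<^sub>R slope e y) \<partial>lborel)"
      by (rule nn_integral_real_affine) (use c in auto)
    also have "(\<integral>\<^sup>+r. indicator {0<..} (0 + (1 / c) * r) * f ((0 + (1 / c) * r) *\<^sub>R slope e y) \<partial>lborel) =
      (\<integral>\<^sup>+r. indicator {0<..} r * f (r *\<^sub>R dir e y) \<partial>lborel)"
      using c by (intro nn_integral_cong)
        (auto simp: indicator_def dir_def c_def[symmetric] divide_inverse mult_ac zero_less_mult_iff)
    finally show "cube e y * (\<integral>\<^sup>+s. indicator {0<..} s * (ennreal (s ^ (DIM('a) - 1)) *
        (f (s *\<^sub>R slope e y) * ennreal (norm (s *\<^sub>R slope e y) powr (1 - real DIM('a))))) \<partial>lborel) =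
       cube e y * ennreal (1 / norm (slope e y) ^ DIM('a)) *
      (\<integral>\<^sup>+r. indicator {0<..} r * f (r *\<^sub>R dir e y) \<partial>lborel)"
      using c by (simp add: c_def[symmetric] mult.assoc[symmetric] ennreal_mult[symmetric])
  qed
qed measurable

text \<open>A coordinate of largest modulus is nonzero, and its sign decides between the cone and
  its reflection.\<close>

lemma cone_cover:
  fixes x :: "'a::euclidean_space"
  assumes "x \<noteq> 0"
  shows "\<exists>e\<in>Basis. x \<in> axis_cone e \<or> - x \<in> axis_cone e"
proof -
  have "\<exists>e\<in>Basis. \<forall>b\<in>Basis. \<bar>x \<bullet> b\<bar> \<le> \<bar>x \<bullet> e\<bar>"
  proof -
    have "Max ((\<lambda>b. \<bar>x \<bullet> b\<bar>) ` Basis) \<in> (\<lambda>b. \<bar>x \<bullet> b\<bar>) ` Basis" by (intro Max_in) auto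
    then obtain e where "e \<in> Basis" "Max ((\<lambda>b. \<bar>x \<bullet> b\<bar>) ` Basis) = \<bar>x \<bullet> e\<bar>" by blast
    then show ?thesis by (metis Max_ge finite_Basis finite_imageI imageI)
  qed
  then obtain e where e: "e \<in> Basis" "\<And>b. b \<in> Basis \<Longrightarrow> \<bar>x \<bullet> b\<bar> \<le> \<bar>x \<bullet> e\<bar>" by blast
  have "x \<bullet> e \<noteq> 0"
  proof
    assume "x \<bullet> e = 0"
    with e(2) have "\<forall>b\<in>Basis. x \<bullet> b = 0" by fastforce
    with assms show False by (simp add: euclidean_all_zero_iff)
  qed
  then have "x \<bullet> e > 0 \<or> (- x) \<bullet> e > 0" by auto
  then have "x \<in> axis_cone e \<or> - x \<in> axis_cone e"
  proof
    assume "x \<bullet> e > 0"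
    then show ?thesis using e(2) by (simp add: axis_cone_def)
  next
    assume "(- x) \<bullet> e > 0"
    then show ?thesis using e(2) by (simp add: axis_cone_def)
  qed
  with e(1) show ?thesis by blast
qed

lemma nn_integral_lborel_uminus:
  fixes f :: "'a::euclidean_space \<Rightarrow> ennreal"
  assumes [measurable]: "f \<in> borel_measurable borel"
  shows "(\<integral>\<^sup>+x. f (- x) \<partial>lborel) = (\<integral>\<^sup>+x. f x \<partial>lborel)"
  by (subst (2) lborel_affine[of "-1" 0]) (auto simp: nn_integral_density nn_integral_distr)

text \<open>The cones overlap on their boundaries, which is harmless for an upper bound, and miss
  only the origin, a null set. The cone around \<open>- e\<close> enters through the reflected
  function, so that later estimates concern basis vectors only.\<close>

lemma nn_integral_le_cones:
  fixes f :: "'a::euclidean_space \<Rightarrow> ennreal"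
  assumes [measurable]: "f \<in> borel_measurable borel"
  shows "(\<integral>\<^sup>+x. f x \<partial>lborel) \<le> (\<Sum>e\<in>Basis. (\<integral>\<^sup>+x. indicator (axis_cone e) x * f x \<partial>lborel) +
    (\<integral>\<^sup>+x. indicator (axis_cone e) x * f (- x) \<partial>lborel))"
proof -
  have "AE x in lborel. x \<noteq> (0::'a)" by (rule AE_lborel_singleton)
  then have "AE x in lborel. f x \<le> (\<Sum>e\<in>Basis. indicator (axis_cone e) x * f x + indicator (axis_cone e) (- x) * f x)"
  proof eventually_elim
    case (elim x)
    from cone_cover[OF this] obtain e where e: "e \<in> Basis" "x \<in> axis_cone e \<or> - x \<in> axis_cone e" by blast
    have "f x \<le> indicator (axis_cone e) x * f x + indicator (axis_cone e) (- x) * f x"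
      using e(2) by (auto simp: indicator_def)
    also have "\<dots> \<le> (\<Sum>e\<in>Basis. indicator (axis_cone e) x * f x + indicator (axis_cone e) (- x) * f x)"
      using e(1) by (intro member_le_sum) auto
    finally show ?case .
  qed
  then have "(\<integral>\<^sup>+x. f x \<partial>lborel) \<le> (\<integral>\<^sup>+x. (\<Sum>e\<in>Basis. indicator (axis_cone e) x * f x + indicator (axis_cone e) (- x) * f x) \<partial>lborel)"
    by (rule nn_integral_mono_AE)
  also have "\<dots> = (\<Sum>e\<in>Basis. (\<integral>\<^sup>+x. indicator (axis_cone e) x * f x \<partial>lborel) +
    (\<integral>\<^sup>+x. indicator (axis_cone e) (- x) * f x \<partial>lborel))"
    by (subst nn_integral_sum) (auto simp: nn_integral_add)
  also have "\<dots> = (\<Sum>e\<in>Basis. (\<integral>\<^sup>+x. indicator (axis_cone e) x * f x \<partial>lborel) +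
    (\<integral>\<^sup>+x. indicator (axis_cone e) x * f (- x) \<partial>lborel))"
    by (subst (2) nn_integral_lborel_uminus[symmetric]) auto
  finally show ?thesis .
qed

section \<open>One-dimensional inequalities\<close>

lemma FTC_nn_integral_le:
  fixes f f' :: "real \<Rightarrow> real"
  assumes "a \<le> b"
    and "\<And>x. a \<le> x \<Longrightarrow> x \<le> b \<Longrightarrow> (f has_real_derivative f' x) (at x)"
    and "\<And>x. a \<le> x \<Longrightarrow> x \<le> b \<Longrightarrow> isCont f' x"
  shows "ennreal \<bar>f b - f a\<bar> \<le> (\<integral>\<^sup>+x. indicator {a..b} x * ennreal \<bar>f' x\<bar> \<partial>lborel)"
proof -
  have "has_bochner_integral lborel (\<lambda>x. f' x * indicator {a..b} x) (f b - f a)"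
    by (rule has_bochner_integral_FTC_Icc_real) (use assms in auto)
  then have "ennreal (norm (f b - f a)) \<le> (\<integral>\<^sup>+x. norm (f' x * indicator {a..b} x) \<partial>lborel)"
    using integral_norm_bound_ennreal[of lborel "\<lambda>x. f' x * indicator {a..b} x"]
    by (simp add: has_bochner_integral_iff)
  also have "\<dots> = (\<integral>\<^sup>+x. indicator {a..b} x * ennreal \<bar>f' x\<bar> \<partial>lborel)"
    by (intro nn_integral_cong) (auto simp: indicator_def)
  finally show ?thesis by simp
qed

text \<open>Values at two points differ by at most the integral of |f'|. Averaging over the second
  point, on an interval of length 2, leaves half the integral of |f|, which is rounded up. The term
  with |f| replaces a boundary condition.\<close>

lemma interval_sup_bound:
  fixes f f' :: "real \<Rightarrow> real"
  assumes der: "\<And>x. (f has_real_derivative f' x) (at x)" and cont: "\<And>x. isCont f' x"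
    and t0: "t0 \<in> {-1..1}"
  shows "ennreal \<bar>f t0\<bar> \<le> (\<integral>\<^sup>+t. indicator {-1..1} t * (ennreal \<bar>f t\<bar> + ennreal \<bar>f' t\<bar>) \<partial>lborel)"
proof -
  define D where "D = (\<integral>\<^sup>+t. indicator {-1..1} t * ennreal \<bar>f' t\<bar> \<partial>lborel)"
  have [measurable]: "f' \<in> borel_measurable borel"
    using cont by (auto intro!: borel_measurable_continuous_onI continuous_at_imp_continuous_on)
  have [measurable]: "f \<in> borel_measurable borel"
    using der by (intro borel_measurable_continuous_onI continuous_at_imp_continuous_on) (auto intro: DERIV_isCont)
  have diff: "ennreal \<bar>f t0 - f t\<bar> \<le> D" if t: "t \<in> {-1..1}" for t
  proof -
    have "ennreal \<bar>f b - f a\<bar> \<le> D" if "a \<le> b" "{a..b} \<subseteq> {-1..1}" for a b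
    proof -
      have "ennreal \<bar>f b - f a\<bar> \<le> (\<integral>\<^sup>+x. indicator {a..b} x * ennreal \<bar>f' x\<bar> \<partial>lborel)"
        by (rule FTC_nn_integral_le) (use that der cont in auto)
      also have "\<dots> \<le> D" unfolding D_def
        using that(2) by (intro nn_integral_mono mult_right_mono) (auto simp: indicator_def)
      finally show ?thesis .
    qed
    from this[of t t0] this[of t0 t] show ?thesis
      using t t0 by (cases "t \<le> t0") (auto simp: abs_minus_commute)
  qed
  have 2: "(\<integral>\<^sup>+t. indicator {-1..1::real} t \<partial>lborel) = 2" by simp
  have pt: "ennreal \<bar>f t0\<bar> * indicator {-1..1} t \<le> indicator {-1..1} t * ennreal \<bar>f t\<bar> + D * indicator {-1..1} t" for t
  proof (cases "t \<in> {-1..1}")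
    case True
    have "ennreal \<bar>f t0\<bar> \<le> ennreal (\<bar>f t\<bar> + \<bar>f t0 - f t\<bar>)" by (intro ennreal_leI) linarith
    also have "\<dots> = ennreal \<bar>f t\<bar> + ennreal \<bar>f t0 - f t\<bar>" by simp
    also have "\<dots> \<le> ennreal \<bar>f t\<bar> + D" using diff[OF True] by (intro add_left_mono)
    finally show ?thesis using True by simp
  qed simp
  have "(\<integral>\<^sup>+t. ennreal \<bar>f t0\<bar> * indicator {-1..1::real} t \<partial>lborel) \<le>
      (\<integral>\<^sup>+t. indicator {-1..1} t * ennreal \<bar>f t\<bar> + D * indicator {-1..1} t \<partial>lborel)"
    by (rule nn_integral_mono) (rule pt)
  then have "ennreal \<bar>f t0\<bar> * 2 \<le> (\<integral>\<^sup>+t. indicator {-1..1} t * ennreal \<bar>f t\<bar> \<partial>lborel) + D * 2"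
    by (simp add: nn_integral_add nn_integral_cmult_indicator)
  also have "\<dots> \<le> ((\<integral>\<^sup>+t. indicator {-1..1} t * ennreal \<bar>f t\<bar> \<partial>lborel) + D) * 2"
    by (simp add: distrib_right mult_2_right)
  finally have "2 * ennreal \<bar>f t0\<bar> \<le> 2 * ((\<integral>\<^sup>+t. indicator {-1..1} t * ennreal \<bar>f t\<bar> \<partial>lborel) + D)"
    by (simp only: mult.commute)
  then have "ennreal \<bar>f t0\<bar> \<le> (\<integral>\<^sup>+t. indicator {-1..1} t * ennreal \<bar>f t\<bar> \<partial>lborel) + D"
    by (subst (asm) ennreal_mult_le_mult_iff) auto
  also have "\<dots> = (\<integral>\<^sup>+t. indicator {-1..1} t * (ennreal \<bar>f t\<bar> + ennreal \<bar>f' t\<bar>) \<partial>lborel)"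
    by (simp add: D_def nn_integral_add distrib_left)
  finally show ?thesis .
qed

text \<open>\<open>d\<close> plays the role of \<open>\<bar>v'\<bar>\<close>; only the integral bounds on \<open>d\<close> matter below.\<close>

definition hardy_weight :: "real \<Rightarrow> (real \<Rightarrow> real) \<Rightarrow> (real \<Rightarrow> real) \<Rightarrow> bool" where
  "hardy_weight \<eta> v d \<longleftrightarrow> v \<in> borel_measurable borel \<and> d \<in> borel_measurable borel \<and>
     (\<forall>r. 0 \<le> v r) \<and> (\<forall>r. 0 \<le> d r) \<and> (\<forall>r. r \<notin> {0<..<\<eta>} \<longrightarrow> v r = 0 \<and> d r = 0) \<and>
     (\<forall>r. 0 < r \<and> r < \<eta> \<longrightarrow> 0 < v r) \<and>
     ((\<forall>a b. 0 < a \<and> a \<le> b \<and> b < \<eta> \<longrightarrow> v a \<le> v b \<and> (\<integral>\<^sup>+r. indicator {a..b} r * ennreal (d r) \<partial>lborel) \<le> ennreal (v b)) \<or>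
      (\<forall>a b. 0 < a \<and> a \<le> b \<and> b < \<eta> \<longrightarrow> v b \<le> v a \<and> (\<integral>\<^sup>+r. indicator {a..b} r * ennreal (d r) \<partial>lborel) \<le> ennreal (v a)))"

text \<open>\<open>f\<close> vanishes at \<open>a\<close> and at \<open>b\<close>, so it is an
  integral of \<open>f'\<close> from whichever end lies on the side where \<open>v\<close> is
  larger: \<open>b\<close> for increasing \<open>v\<close>, \<open>a\<close> for decreasing
  \<open>v\<close>. There \<open>v r\<close> is at most \<open>v s\<close>, which gives the first
  bound. For the second, Fubini puts the integral of \<open>d\<close> inside, where it is at most
  \<open>v s\<close>.\<close>

lemma hardy_1d:
  fixes f f' :: "real \<Rightarrow> real"
  assumes hw: "hardy_weight \<eta> v d"
    and der: "\<And>x. 0 < x \<Longrightarrow> (f has_real_derivative f' x) (at x)"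
    and cont: "\<And>x. isCont f' x"
    and supp: "0 < a" "a < b" "b < \<eta>" "\<And>r. 0 < r \<Longrightarrow> r \<le> a \<or> b \<le> r \<Longrightarrow> f r = 0"
  shows "ennreal (v r * \<bar>f r\<bar>) \<le> (\<integral>\<^sup>+s. ennreal (v s * \<bar>f' s\<bar>) \<partial>lborel)" (is "?A")
    and "(\<integral>\<^sup>+r. ennreal (\<bar>f r\<bar> * d r) \<partial>lborel) \<le> (\<integral>\<^sup>+s. ennreal (v s * \<bar>f' s\<bar>) \<partial>lborel)" (is "?B")
proof -
  note [measurable] = hw[unfolded hardy_weight_def, THEN conjunct1] hw[unfolded hardy_weight_def, THEN conjunct2, THEN conjunct1]
  have nn: "v r \<ge> 0" "d r \<ge> 0" for r using hw by (auto simp: hardy_weight_def)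
  have out: "v r = 0" "d r = 0" if "r \<notin> {0<..<\<eta>}" for r using hw that by (auto simp: hardy_weight_def)
  have [measurable]: "f' \<in> borel_measurable borel"
    using cont by (auto intro!: borel_measurable_continuous_onI continuous_at_imp_continuous_on)
  text \<open>\<open>T s r\<close>: the point \<open>s\<close> lies on the side of \<open>r\<close> on which \<open>v \<ge> v r\<close>.\<close>
  define I where "I = {a..b}"
  have I: "r \<in> {0<..<\<eta>}" if "r \<in> I" for r using that supp by (auto simp: I_def)
  obtain T :: "real \<Rightarrow> real \<Rightarrow> bool" where
    Tm: "Measurable.pred (borel \<Otimes>\<^sub>M borel) (\<lambda>x. T (fst x) (snd x))"
    and Tv: "\<And>s r. T s r \<Longrightarrow> s \<in> I \<Longrightarrow> r \<in> I \<Longrightarrow> v r \<le> v s"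
    and Td: "\<And>s. s \<in> I \<Longrightarrow> (\<integral>\<^sup>+r. indicator {r. T s r \<and> r \<in> I} r * ennreal (d r) \<partial>lborel) \<le> ennreal (v s)"
    and Tf: "\<And>r. r \<in> I \<Longrightarrow> ennreal \<bar>f r\<bar> \<le> (\<integral>\<^sup>+s. indicator {s. T s r \<and> s \<in> I} s * ennreal \<bar>f' s\<bar> \<partial>lborel)"
  proof -
    consider (inc) "\<forall>a b. 0 < a \<and> a \<le> b \<and> b < \<eta> \<longrightarrow> v a \<le> v b \<and> (\<integral>\<^sup>+r. indicator {a..b} r * ennreal (d r) \<partial>lborel) \<le> ennreal (v b)"
      | (dec) "\<forall>a b. 0 < a \<and> a \<le> b \<and> b < \<eta> \<longrightarrow> v b \<le> v a \<and> (\<integral>\<^sup>+r. indicator {a..b} r * ennreal (d r) \<partial>lborel) \<le> ennreal (v a)"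
      using hw by (auto simp: hardy_weight_def)
    then show thesis
    proof cases
      case inc
      show thesis
      proof (rule that[of "\<lambda>s r. r \<le> s"])
        show "Measurable.pred (borel \<Otimes>\<^sub>M borel) (\<lambda>x::real \<times> real. snd x \<le> fst x)"
          by measurable
        show "v r \<le> v s" if "r \<le> s" "s \<in> I" "r \<in> I" for s r
          using inc that supp by (auto simp: I_def)
        fix s assume s: "s \<in> I"
        have eq: "{r. r \<le> s \<and> r \<in> I} = {a..s}" "{t. s \<le> t \<and> t \<in> I} = {s..b}" using s by (auto simp: I_def)
        show "(\<integral>\<^sup>+r. indicator {r. r \<le> s \<and> r \<in> I} r * ennreal (d r) \<partial>lborel) \<le> ennreal (v s)"
          unfolding eq using inc s supp by (auto simp: I_def)
        have "ennreal \<bar>f b - f s\<bar> \<le> (\<integral>\<^sup>+t. indicator {s..b} t * ennreal \<bar>f' t\<bar> \<partial>lborel)"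
          by (rule FTC_nn_integral_le) (use s supp der cont in \<open>auto simp: I_def\<close>)
        then show "ennreal \<bar>f s\<bar> \<le> (\<integral>\<^sup>+t. indicator {t. s \<le> t \<and> t \<in> I} t * ennreal \<bar>f' t\<bar> \<partial>lborel)"
          unfolding eq using supp by simp
      qed
    next
      case dec
      show thesis
      proof (rule that[of "\<lambda>s r. s \<le> r"])
        show "Measurable.pred (borel \<Otimes>\<^sub>M borel) (\<lambda>x::real \<times> real. fst x \<le> snd x)"
          by measurable
        show "v r \<le> v s" if "s \<le> r" "s \<in> I" "r \<in> I" for s r
          using dec that supp by (auto simp: I_def)
        fix s assume s: "s \<in> I"
        have eq: "{t. t \<le> s \<and> t \<in> I} = {a..s}" "{t. s \<le> t \<and> t \<in> I} = {s..b}" using s by (auto simp: I_def)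
        show "(\<integral>\<^sup>+r. indicator {r. s \<le> r \<and> r \<in> I} r * ennreal (d r) \<partial>lborel) \<le> ennreal (v s)"
          unfolding eq using dec s supp by (auto simp: I_def)
        have "ennreal \<bar>f s - f a\<bar> \<le> (\<integral>\<^sup>+t. indicator {a..s} t * ennreal \<bar>f' t\<bar> \<partial>lborel)"
          by (rule FTC_nn_integral_le) (use s supp der cont in \<open>auto simp: I_def\<close>)
        then show "ennreal \<bar>f s\<bar> \<le> (\<integral>\<^sup>+t. indicator {t. t \<le> s \<and> t \<in> I} t * ennreal \<bar>f' t\<bar> \<partial>lborel)"
          unfolding eq using supp by simp
      qed
    qed
  qed
  have fI: "f r = 0" if "r \<notin> I" "r \<in> {0<..<\<eta>}" for r using that supp by (auto simp: I_def)
  have Im[measurable]: "I \<in> sets borel" by (simp add: I_def)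
  show ?A
  proof (cases "r \<in> I")
    case True
    have "ennreal (v r * \<bar>f r\<bar>) = ennreal (v r) * ennreal \<bar>f r\<bar>" using nn by (simp add: ennreal_mult)
    also have "\<dots> \<le> ennreal (v r) * (\<integral>\<^sup>+s. indicator {s. T s r \<and> s \<in> I} s * ennreal \<bar>f' s\<bar> \<partial>lborel)"
      by (intro mult_left_mono Tf True) auto
    also have "\<dots> = (\<integral>\<^sup>+s. ennreal (v r) * (indicator {s. T s r \<and> s \<in> I} s * ennreal \<bar>f' s\<bar>) \<partial>lborel)"
    proof (rule nn_integral_cmult[symmetric])
      have "Measurable.pred borel (\<lambda>s. T s r)"
        using measurable_compose[OF _ Tm, of "\<lambda>s. (s, r)" borel] by simp
      then show "(\<lambda>s. indicator {s. T s r \<and> s \<in> I} s * ennreal \<bar>f' s\<bar>) \<in> borel_measurable lborel"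
        by measurable
    qed
    also have "\<dots> \<le> (\<integral>\<^sup>+s. ennreal (v s * \<bar>f' s\<bar>) \<partial>lborel)"
    proof (rule nn_integral_mono)
      fix s show "ennreal (v r) * (indicator {s. T s r \<and> s \<in> I} s * ennreal \<bar>f' s\<bar>) \<le> ennreal (v s * \<bar>f' s\<bar>)"
        using Tv[of s r] True nn[of r] nn[of s]
        by (auto simp: indicator_def ennreal_mult[symmetric] intro!: ennreal_leI mult_right_mono)
    qed
    finally show ?thesis .
  next
    case False
    then show ?thesis using fI[of r] out[of r] by (cases "r \<in> {0<..<\<eta>}") auto
  qed
  have "(\<integral>\<^sup>+r. ennreal (\<bar>f r\<bar> * d r) \<partial>lborel) \<le>
    (\<integral>\<^sup>+r. \<integral>\<^sup>+s. (indicator I r * ennreal (d r)) * (indicator {s. T s r \<and> s \<in> I} s * ennreal \<bar>f' s\<bar>) \<partial>lborel \<partial>lborel)"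
  proof (rule nn_integral_mono)
    fix r :: real
    have "Measurable.pred borel (\<lambda>s. T s r)"
      using measurable_compose[OF _ Tm, of "\<lambda>s. (s, r)" borel] by simp
    then have m: "(\<lambda>s. indicator {s. T s r \<and> s \<in> I} s * ennreal \<bar>f' s\<bar>) \<in> borel_measurable lborel"
      by measurable
    show "ennreal (\<bar>f r\<bar> * d r) \<le>
      (\<integral>\<^sup>+s. (indicator I r * ennreal (d r)) * (indicator {s. T s r \<and> s \<in> I} s * ennreal \<bar>f' s\<bar>) \<partial>lborel)"
      unfolding nn_integral_cmult[OF m]
    proof (cases "r \<in> I")
      case True
      then show "ennreal (\<bar>f r\<bar> * d r) \<le>
         (indicator I r * ennreal (d r)) * (\<integral>\<^sup>+s. (indicator {s. T s r \<and> s \<in> I} s * ennreal \<bar>f' s\<bar>) \<partial>lborel)"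
        using nn mult_left_mono[OF Tf[OF True], of "ennreal (d r)"] by (simp add: ennreal_mult mult.commute)
    next
      case False
      then have "\<bar>f r\<bar> * d r = 0" using fI[of r] out[of r] by (cases "r \<in> {0<..<\<eta>}") auto
      then show "ennreal (\<bar>f r\<bar> * d r) \<le>
         (indicator I r * ennreal (d r)) * (\<integral>\<^sup>+s. (indicator {s. T s r \<and> s \<in> I} s * ennreal \<bar>f' s\<bar>) \<partial>lborel)"
        by (simp only: ennreal_0 zero_le)
    qed
  qed
  also have "\<dots> = (\<integral>\<^sup>+s. \<integral>\<^sup>+r. (indicator I s * ennreal \<bar>f' s\<bar>) * (indicator {r. T s r \<and> r \<in> I} r * ennreal (d r)) \<partial>lborel \<partial>lborel)"
  proof -
    have "(\<integral>\<^sup>+r. \<integral>\<^sup>+s. (indicator I r * ennreal (d r)) * (indicator {s. T s r \<and> s \<in> I} s * ennreal \<bar>f' s\<bar>) \<partial>lborel \<partial>lborel) =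
      (\<integral>\<^sup>+s. \<integral>\<^sup>+r. (indicator I r * ennreal (d r)) * (indicator {s. T s r \<and> s \<in> I} s * ennreal \<bar>f' s\<bar>) \<partial>lborel \<partial>lborel)"
    proof (rule lborel_pair.Fubini')
      have "(\<lambda>x. (indicator I (snd x) * ennreal (d (snd x))) *
          (indicator {x. T (fst x) (snd x)} x * indicator I (fst x) * ennreal \<bar>f' (fst x)\<bar>))
          \<in> borel_measurable (borel \<Otimes>\<^sub>M borel)"
        using Tm by measurable
      moreover have "(\<lambda>x. (indicator I (snd x) * ennreal (d (snd x))) *
          (indicator {x. T (fst x) (snd x)} x * indicator I (fst x) * ennreal \<bar>f' (fst x)\<bar>)) =
          (\<lambda>(s, r). (indicator I r * ennreal (d r)) * (indicator {s. T s r \<and> s \<in> I} s * ennreal \<bar>f' s\<bar>))"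
        by (auto simp: fun_eq_iff indicator_def)
      moreover have "sets (lborel \<Otimes>\<^sub>M lborel) = sets (borel \<Otimes>\<^sub>M borel :: (real \<times> real) measure)"
        by (intro sets_pair_measure_cong) auto
      ultimately show "(\<lambda>(s, r). (indicator I r * ennreal (d r)) * (indicator {s. T s r \<and> s \<in> I} s * ennreal \<bar>f' s\<bar>))
          \<in> borel_measurable (lborel \<Otimes>\<^sub>M lborel)"
        by (simp cong: measurable_cong_sets)
    qed
    also have "\<dots> = (\<integral>\<^sup>+s. \<integral>\<^sup>+r. (indicator I s * ennreal \<bar>f' s\<bar>) * (indicator {r. T s r \<and> r \<in> I} r * ennreal (d r)) \<partial>lborel \<partial>lborel)"
      by (intro nn_integral_cong) (auto simp: indicator_def mult_ac)
    finally show ?thesis .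
  qed
  also have "\<dots> \<le> (\<integral>\<^sup>+s. ennreal (v s * \<bar>f' s\<bar>) \<partial>lborel)"
  proof (rule nn_integral_mono)
    fix s :: real
    have "Measurable.pred borel (\<lambda>r. T s r)"
      using measurable_compose[OF _ Tm, of "\<lambda>r. (s, r)" borel] by simp
    then have m: "(\<lambda>r. indicator {r. T s r \<and> r \<in> I} r * ennreal (d r)) \<in> borel_measurable lborel"
      by measurable
    show "(\<integral>\<^sup>+r. (indicator I s * ennreal \<bar>f' s\<bar>) * (indicator {r. T s r \<and> r \<in> I} r * ennreal (d r)) \<partial>lborel) \<le> ennreal (v s * \<bar>f' s\<bar>)"
      unfolding nn_integral_cmult[OF m]
    proof (cases "s \<in> I")
      case True
      then show "(indicator I s * ennreal \<bar>f' s\<bar>) * (\<integral>\<^sup>+r. (indicator {r. T s r \<and> r \<in> I} r * ennreal (d r)) \<partial>lborel) \<le> ennreal (v s * \<bar>f' s\<bar>)"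
        using nn mult_left_mono[OF Td[OF True], of "ennreal \<bar>f' s\<bar>"] by (simp add: ennreal_mult mult.commute)
    qed simp
  qed
  finally show ?B .
qed

section \<open>The Sobolev inequality in a cone\<close>

text \<open>The two terms of the quotient rule for S/|S| have norm at most 1 each, since |S| >= 1
  and \<open>i\<close> is a unit vector. The line is traced when a single slope varies.\<close>

lemma normalized_line_derivative:
  fixes p i :: "'a::euclidean_space"
  assumes ge1: "\<And>t. 1 \<le> norm (p + t *\<^sub>R i)" and i: "norm i = 1"
  obtains D where
    "\<And>t. ((\<lambda>t. (p + t *\<^sub>R i) /\<^sub>R norm (p + t *\<^sub>R i)) has_vector_derivative D t) (at t)"
    "\<And>t. isCont D t" "\<And>t. norm (D t) \<le> 2"
proof -
  define S where "S t = p + t *\<^sub>R i" for t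
  define D where "D t = i /\<^sub>R norm (S t) - ((S t \<bullet> i) / norm (S t) ^ 3) *\<^sub>R S t" for t
  have S: "1 \<le> norm (S t)" "S t \<noteq> 0" for t
    using ge1[of t] by (auto simp: S_def)
  have Sd: "(S has_derivative (\<lambda>h. h *\<^sub>R i)) (at t)" for t
    unfolding S_def by (auto intro!: derivative_eq_intros)
  have nd: "((\<lambda>t. norm (S t)) has_derivative (\<lambda>h. (h *\<^sub>R i) \<bullet> sgn (S t))) (at t)" for t
    using has_derivative_compose[OF Sd has_derivative_norm[OF S(2)]] by simp
  have Dd: "((\<lambda>t. S t /\<^sub>R norm (S t)) has_vector_derivative D t) (at t)" for t
  proof -
    have "((\<lambda>t. inverse (norm (S t))) has_derivative
       (\<lambda>h. - (inverse (norm (S t)) * ((h *\<^sub>R i) \<bullet> sgn (S t)) * inverse (norm (S t))))) (at t)"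
      using S(2) nd by (intro Deriv.has_derivative_inverse) auto
    from has_derivative_scaleR[OF this Sd]
    have "((\<lambda>t. S t /\<^sub>R norm (S t)) has_derivative (\<lambda>h. (h *\<^sub>R i) /\<^sub>R norm (S t) +
      (- (inverse (norm (S t)) * ((h *\<^sub>R i) \<bullet> sgn (S t)) * inverse (norm (S t)))) *\<^sub>R S t)) (at t)"
      by simp
    moreover have "(h *\<^sub>R i) /\<^sub>R norm (S t) +
      (- (inverse (norm (S t)) * ((h *\<^sub>R i) \<bullet> sgn (S t)) * inverse (norm (S t)))) *\<^sub>R S t = h *\<^sub>R D t" for h
      by (simp add: D_def sgn_div_norm inner_commute scaleR_diff_right divide_inverse power3_eq_cube mult_ac)
    ultimately show ?thesis by (simp add: has_vector_derivative_def)
  qed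
  have Sc: "isCont S t" for t using Sd by (rule has_derivative_continuous)
  have Dc: "isCont D t" for t
    unfolding D_def using S Sc by (intro continuous_intros) auto
  have Dn: "norm (D t) \<le> 2" for t
  proof -
    have "norm (i /\<^sub>R norm (S t)) \<le> 1"
      using S(1)[of t] i by (simp add: inverse_le_1_iff)
    moreover have "norm (((S t \<bullet> i) / norm (S t) ^ 3) *\<^sub>R S t) \<le> 1"
    proof -
      have "\<bar>S t \<bullet> i\<bar> \<le> norm (S t)" using Cauchy_Schwarz_ineq2[of "S t" i] i by simp
      then have "\<bar>S t \<bullet> i\<bar> * norm (S t) \<le> norm (S t) * norm (S t)" by (intro mult_right_mono) auto
      also have "\<dots> \<le> norm (S t) ^ 3"
        using S(1)[of t] mult_right_mono[of 1 "norm (S t)" "norm (S t) * norm (S t)"]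
        by (simp add: power3_eq_cube)
      finally show ?thesis using S(1)[of t] S(2)[of t] by (simp add: pos_divide_le_eq)
    qed
    ultimately show ?thesis unfolding D_def
      using norm_triangle_ineq4[of "i /\<^sub>R norm (S t)" "((S t \<bullet> i) / norm (S t) ^ 3) *\<^sub>R S t"] by linarith
  qed
  show ?thesis using Dd Dc Dn that unfolding S_def by blast
qed

lemma prod_mono_ennreal:
  fixes f g :: "'b \<Rightarrow> ennreal"
  assumes "\<And>i. i \<in> S \<Longrightarrow> f i \<le> g i"
  shows "prod f S \<le> prod g S"
  using assms by (induction S rule: infinite_finite_induct) (auto intro!: mult_mono)

lemma cube_cases: "cube e y = 0 \<or> cube e y = 1"
  by (cases "\<forall>b\<in>Basis - {e}. y b \<in> {-1..1}") (auto simp: cube_def indicator_def)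

lemma cube_eq_1_iff: "cube e y = 1 \<longleftrightarrow> (\<forall>b\<in>Basis - {e}. y b \<in> {-1..1})"
proof (cases "\<forall>b\<in>Basis - {e}. y b \<in> {-1..1}")
  case False
  then have "cube e y = 0" unfolding cube_def by (auto simp: indicator_def)
  then show ?thesis using False by simp
qed (auto simp: cube_def)

lemma cube_upd:
  assumes "cube e y = 1" "i \<in> Basis - {e}"
  shows "cube e (y(i := t)) = indicator {-1..1} t"
proof (cases "t \<in> {-1..1}")
  case True
  then have "cube e (y(i := t)) = 1" using assms unfolding cube_eq_1_iff by auto
  then show ?thesis using True by simp
next
  case False
  then have "cube e (y(i := t)) \<noteq> 1" using assms unfolding cube_eq_1_iff by auto
  then show ?thesis using False cube_cases[of e "y(i := t)"] by simp
qed

lemma slope_upd: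
  assumes "i \<in> Basis - {e}"
  shows "slope e (y(i := t)) = slope e (y(i := 0)) + t *\<^sub>R i"
proof -
  have "(\<Sum>b\<in>Basis - {e}. (y(i := t)) b *\<^sub>R b) = t *\<^sub>R i + (\<Sum>b\<in>Basis - {e} - {i}. y b *\<^sub>R b)" for t
    using assms by (subst sum.remove[of _ i]) (auto intro!: sum.cong)
  from this[of t] this[of 0] show ?thesis by (simp add: slope_def)
qed

text \<open>\<open>g\<close> is the gradient of \<open>u\<close>, kept as a parameter so that the
  reflected function, which accounts for the opposite cone, is another instance. The radii
  \<open>a\<close> and \<open>b\<close> bound the support and keep it away from the origin, where
  \<open>v\<close> may be unbounded, and from \<eta>.\<close>

locale cone_setting =
  fixes e :: "'a::euclidean_space" and \<eta> :: real and v d :: "real \<Rightarrow> real"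
    and u :: "'a \<Rightarrow> real" and g :: "'a \<Rightarrow> 'a" and a b :: real
  assumes e: "e \<in> Basis" and dim: "DIM('a) \<ge> 2"
    and hw: "hardy_weight \<eta> v d"
    and der: "\<And>x. (u has_derivative (\<lambda>h. g x \<bullet> h)) (at x)"
    and contg: "continuous_on UNIV g"
    and ab: "0 < a" "a < b" "b < \<eta>"
    and supp: "\<And>x. norm x \<le> a \<or> b \<le> norm x \<Longrightarrow> u x = 0"
begin

definition "ray_grad y = (\<integral>\<^sup>+r. ennreal (v r * norm (g (r *\<^sub>R dir e y))) \<partial>lborel)"

text \<open>The inverse n-th power of \<open>norm (slope e y)\<close> in the polar formula is left
  out. This leaves plain product measure on the cube of slopes, the setting of Loomis-Whitney;
  \<open>cone_grad_le\<close> accounts for the difference.\<close>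

definition "cone_grad = (\<integral>\<^sup>+y. cube e y * ray_grad y \<partial>slopes e)"

lemma v_measurable[measurable]: "v \<in> borel_measurable borel"
  and d_measurable[measurable]: "d \<in> borel_measurable borel"
  using hw by (auto simp: hardy_weight_def)

lemma v_nonneg: "0 \<le> v r" and d_nonneg: "0 \<le> d r"
  using hw by (auto simp: hardy_weight_def)

lemma g_measurable[measurable]: "g \<in> borel_measurable borel"
  by (rule borel_measurable_continuous_onI[OF contg])

lemma u_measurable[measurable]: "u \<in> borel_measurable borel"
  using der by (intro borel_measurable_continuous_onI continuous_at_imp_continuous_on)
    (auto intro: has_derivative_continuous)

lemma ray_grad_measurable[measurable]: "ray_grad \<in> borel_measurable (slopes e)"
  unfolding ray_grad_def by measurable

lemma ray_derivative:
  "((\<lambda>r. u (r *\<^sub>R z)) has_real_derivative (g (r *\<^sub>R z) \<bullet> z)) (at r)"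
proof -
  have "((\<lambda>r. r *\<^sub>R z) has_derivative (\<lambda>h. h *\<^sub>R z)) (at r)"
    by (auto intro!: derivative_eq_intros)
  moreover have "(\<lambda>h. g (r *\<^sub>R z) \<bullet> (h *\<^sub>R z)) = (\<lambda>h. (g (r *\<^sub>R z) \<bullet> z) * h)"
    by (auto simp: fun_eq_iff)
  ultimately show ?thesis
    unfolding has_field_derivative_def using has_derivative_compose[OF _ der] by metis
qed

lemma ray_bounds:
  shows "ennreal (v r * \<bar>u (r *\<^sub>R dir e y)\<bar>) \<le> ray_grad y"
    and "(\<integral>\<^sup>+r. ennreal (\<bar>u (r *\<^sub>R dir e y)\<bar> * d r) \<partial>lborel) \<le> ray_grad y"
proof -
  have n: "norm (dir e y) = 1" by (rule norm_dir[OF e])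
  have c: "isCont (\<lambda>r. g (r *\<^sub>R dir e y) \<bullet> dir e y) r" for r
    using contg by (intro continuous_intros continuous_at_compose[unfolded o_def, of r "\<lambda>r. r *\<^sub>R dir e y" g])
      (auto simp: continuous_on_eq_continuous_at)
  have le: "(\<integral>\<^sup>+s. ennreal (v s * \<bar>g (s *\<^sub>R dir e y) \<bullet> dir e y\<bar>) \<partial>lborel) \<le> ray_grad y"
    unfolding ray_grad_def
  proof (intro nn_integral_mono ennreal_leI mult_left_mono v_nonneg)
    fix s show "\<bar>g (s *\<^sub>R dir e y) \<bullet> dir e y\<bar> \<le> norm (g (s *\<^sub>R dir e y))"
      using Cauchy_Schwarz_ineq2[of "g (s *\<^sub>R dir e y)" "dir e y"] n by simp
  qed
  have s: "u (r *\<^sub>R dir e y) = 0" if "0 < r" "r \<le> a \<or> b \<le> r" for r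
    using that n by (intro supp) auto
  note H = hardy_1d[OF hw ray_derivative c ab s]
  show "ennreal (v r * \<bar>u (r *\<^sub>R dir e y)\<bar>) \<le> ray_grad y"
    by (rule order_trans[OF H(1) le])
  show "(\<integral>\<^sup>+r. ennreal (\<bar>u (r *\<^sub>R dir e y)\<bar> * d r) \<partial>lborel) \<le> ray_grad y"
    by (rule order_trans[OF H(2) le])
qed

text \<open>This settles q = 1; for larger q it absorbs the mean terms left by the angular
  bounds.\<close>

lemma cone_hardy:
  "(\<integral>\<^sup>+y. cube e y * (\<integral>\<^sup>+r. ennreal (\<bar>u (r *\<^sub>R dir e y)\<bar> * d r) \<partial>lborel) \<partial>slopes e) \<le> cone_grad"
  unfolding cone_grad_def by (intro nn_integral_mono mult_left_mono ray_bounds) auto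

text \<open>Varying one slope moves the point on the sphere of radius \<open>r\<close> with speed at
  most \<open>2 * r\<close>, while \<open>v r\<close> and \<open>d r\<close> stay constant. The
  right-hand side no longer depends on \<open>y i\<close>, which is what Loomis-Whitney needs of the
  factor with index \<open>i\<close>.\<close>

lemma angular_bound:
  assumes k: "k > 0" "k * r * d r \<le> v r" and y: "cube e y = 1" and i: "i \<in> Basis - {e}"
  shows "ennreal (\<bar>u (r *\<^sub>R dir e y)\<bar> * d r) \<le>
    (\<integral>\<^sup>+t. cube e (y(i := t)) * ennreal (\<bar>u (r *\<^sub>R dir e (y(i := t)))\<bar> * d r +
       2 / k * (v r * norm (g (r *\<^sub>R dir e (y(i := t)))))) \<partial>lborel)"
proof (cases "r > 0")
  case False
  then have "d r = 0" using hw by (auto simp: hardy_weight_def)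
  then show ?thesis by simp
next
  case True
  define p where "p = slope e (y(i := 0))"
  define z where "z t = (p + t *\<^sub>R i) /\<^sub>R norm (p + t *\<^sub>R i)" for t
  have dir_z: "dir e (y(i := t)) = z t" for t
    unfolding dir_def z_def p_def slope_upd[OF i, of y t] ..
  have ge1: "1 \<le> norm (p + t *\<^sub>R i)" for t
    using norm_slope_ge_1[OF e, of "y(i := t)"] by (simp only: p_def slope_upd[OF i, symmetric])
  obtain D where D: "\<And>t. (z has_vector_derivative D t) (at t)" "\<And>t. isCont D t" "\<And>t. norm (D t) \<le> 2"
    using normalized_line_derivative[OF ge1] i unfolding z_def[abs_def, symmetric] by auto
  define \<phi> where "\<phi> t = u (r *\<^sub>R z t)" for t
  define \<phi>' where "\<phi>' t = g (r *\<^sub>R z t) \<bullet> (r *\<^sub>R D t)" for t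
  have zc: "isCont z t" for t using D(1) has_vector_derivative_continuous by blast
  have der\<phi>: "(\<phi> has_real_derivative \<phi>' t) (at t)" for t
  proof -
    have "((\<lambda>t. r *\<^sub>R z t) has_derivative (\<lambda>h. r *\<^sub>R (h *\<^sub>R D t))) (at t)"
      using D(1)[of t] unfolding has_vector_derivative_def by (intro has_derivative_scaleR_right)
    from has_derivative_compose[OF this der]
    have "(\<phi> has_derivative (\<lambda>h. g (r *\<^sub>R z t) \<bullet> (r *\<^sub>R (h *\<^sub>R D t)))) (at t)"
      unfolding \<phi>_def .
    moreover have "(\<lambda>h. g (r *\<^sub>R z t) \<bullet> (r *\<^sub>R (h *\<^sub>R D t))) = (\<lambda>h. \<phi>' t * h)"
      by (auto simp: fun_eq_iff \<phi>'_def)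
    ultimately show ?thesis unfolding has_field_derivative_def by (simp only:)
  qed
  have cont\<phi>': "isCont \<phi>' t" for t
    unfolding \<phi>'_def using contg zc D(2)
    by (intro continuous_intros continuous_at_compose[unfolded o_def, of t "\<lambda>t. r *\<^sub>R z t" g])
      (auto simp: continuous_on_eq_continuous_at)
  have bd: "\<bar>\<phi>' t\<bar> * d r \<le> 2 / k * (v r * norm (g (r *\<^sub>R z t)))" for t
  proof -
    have "\<bar>\<phi>' t\<bar> \<le> norm (g (r *\<^sub>R z t)) * (r * norm (D t))"
      unfolding \<phi>'_def using Cauchy_Schwarz_ineq2[of "g (r *\<^sub>R z t)" "r *\<^sub>R D t"] True by simp
    also have "\<dots> \<le> norm (g (r *\<^sub>R z t)) * (r * 2)"
      using D(3) True by (intro mult_left_mono) auto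
    finally have "\<bar>\<phi>' t\<bar> * d r \<le> norm (g (r *\<^sub>R z t)) * (r * 2) * d r"
      by (rule mult_right_mono) (rule d_nonneg)
    also have "\<dots> = 2 * norm (g (r *\<^sub>R z t)) * (r * d r)" by simp
    also have "\<dots> \<le> 2 * norm (g (r *\<^sub>R z t)) * (v r / k)"
      using k by (intro mult_left_mono) (auto simp: field_simps)
    finally show ?thesis by (simp add: field_simps)
  qed
  have [measurable]: "\<phi> \<in> borel_measurable borel" "\<phi>' \<in> borel_measurable borel"
    using der\<phi> cont\<phi>' by (auto intro!: borel_measurable_continuous_onI continuous_at_imp_continuous_on intro: DERIV_isCont)
  have y0: "y(i := y i) = y" by simp
  have yi: "y i \<in> {-1..1}" using y i unfolding cube_eq_1_iff by blast
  have "ennreal (\<bar>u (r *\<^sub>R dir e y)\<bar> * d r) = ennreal \<bar>\<phi> (y i)\<bar> * ennreal (d r)"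
    using dir_z[of "y i"] d_nonneg by (simp add: \<phi>_def ennreal_mult)
  also have "\<dots> \<le> (\<integral>\<^sup>+t. indicator {-1..1} t * (ennreal \<bar>\<phi> t\<bar> + ennreal \<bar>\<phi>' t\<bar>) \<partial>lborel) * ennreal (d r)"
    by (intro mult_right_mono interval_sup_bound[OF der\<phi> cont\<phi>' yi]) auto
  also have "\<dots> = (\<integral>\<^sup>+t. indicator {-1..1} t * (ennreal \<bar>\<phi> t\<bar> + ennreal \<bar>\<phi>' t\<bar>) * ennreal (d r) \<partial>lborel)"
    by (intro nn_integral_multc[symmetric]) measurable
  also have "\<dots> \<le> (\<integral>\<^sup>+t. cube e (y(i := t)) * ennreal (\<bar>u (r *\<^sub>R dir e (y(i := t)))\<bar> * d r +
       2 / k * (v r * norm (g (r *\<^sub>R dir e (y(i := t)))))) \<partial>lborel)"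
  proof (rule nn_integral_mono)
    fix t
    have "(ennreal \<bar>\<phi> t\<bar> + ennreal \<bar>\<phi>' t\<bar>) * ennreal (d r) = ennreal (\<bar>\<phi> t\<bar> * d r + \<bar>\<phi>' t\<bar> * d r)"
      using d_nonneg by (simp add: ennreal_mult[symmetric] ennreal_plus[symmetric] distrib_right del: ennreal_plus)
    also have "\<dots> \<le> ennreal (\<bar>\<phi> t\<bar> * d r + 2 / k * (v r * norm (g (r *\<^sub>R z t))))"
      using bd by (intro ennreal_leI) auto
    finally show "indicator {-1..1} t * (ennreal \<bar>\<phi> t\<bar> + ennreal \<bar>\<phi>' t\<bar>) * ennreal (d r) \<le>
      cube e (y(i := t)) * ennreal (\<bar>u (r *\<^sub>R dir e (y(i := t)))\<bar> * d r +
       2 / k * (v r * norm (g (r *\<^sub>R dir e (y(i := t))))))"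
      unfolding cube_upd[OF y i] dir_z \<phi>_def by (simp add: mult.assoc mult_left_mono)
  qed
  finally show ?thesis .
qed

text \<open>The \<open>m\<close>-th power of the integrand is a product of \<open>m + 1\<close>
  factors, one bounded radially and one for each slope. Hoelder in \<open>r\<close> at fixed slopes
  is the first of the n integrations; Loomis-Whitney carries out the remaining
  \<open>m\<close>.\<close>

lemma cone_sobolev:
  assumes k: "k > 0" "\<And>r. k * r * d r \<le> v r" and m: "Suc m = DIM('a)"
  shows "(\<integral>\<^sup>+y. cube e y * (\<integral>\<^sup>+r. ennreal ((v r * \<bar>u (r *\<^sub>R dir e y)\<bar>) powr (1 / m) *
      (\<bar>u (r *\<^sub>R dir e y)\<bar> * d r)) \<partial>lborel) \<partial>slopes e) ^ m \<le>
    cone_grad * (ennreal (1 + 2 / k) * cone_grad) ^ m"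
proof -
  let ?J = "Basis - {e} :: 'a set"
  have J: "finite ?J" "card ?J = m" "m > 0" "e \<notin> ?J" using e m dim by auto
  define U where "U r y = \<bar>u (r *\<^sub>R dir e y)\<bar>" for r y
  define P where "P r y = ennreal (U r y * d r + 2 / k * (v r * norm (g (r *\<^sub>R dir e y))))" for r y
  define G where "G y = cube e y * (\<integral>\<^sup>+r. P r y \<partial>lborel)" for y
  define A where "A y = (\<integral>\<^sup>+r. ennreal ((v r * U r y) powr (1 / m) * (U r y * d r)) \<partial>lborel)" for y
  have U[measurable]: "(\<lambda>(y, r). U r y) \<in> borel_measurable (slopes e \<Otimes>\<^sub>M lborel)"
    unfolding U_def by measurable
  have P[measurable]: "(\<lambda>(y, r). P r y) \<in> borel_measurable (slopes e \<Otimes>\<^sub>M lborel)"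
    unfolding P_def U_def by measurable
  have Gm[measurable]: "G \<in> borel_measurable (slopes e)" unfolding G_def by measurable
  have Am[measurable]: "A \<in> borel_measurable (slopes e)" unfolding A_def U_def by measurable
  have hoelder: "(cube e y * A y) ^ m \<le> cube e y * ray_grad y * (\<Prod>i\<in>?J. \<integral>\<^sup>+t. G (y(i := t)) \<partial>lborel)"
    if y: "y \<in> space (slopes e)" for y
  proof (cases "cube e y = 1")
    case False
    then show ?thesis using cube_cases[of e y] J by (simp add: zero_power)
  next
    case True
    \<comment> \<open>\<open>y\<close> already has a coordinate \<open>i\<close>. It is removed so
      that the update becomes the measurable insertion of a new coordinate.\<close>
    have upd: "(\<lambda>t. y(i := t)) \<in> lborel \<rightarrow>\<^sub>M slopes e" if "i \<in> ?J" for i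
    proof -
      have "(\<lambda>t. (restrict y (?J - {i}))(i := t)) \<in> lborel \<rightarrow>\<^sub>M PiM (insert i (?J - {i})) (\<lambda>_. lborel :: real measure)"
        by (rule measurable_component_update[of "restrict y (?J - {i})" "?J - {i}" "\<lambda>_. lborel" i])
          (auto simp: space_PiM)
      moreover have "(\<lambda>t. (restrict y (?J - {i}))(i := t)) = (\<lambda>t. y(i := t))"
        using y that by (auto simp: fun_eq_iff space_PiM PiE_def extensional_def)
      moreover have "insert i (?J - {i}) = ?J" using that by auto
      ultimately show ?thesis by simp
    qed
    define B where "B i r = (\<integral>\<^sup>+t. cube e (y(i := t)) * P r (y(i := t)) \<partial>lborel)" for i r
    have PB: "(\<lambda>(r, t). cube e (y(i := t)) * P r (y(i := t))) \<in> borel_measurable (lborel \<Otimes>\<^sub>M lborel)" if "i \<in> ?J" for i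
    proof -
      have "(\<lambda>x. (y(i := snd x), fst x)) \<in> (lborel \<Otimes>\<^sub>M lborel) \<rightarrow>\<^sub>M (slopes e \<Otimes>\<^sub>M (lborel :: real measure))"
        using measurable_compose[OF measurable_snd upd[OF that]] by (intro measurable_Pair) auto
      from measurable_compose[OF this P] have "(\<lambda>x. P (fst x) (y(i := snd x))) \<in> borel_measurable (lborel \<Otimes>\<^sub>M lborel)"
        by (simp only: prod.case)
      moreover have "(\<lambda>x. cube e (y(i := snd x))) \<in> borel_measurable ((lborel :: real measure) \<Otimes>\<^sub>M lborel)"
        by (rule measurable_compose[OF measurable_snd measurable_compose[OF upd[OF that] cube_measurable]])
      ultimately have "(\<lambda>x. cube e (y(i := snd x)) * P (fst x) (y(i := snd x))) \<in> borel_measurable (lborel \<Otimes>\<^sub>M lborel)"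
        by (intro borel_measurable_times_ennreal)
      then show ?thesis by (simp only: split_beta')
    qed
    have "A y ^ m \<le> ray_grad y * (\<Prod>i\<in>?J. \<integral>\<^sup>+r. B i r \<partial>lborel)"
      unfolding A_def
    proof (rule nn_integral_Hoelder_prod)
      show "B i \<in> borel_measurable lborel" if "i \<in> ?J" for i
        unfolding B_def using PB[OF that] by (rule lborel.borel_measurable_nn_integral)
      show "(\<lambda>r. ennreal ((v r * U r y) powr (1 / m) * (U r y * d r))) \<in> borel_measurable lborel"
        unfolding U_def by measurable
      fix r :: real
      have nn: "0 \<le> v r * U r y" "0 \<le> U r y * d r" using v_nonneg d_nonneg by (auto simp: U_def)
      have root: "(x powr (1 / m)) ^ m = x" if "x \<ge> 0" for x
        using that J(3) by (cases "x = 0") (auto simp: powr_realpow[symmetric] powr_powr zero_power)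
      have "ennreal ((v r * U r y) powr (1 / m) * (U r y * d r)) ^ m = ennreal (v r * U r y) * ennreal (U r y * d r) ^ m"
        using nn by (simp add: ennreal_power power_mult_distrib root ennreal_mult)
      also have "\<dots> \<le> ray_grad y * (\<Prod>i\<in>?J. B i r)"
      proof (rule mult_mono)
        show "ennreal (v r * U r y) \<le> ray_grad y" unfolding U_def by (rule ray_bounds)
        have "ennreal (U r y * d r) \<le> B i r" if "i \<in> ?J" for i
          unfolding B_def P_def U_def by (rule angular_bound[OF k(1) k(2) True that])
        then have "(\<Prod>i\<in>?J. ennreal (U r y * d r)) \<le> (\<Prod>i\<in>?J. B i r)"
          by (rule prod_mono_ennreal)
        then show "ennreal (U r y * d r) ^ m \<le> (\<Prod>i\<in>?J. B i r)" using J(2) by simp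
      qed auto
      finally show "ennreal ((v r * U r y) powr (1 / m) * (U r y * d r)) ^ m \<le> ray_grad y * (\<Prod>i\<in>?J. B i r)" .
    qed (use J in auto)
    also have "(\<Prod>i\<in>?J. \<integral>\<^sup>+r. B i r \<partial>lborel) = (\<Prod>i\<in>?J. \<integral>\<^sup>+t. G (y(i := t)) \<partial>lborel)"
    proof (rule prod.cong[OF refl])
      fix i assume i: "i \<in> ?J"
      have "(\<integral>\<^sup>+r. B i r \<partial>lborel) = (\<integral>\<^sup>+t. \<integral>\<^sup>+r. cube e (y(i := t)) * P r (y(i := t)) \<partial>lborel \<partial>lborel)"
        unfolding B_def by (rule lborel_pair.Fubini'[OF PB[OF i], symmetric])
      also have "\<dots> = (\<integral>\<^sup>+t. G (y(i := t)) \<partial>lborel)"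
        unfolding G_def
      proof (intro nn_integral_cong nn_integral_cmult)
        fix t
        show "(\<lambda>r. P r (y(i := t))) \<in> borel_measurable lborel" unfolding P_def U_def by measurable
      qed
      finally show "(\<integral>\<^sup>+r. B i r \<partial>lborel) = (\<integral>\<^sup>+t. G (y(i := t)) \<partial>lborel)" .
    qed
    finally show ?thesis using True by simp
  qed
  \<comment> \<open>Index \<open>e\<close> stands for the radial direction. It is the one element of
    \<open>Basis\<close> that is not a slope variable, and its factor is the ray integral.\<close>
  define H where "H l = (if l = e then (\<lambda>y. cube e y * ray_grad y) else G)" for l
  have "(\<integral>\<^sup>+y. cube e y * A y \<partial>slopes e) ^ m \<le> (\<Prod>l\<in>Basis. \<integral>\<^sup>+y. H l y \<partial>slopes e)"
  proof (rule lborel_product.nn_integral_Loomis_Whitney)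
    fix y assume y: "y \<in> space (slopes e)"
    have "Basis - ?J = {e}" using e by auto
    moreover have "(\<Prod>i\<in>?J. \<integral>\<^sup>+t. H i (y(i := t)) \<partial>lborel) = (\<Prod>i\<in>?J. \<integral>\<^sup>+t. G (y(i := t)) \<partial>lborel)"
      by (intro prod.cong) (auto simp: H_def)
    ultimately show "(cube e y * A y) ^ m \<le> (\<Prod>l\<in>Basis - ?J. H l y) * (\<Prod>i\<in>?J. \<integral>\<^sup>+t. H i (y(i := t)) \<partial>lborel)"
      using hoelder[OF y] by (simp add: H_def)
  next
    show "H l \<in> borel_measurable (slopes e)" for l unfolding H_def by simp
  qed (use J m in \<open>auto intro: finite_Basis\<close>)
  also have "\<dots> = cone_grad * (\<integral>\<^sup>+y. G y \<partial>slopes e) ^ m"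
  proof -
    have "(\<Prod>l\<in>Basis. \<integral>\<^sup>+y. H l y \<partial>slopes e) = (\<integral>\<^sup>+y. H e y \<partial>slopes e) * (\<Prod>l\<in>?J. \<integral>\<^sup>+y. H l y \<partial>slopes e)"
      using e by (intro prod.remove) auto
    also have "(\<Prod>l\<in>?J. \<integral>\<^sup>+y. H l y \<partial>slopes e) = (\<Prod>l\<in>?J. \<integral>\<^sup>+y. G y \<partial>slopes e)"
      by (intro prod.cong) (auto simp: H_def)
    finally show ?thesis using J by (simp add: H_def cone_grad_def)
  qed
  \<comment> \<open>Here \<open>1 + 2 / k\<close> arises: \<open>1\<close> from the mean terms
    through \<open>cone_hardy\<close>, \<open>2 / k\<close> from the gradient terms.\<close>
  also have "\<dots> \<le> cone_grad * (ennreal (1 + 2 / k) * cone_grad) ^ m"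
  proof (intro mult_left_mono power_mono)
    have "(\<integral>\<^sup>+y. G y \<partial>slopes e) = (\<integral>\<^sup>+y. cube e y * (\<integral>\<^sup>+r. ennreal (U r y * d r) \<partial>lborel) + ennreal (2 / k) * (cube e y * ray_grad y) \<partial>slopes e)"
    proof (rule nn_integral_cong)
      fix y
      have "(\<integral>\<^sup>+r. P r y \<partial>lborel) = (\<integral>\<^sup>+r. ennreal (U r y * d r) + ennreal (2 / k) * ennreal (v r * norm (g (r *\<^sub>R dir e y))) \<partial>lborel)"
        unfolding P_def using k(1) v_nonneg d_nonneg
        by (intro nn_integral_cong) (simp add: U_def ennreal_mult[symmetric] ennreal_plus[symmetric] del: ennreal_plus)
      also have "\<dots> = (\<integral>\<^sup>+r. ennreal (U r y * d r) \<partial>lborel) + ennreal (2 / k) * ray_grad y"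
        unfolding ray_grad_def U_def by (simp add: nn_integral_add nn_integral_cmult)
      finally show "G y = cube e y * (\<integral>\<^sup>+r. ennreal (U r y * d r) \<partial>lborel) + ennreal (2 / k) * (cube e y * ray_grad y)"
        by (simp add: G_def distrib_left mult_ac)
    qed
    also have "\<dots> = (\<integral>\<^sup>+y. cube e y * (\<integral>\<^sup>+r. ennreal (U r y * d r) \<partial>lborel) \<partial>slopes e) + ennreal (2 / k) * cone_grad"
      unfolding cone_grad_def U_def by (simp add: nn_integral_add nn_integral_cmult)
    also have "\<dots> \<le> cone_grad + ennreal (2 / k) * cone_grad"
      unfolding U_def by (intro add_right_mono cone_hardy)
    also have "\<dots> = ennreal (1 + 2 / k) * cone_grad"
      using k(1) by (simp add: distrib_right)
    finally show "(\<integral>\<^sup>+y. G y \<partial>slopes e) \<le> ennreal (1 + 2 / k) * cone_grad" .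
  qed auto
  finally show ?thesis unfolding A_def U_def .
qed

end

section \<open>Regularity of the weights\<close>

text \<open>Clamping the argument to a compact interval makes \<open>f\<close> globally Lipschitz
  without changing it inside. Countably many such intervals exhaust the open interval, so the
  exceptional sets can be united.\<close>

lemma AE_differentiable_of_locally_lipschitz:
  fixes f :: "real \<Rightarrow> real"
  assumes lip: "\<And>a b. 0 < a \<Longrightarrow> a < b \<Longrightarrow> b < \<eta> \<Longrightarrow> \<exists>L. L-lipschitz_on {a..b} f"
  shows "AE x in lborel. 0 < x \<and> x < \<eta> \<longrightarrow> (\<exists>D. (f has_real_derivative D) (at x))"
proof -
  have *: "AE x in lborel. a < x \<and> x < b \<longrightarrow> (\<exists>D. (f has_real_derivative D) (at x))"
    if ab: "0 < a" "b < \<eta>" for a b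
  proof (cases "a < b")
    case True
    define F where "F x = f (max a (min b x))" for x
    obtain L where L: "L-lipschitz_on {a..b} f" using lip ab True by blast
    have "L-lipschitz_on UNIV F"
    proof (rule lipschitz_onI)
      fix x y :: real
      have "dist (F x) (F y) \<le> L * dist (max a (min b x)) (max a (min b y))"
        unfolding F_def using L True by (intro lipschitz_onD[OF L]) auto
      also have "\<dots> \<le> L * dist x y"
        using lipschitz_on_nonneg[OF L] by (intro mult_left_mono) (auto simp: dist_real_def max_def min_def)
      finally show "dist (F x) (F y) \<le> L * dist x y" .
    qed (use lipschitz_on_nonneg[OF L] in auto)
    then obtain g where "AE x in lborel. (F has_real_derivative g x) (at x)"
      using lipschitz_AE_derivative by blast
    then show ?thesis
    proof eventually_elim
      case (elim x)
      show ?case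
      proof
        assume "a < x \<and> x < b"
        then have "(f has_real_derivative g x) (at x)"
          by (intro has_field_derivative_transform_within_open[OF elim, of "{a<..<b}"]) (auto simp: F_def)
        then show "\<exists>D. (f has_real_derivative D) (at x)" by blast
      qed
    qed
  qed auto
  have "AE x in lborel. \<forall>n. 1 / real (Suc n) < x \<and> x < \<eta> - 1 / real (Suc n) \<longrightarrow> (\<exists>D. (f has_real_derivative D) (at x))"
    unfolding AE_all_countable by (intro allI *) auto
  then show ?thesis
  proof eventually_elim
    case (elim x)
    show ?case
    proof
      assume x: "0 < x \<and> x < \<eta>"
      then obtain n where "inverse (real (Suc n)) < min x (\<eta> - x)"
        using reals_Archimedean[of "min x (\<eta> - x)"] by auto
      then have "1 / real (Suc n) < x" "x < \<eta> - 1 / real (Suc n)" by (auto simp: divide_inverse)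
      with elim show "\<exists>D. (f has_real_derivative D) (at x)" by blast
    qed
  qed
qed

text \<open>Monotonicity makes the derivative nonnegative, so its absolute value integrates to the
  increment. This supplies the integral bounds on \<open>d\<close> in
  \<open>hardy_weight\<close>.\<close>

lemma nn_integral_derivative_mono:
  fixes f d :: "real \<Rightarrow> real"
  assumes ab: "a \<le> b" and mono: "mono_on {a..b} f" and L: "L-lipschitz_on {a..b} f"
    and d: "AE x in lborel. a < x \<and> x < b \<longrightarrow> (\<exists>D. (f has_real_derivative D) (at x) \<and> d x = \<bar>D\<bar>)"
  shows "(\<integral>\<^sup>+x. indicator {a..b} x * ennreal (d x) \<partial>lborel) = ennreal (f b - f a)"
proof -
  define F where "F x = f (max a (min b x))" for x
  have "L-lipschitz_on UNIV F"
  proof (rule lipschitz_onI)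
    fix x y :: real
    have "dist (F x) (F y) \<le> L * dist (max a (min b x)) (max a (min b y))"
      unfolding F_def using L ab by (intro lipschitz_onD[OF L]) auto
    also have "\<dots> \<le> L * dist x y"
      using lipschitz_on_nonneg[OF L] by (intro mult_left_mono) (auto simp: dist_real_def max_def min_def)
    finally show "dist (F x) (F y) \<le> L * dist x y" .
  qed (use lipschitz_on_nonneg[OF L] in auto)
  then obtain g where gd: "AE x in lborel. (F has_real_derivative g x) (at x)"
    and I: "\<And>a b. a \<le> b \<Longrightarrow> has_bochner_integral lborel (\<lambda>x. g x * indicator {a..b} x) (F b - F a)"
    using lipschitz_AE_derivative by blast
  have ae: "AE x in lborel. g x * indicator {a..b} x = d x * indicator {a..b} x \<and> 0 \<le> g x * indicator {a..b} x"
    using gd d AE_lborel_singleton[of a] AE_lborel_singleton[of b]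
  proof eventually_elim
    case (elim x)
    show ?case
    proof (cases "x \<in> {a..b}")
      case True
      then have x: "a < x" "x < b" using elim(3,4) by auto
      then have f: "(f has_real_derivative g x) (at x)"
        by (intro has_field_derivative_transform_within_open[OF elim(1), of "{a<..<b}"]) (auto simp: F_def)
      have "0 \<le> g x"
        using mono_on_imp_deriv_nonneg[OF mono f] x by simp
      moreover obtain D where "(f has_real_derivative D) (at x)" "d x = \<bar>D\<bar>" using elim(2) x by blast
      ultimately show ?thesis using DERIV_unique[OF f] by auto
    qed simp
  qed
  have FF: "F b - F a = f b - f a" using ab by (simp add: F_def)
  have "(\<integral>\<^sup>+x. indicator {a..b} x * ennreal (d x) \<partial>lborel) = (\<integral>\<^sup>+x. ennreal (g x * indicator {a..b} x) \<partial>lborel)"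
  proof (rule nn_integral_cong_AE)
    show "AE x in lborel. indicator {a..b} x * ennreal (d x) = ennreal (g x * indicator {a..b} x)"
      using ae by eventually_elim (auto simp: indicator_def)
  qed
  also have "\<dots> = ennreal (\<integral>x. g x * indicator {a..b} x \<partial>lborel)"
    using I[OF ab] ae by (intro nn_integral_eq_integral) (auto simp: has_bochner_integral_iff)
  also have "(\<integral>x. g x * indicator {a..b} x \<partial>lborel) = f b - f a"
    using I[OF ab] FF by (simp add: has_bochner_integral_iff)
  finally show ?thesis .
qed

section \<open>Attained infima, and contact of a weight with its monotone minorant\<close>

lemma W_class_lipschitz:
  assumes "w \<in> W_class c" "0 < a" shows "\<exists>L. L-lipschitz_on {a..b} w"
proof -
  have "compact {a..b} \<and> {a..b} \<subseteq> {0<..}" using assms(2) by auto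
  with assms(1) show ?thesis by (auto simp: W_class_def)
qed

lemma W_class_pos: "w \<in> W_class c \<Longrightarrow> 0 < t \<Longrightarrow> 0 < w t"
  by (auto simp: W_class_def)

lemma W_class_continuous_on:
  assumes "w \<in> W_class c" "0 < a" shows "continuous_on {a..b} w"
  using W_class_lipschitz[OF assms, of b] lipschitz_on_continuous_on by blast

lemma W_class_isCont:
  assumes "w \<in> W_class c" "0 < t" shows "isCont w t"
proof -
  have "continuous_on {t/2..2*t} w" using assms by (intro W_class_continuous_on) auto
  then show ?thesis using assms(2) by (intro continuous_on_interior) (auto simp: interior_atLeastAtMost_real)
qed

lemma phi_attained:
  assumes "w \<in> W_class c" "0 < t" "t \<le> \<eta>"
  shows "\<exists>x\<in>{t..\<eta>}. phi w \<eta> t = w x \<and> (\<forall>y\<in>{t..\<eta>}. w x \<le> w y)"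
proof -
  obtain x where x: "x \<in> {t..\<eta>}" "\<forall>y\<in>{t..\<eta>}. w x \<le> w y"
    using continuous_attains_inf[OF _ _ W_class_continuous_on[OF assms(1,2), of \<eta>]] assms(3) by auto
  have "(INF s\<in>{t..\<eta>}. w s) = w x"
    by (rule cInf_eq_minimum) (use x in auto)
  then show ?thesis using x assms(3) by (auto simp: phi_def)
qed

text \<open>Since \<open>w\<close> blows up at the origin, its values near \<open>0\<close> exceed
  \<open>w t\<close>, so only a compact interval competes for the infimum.\<close>

lemma psi_attained:
  assumes w: "w \<in> W_class \<infinity>" and t: "0 < t" "t \<le> \<eta>"
  shows "\<exists>x\<in>{0<..t}. psi w \<eta> t = w x \<and> (\<forall>y\<in>{0<..t}. w x \<le> w y)"
proof -
  have "((\<lambda>s. ennreal (w s)) \<longlongrightarrow> \<infinity>) (at_right 0)" using w by (simp add: W_class_def)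
  then have "\<forall>\<^sub>F s in at_right 0. ennreal (w t) < ennreal (w s)"
    by (rule order_tendstoD) simp
  then obtain \<delta> where \<delta>: "\<delta> > 0" "\<And>s. 0 < s \<Longrightarrow> s < \<delta> \<Longrightarrow> w t < w s"
    unfolding eventually_at_right_field using W_class_pos[OF w t(1)]
    by (metis ennreal_leI not_le)
  define \<delta>' where "\<delta>' = min \<delta> t"
  have \<delta>': "0 < \<delta>'" "\<delta>' \<le> t" using \<delta> t by (auto simp: \<delta>'_def)
  obtain x where x: "x \<in> {\<delta>'..t}" "\<forall>y\<in>{\<delta>'..t}. w x \<le> w y"
    using continuous_attains_inf[OF _ _ W_class_continuous_on[OF w \<delta>'(1), of t]] \<delta>'(2) by auto
  have min: "w x \<le> w y" if "y \<in> {0<..t}" for y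
  proof (cases "y < \<delta>'")
    case True
    then have "w t < w y" using \<delta>(2) that by (auto simp: \<delta>'_def)
    moreover have "w x \<le> w t" using x \<delta>'(2) by auto
    ultimately show ?thesis by simp
  qed (use x that in auto)
  have "(INF s\<in>{0<..t}. w s) = w x"
    by (rule cInf_eq_minimum) (use x min \<delta>'(1) in auto)
  then show ?thesis using x min \<delta>'(1) t by (intro bexI[of _ x]) (auto simp: psi_def)
qed

text \<open>The last clause says that \<open>v\<close> can only vary where it touches \<open>w\<close>; together with
  \<open>v \<le> w\<close> it carries the regularity of \<open>w\<close> over to \<open>v\<close> in both cases.\<close>

definition touching_minorant :: "real \<Rightarrow> (real \<Rightarrow> real) \<Rightarrow> (real \<Rightarrow> real) \<Rightarrow> bool" where
  "touching_minorant \<eta> w v \<longleftrightarrow> (\<forall>t. 0 < t \<and> t \<le> \<eta> \<longrightarrow> 0 < v t \<and> v t \<le> w t) \<and>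
     (\<forall>s t. 0 < s \<and> s < t \<and> t \<le> \<eta> \<and> v s \<noteq> v t \<longrightarrow> (\<exists>x\<in>{s..t}. min (v s) (v t) = w x))"

lemma phi_mono:
  assumes w: "w \<in> W_class c" and st: "0 < s" "s \<le> t" "t \<le> \<eta>"
  shows "phi w \<eta> s \<le> phi w \<eta> t"
  using phi_attained[OF w, of s \<eta>] phi_attained[OF w, of t \<eta>] st by fastforce

lemma psi_antimono:
  assumes w: "w \<in> W_class \<infinity>" and st: "0 < s" "s \<le> t" "t \<le> \<eta>"
  shows "psi w \<eta> t \<le> psi w \<eta> s"
  using psi_attained[OF w, of s \<eta>] psi_attained[OF w, of t \<eta>] st by fastforce

text \<open>A minimiser for \<open>s\<close> lying beyond \<open>t\<close> would also compete for
  the infimum belonging to \<open>t\<close>, and the two values would agree. So it lies in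
  \<open>{s..t}\<close>. For \<open>psi\<close> the same argument places the minimiser belonging to
  \<open>t\<close> there.\<close>

lemma touching_minorant_phi:
  assumes w: "w \<in> W_class c"
  shows "touching_minorant \<eta> w (phi w \<eta>)"
  unfolding touching_minorant_def
proof (intro conjI allI impI)
  fix t assume "0 < t \<and> t \<le> \<eta>"
  then show "0 < phi w \<eta> t" "phi w \<eta> t \<le> w t"
    using phi_attained[OF w, of t \<eta>] W_class_pos[OF w] by fastforce+
next
  fix s t assume st: "0 < s \<and> s < t \<and> t \<le> \<eta> \<and> phi w \<eta> s \<noteq> phi w \<eta> t"
  then have lt: "phi w \<eta> s < phi w \<eta> t" using phi_mono[OF w, of s t \<eta>] by simp
  obtain x where x: "x \<in> {s..\<eta>}" "phi w \<eta> s = w x" using phi_attained[OF w, of s \<eta>] st by auto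
  obtain z where z: "z \<in> {t..\<eta>}" "phi w \<eta> t = w z" "\<forall>y\<in>{t..\<eta>}. w z \<le> w y"
    using phi_attained[OF w, of t \<eta>] st by auto
  have "x \<le> t" using x z lt by (metis atLeastAtMost_iff linear not_le)
  then show "\<exists>x\<in>{s..t}. min (phi w \<eta> s) (phi w \<eta> t) = w x"
    using x lt by (intro bexI[of _ x]) auto
qed

lemma touching_minorant_psi:
  assumes w: "w \<in> W_class \<infinity>"
  shows "touching_minorant \<eta> w (psi w \<eta>)"
  unfolding touching_minorant_def
proof (intro conjI allI impI)
  fix t assume "0 < t \<and> t \<le> \<eta>"
  then show "0 < psi w \<eta> t" "psi w \<eta> t \<le> w t"
    using psi_attained[OF w, of t \<eta>] W_class_pos[OF w] by fastforce+
next
  fix s t assume st: "0 < s \<and> s < t \<and> t \<le> \<eta> \<and> psi w \<eta> s \<noteq> psi w \<eta> t"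
  then have lt: "psi w \<eta> t < psi w \<eta> s" using psi_antimono[OF w, of s t \<eta>] by simp
  obtain x where x: "x \<in> {0<..t}" "psi w \<eta> t = w x" using psi_attained[OF w, of t \<eta>] st by auto
  obtain z where z: "z \<in> {0<..s}" "psi w \<eta> s = w z" "\<forall>y\<in>{0<..s}. w z \<le> w y"
    using psi_attained[OF w, of s \<eta>] st by auto
  have "s \<le> x" using x z lt by (metis greaterThanAtMost_iff linear not_le)
  then show "\<exists>x\<in>{s..t}. min (psi w \<eta> s) (psi w \<eta> t) = w x"
    using x lt by (intro bexI[of _ x]) auto
qed

text \<open>When the two values of \<open>v\<close> differ, the smaller one equals
  \<open>w x\<close> at an intermediate point and the larger one is at most \<open>w\<close> at its
  own point. Their difference is thus bounded by a difference of values of \<open>w\<close> over a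
  shorter distance.\<close>

lemma touching_minorant_lipschitz:
  assumes tm: "touching_minorant \<eta> w v" and ab: "0 < a" "b \<le> \<eta>" and L: "L-lipschitz_on {a..b} w"
  shows "L-lipschitz_on {a..b} v"
proof (rule lipschitz_onI)
  show "0 \<le> L" using L by (rule lipschitz_on_nonneg)
  have *: "dist (v s) (v t) \<le> L * dist s t" if st: "s \<in> {a..b}" "t \<in> {a..b}" "s < t" for s t
  proof (cases "v s = v t")
    case True
    then show ?thesis using \<open>0 \<le> L\<close> by simp
  next
    case False
    then obtain x where x: "x \<in> {s..t}" "min (v s) (v t) = w x"
    proof -
      have "0 < s \<and> s < t \<and> t \<le> \<eta> \<and> v s \<noteq> v t" using st ab False by auto
      then show ?thesis using tm that unfolding touching_minorant_def by blast
    qed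
    have le: "v s \<le> w s" "v t \<le> w t" using tm st ab by (auto simp: touching_minorant_def)
    have wx: "\<bar>w p - w x\<bar> \<le> L * \<bar>p - x\<bar>" if "p \<in> {s, t}" for p
      using lipschitz_onD[OF L, of p x] that st x by (auto simp: dist_real_def)
    have px: "L * \<bar>p - x\<bar> \<le> L * (t - s)" if "p \<in> {s, t}" for p
      using x that \<open>0 \<le> L\<close> by (intro mult_left_mono) auto
    show ?thesis
      using x(2) le wx[of s] wx[of t] px[of s] px[of t] st(3)
      by (auto simp: dist_real_def min_def abs_if split: if_splits)
  qed
  show "dist (v x) (v y) \<le> L * dist x y" if "x \<in> {a..b}" "y \<in> {a..b}" for x y
    using *[of x y] *[of y x] that \<open>0 \<le> L\<close> by (cases x y rule: linorder_cases) (auto simp: dist_commute)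
qed

text \<open>If \<open>v r < w r\<close>, then \<open>w\<close> stays above \<open>v r\<close> near
  \<open>r\<close>, whereas any variation of \<open>v\<close> there would force \<open>w\<close> to
  take a value at most \<open>v r\<close>; hence \<open>v\<close> is locally constant, against
  \<open>D \<noteq> 0\<close>. At a contact point \<open>w - v\<close> has a local minimum, so the
  derivatives agree.\<close>

lemma touching_minorant_derivative:
  assumes tm: "touching_minorant \<eta> w v" and r: "0 < r" "r < \<eta>" and c: "isCont w r"
    and v: "(v has_real_derivative D) (at r)" and w: "(w has_real_derivative E) (at r)" and D: "D \<noteq> 0"
  shows "w r = v r \<and> E = D"
proof -
  have le: "v t \<le> w t" if "0 < t" "t < \<eta>" for t using tm that by (auto simp: touching_minorant_def)
  have eq: "w r = v r"
  proof (rule ccontr)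
    assume "w r \<noteq> v r"
    then have "v r < w r" using le[OF r] by simp
    then have "\<forall>\<^sub>F s in nhds r. v r < w s"
      using c unfolding continuous_at by (intro order_tendstoD) (auto simp: tendsto_at_iff_tendsto_nhds)
    moreover have "\<forall>\<^sub>F s in nhds r. s \<in> {0<..<\<eta>}"
      using r by (intro eventually_nhds_in_open) auto
    ultimately have "\<forall>\<^sub>F s in nhds r. v r < w s \<and> s \<in> {0<..<\<eta>}" by eventually_elim auto
    then obtain \<delta> where \<delta>: "\<delta> > 0" "\<And>s. dist s r < \<delta> \<Longrightarrow> v r < w s \<and> s \<in> {0<..<\<eta>}"
      by (auto simp: eventually_nhds_metric)
    have const: "v s = v r" if s: "dist s r < \<delta>" for s
    proof (rule ccontr)
      assume ne: "v s \<noteq> v r"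
      have s0: "0 < s" "s < \<eta>" using \<delta>(2)[OF s] by auto
      have "\<exists>x. dist x r < \<delta> \<and> min (v s) (v r) = w x"
      proof (cases "s < r")
        case True
        then obtain x where "x \<in> {s..r}" "min (v s) (v r) = w x"
          using tm ne s0 r unfolding touching_minorant_def by (meson less_imp_le)
        then show ?thesis using s by (intro exI[of _ x]) (auto simp: dist_real_def)
      next
        case False
        with ne have "r < s" by (cases "r = s") auto
        then obtain x where "x \<in> {r..s}" "min (v r) (v s) = w x"
          using tm ne s0 r unfolding touching_minorant_def by (metis less_imp_le)
        then show ?thesis using s by (intro exI[of _ x]) (auto simp: dist_real_def min.commute)
      qed
      then show False using \<delta>(2) by (metis min.cobounded2 not_le)
    qed
    have "\<forall>y. \<bar>r - y\<bar> < \<delta> \<longrightarrow> v r = v y"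
      using const unfolding dist_real_def by (metis abs_minus_commute)
    then have "D = 0" by (rule DERIV_local_const[OF v \<delta>(1)])
    with D show False by simp
  qed
  have "((\<lambda>t. w t - v t) has_real_derivative E - D) (at r)"
    using v w by (intro DERIV_diff)
  moreover have "0 < min r (\<eta> - r)" using r by simp
  moreover have "\<forall>y. \<bar>r - y\<bar> < min r (\<eta> - r) \<longrightarrow> w r - v r \<le> w y - v y"
    using le eq by (auto simp: abs_if split: if_splits)
  ultimately have "E - D = 0" by (rule DERIV_local_min)
  with eq show ?thesis by simp
qed

section \<open>From the hypothesis on K to the abstract weight pair\<close>

lemma K_fun_lower_bound:
  assumes w: "w \<in> V_class" and tm: "touching_minorant \<eta> w (v_fun w \<eta>)" and r: "0 < r" "r < \<eta>"
    and v': "(v_fun w \<eta> has_real_derivative D) (at r)" and w': "(w has_real_derivative E) (at r)"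
    and k: "k > 0" "\<And>r. r \<in> {0<..\<eta>} \<inter> Z_set (v_fun w \<eta>) \<Longrightarrow> k \<le> K_fun w r"
  shows "k * r * \<bar>D\<bar> \<le> v_fun w \<eta> r"
proof (cases "D = 0")
  case True
  then show ?thesis using tm r by (auto simp: touching_minorant_def less_imp_le)
next
  case False
  obtain c where "w \<in> W_class c" using w by (auto simp: V_class_def)
  then have "isCont w r" using r(1) by (rule W_class_isCont)
  \<comment> \<open>With \<open>w\<close> and its derivative replaced by \<open>v\<close> and its
    derivative, \<open>K_fun w r\<close> is the quotient of \<open>v r\<close> by
    \<open>r * \<bar>D\<bar>\<close>, and its lower bound is the claim.\<close>
  from touching_minorant_derivative[OF tm r this v' w' False]
  have eq: "w r = v_fun w \<eta> r" "E = D" by auto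
  have "r \<in> {0<..\<eta>} \<inter> Z_set (v_fun w \<eta>)"
    using r v' False DERIV_imp_deriv[OF v'] by (auto simp: Z_set_def real_differentiable_def)
  from k(2)[OF this] have "k \<le> \<bar>v_fun w \<eta> r / (r * D)\<bar>"
    using DERIV_imp_deriv[OF w'] eq by (simp add: K_fun_def)
  moreover have "0 < v_fun w \<eta> r" using tm r by (auto simp: touching_minorant_def)
  ultimately show ?thesis using r False by (simp add: abs_mult pos_le_divide_eq mult.assoc)
qed

lemma hardy_weight_of_minorant:
  assumes tm: "touching_minorant \<eta> w v" and w: "w \<in> W_class c"
    and mono: "(\<forall>s t. 0 < s \<and> s \<le> t \<and> t < \<eta> \<longrightarrow> v s \<le> v t) \<or> (\<forall>s t. 0 < s \<and> s \<le> t \<and> t < \<eta> \<longrightarrow> v t \<le> v s)"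
    and k: "0 \<le> k" and kv: "\<And>r D E. 0 < r \<Longrightarrow> r < \<eta> \<Longrightarrow> (v has_real_derivative D) (at r) \<Longrightarrow>
      (w has_real_derivative E) (at r) \<Longrightarrow> k * r * \<bar>D\<bar> \<le> v r"
  obtains V d where "hardy_weight \<eta> V d" "\<And>r. k * r * d r \<le> V r" "\<And>r. 0 < r \<Longrightarrow> r < \<eta> \<Longrightarrow> V r = v r"
    "AE r in lborel. 0 < r \<and> r < \<eta> \<longrightarrow> (\<exists>D. (v has_real_derivative D) (at r) \<and> d r = \<bar>D\<bar>)"
proof -
  define V where "V r = indicator {0<..<\<eta>} r * v r" for r
  \<comment> \<open>This \<open>lim\<close> is Borel measurable whether or not the quotients
    converge, and equals the derivative wherever that exists. \<open>V\<close> is used because it is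
    Borel on the whole line.\<close>
  define dd where "dd r = lim (\<lambda>n. (V (r + 1 / Suc n) - V r) / (1 / Suc n))" for r
  \<comment> \<open>Replacing the derivative by zero where the bound fails makes
    \<open>k * r * d r \<le> V r\<close> hold at every radius. By \<open>kv\<close> the failure is
    confined to a null set of radii in (0, \<eta>).\<close>
  define d where "d r = (if 0 < r \<and> r < \<eta> \<and> k * r * \<bar>dd r\<bar> \<le> V r then \<bar>dd r\<bar> else 0)" for r
  have vpos: "0 < v r" if "0 < r" "r < \<eta>" for r using tm that by (auto simp: touching_minorant_def)
  have Vv: "V r = v r" if "0 < r" "r < \<eta>" for r using that by (simp add: V_def)
  have lipw: "\<exists>L. L-lipschitz_on {a..b} w" if "0 < a" for a b
    by (rule W_class_lipschitz[OF w that])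
  have lip: "\<exists>L. L-lipschitz_on {a..b} v" if "0 < a" "b < \<eta>" for a b
    using touching_minorant_lipschitz[OF tm that(1), of b] lipw[OF that(1)] that(2) by (meson less_imp_le)
  have "continuous_on {0<..<\<eta>} v"
  proof (rule continuous_at_imp_continuous_on, rule ballI)
    fix x assume x: "x \<in> {0<..<\<eta>}"
    have "continuous_on {x / 2..(x + \<eta>) / 2} v"
      using lip[of "x / 2" "(x + \<eta>) / 2"] x lipschitz_on_continuous_on by force
    then show "isCont v x" using x by (intro continuous_on_interior) (auto simp: interior_atLeastAtMost_real field_simps)
  qed
  then have Vm[measurable]: "V \<in> borel_measurable borel"
    unfolding V_def using borel_measurable_continuous_on_indicator[of "{0<..<\<eta>}" v] by simp
  have ddm[measurable]: "dd \<in> borel_measurable borel" unfolding dd_def by measurable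
  have dm: "d \<in> borel_measurable borel" unfolding d_def by measurable
  have "AE r in lborel. 0 < r \<and> r < \<eta> \<longrightarrow> (\<exists>D. (v has_real_derivative D) (at r))"
    by (rule AE_differentiable_of_locally_lipschitz) (use lip in auto)
  moreover have "AE r in lborel. 0 < r \<and> r < \<eta> \<longrightarrow> (\<exists>D. (w has_real_derivative D) (at r))"
    by (rule AE_differentiable_of_locally_lipschitz) (use lipw in auto)
  ultimately have ae: "AE r in lborel. 0 < r \<and> r < \<eta> \<longrightarrow> (\<exists>D. (v has_real_derivative D) (at r) \<and> d r = \<bar>D\<bar>)"
  proof eventually_elim
    case (elim r)
    show ?case
    proof
      assume r: "0 < r \<and> r < \<eta>"
      with elim obtain D E where D: "(v has_real_derivative D) (at r)" and E: "(w has_real_derivative E) (at r)" by blast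
      have "(V has_real_derivative D) (at r)"
        by (rule has_field_derivative_transform_within_open[OF D, of "{0<..<\<eta>}"]) (use r in \<open>auto simp: V_def\<close>)
      then have "(\<lambda>h. (V (r + h) - V r) / h) \<midarrow>0\<rightarrow> D" by (simp add: DERIV_def)
      moreover have "filterlim (\<lambda>n. 1 / real (Suc n)) (at 0) sequentially"
        unfolding filterlim_at using LIMSEQ_Suc[OF lim_1_over_n[where ?'a = real]] by (auto simp: field_simps)
      ultimately have "(\<lambda>n. (V (r + 1 / Suc n) - V r) / (1 / Suc n)) \<longlonglongrightarrow> D"
        by (rule filterlim_compose)
      then have "dd r = D" unfolding dd_def by (rule limI)
      then have "d r = \<bar>D\<bar>" using kv[OF _ _ D E] r by (simp add: d_def Vv)
      with D show "\<exists>D. (v has_real_derivative D) (at r) \<and> d r = \<bar>D\<bar>" by blast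
    qed
  qed
  have "hardy_weight \<eta> V d"
    unfolding hardy_weight_def
  proof (intro conjI allI impI)
    show "0 \<le> V r" "0 \<le> d r" for r using vpos[of r] by (auto simp: V_def d_def indicator_def)
    show "V r = 0" "d r = 0" if "r \<notin> {0<..<\<eta>}" for r using that by (auto simp: V_def d_def)
    show "0 < V r" if "0 < r \<and> r < \<eta>" for r using that vpos Vv by simp
    have int: "(\<integral>\<^sup>+r. indicator {a..b} r * ennreal (d r) \<partial>lborel) = ennreal (f b - f a)"
      if f: "f = v \<or> f = (\<lambda>r. - v r)" and m: "mono_on {a..b} f" and ab: "0 < a" "a \<le> b" "b < \<eta>" for a b f
    proof -
      obtain L where "L-lipschitz_on {a..b} v" using lip ab by blast
      then have "L-lipschitz_on {a..b} f" using f by (auto simp: lipschitz_on_def dist_minus)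
      moreover have "AE x in lborel. a < x \<and> x < b \<longrightarrow> (\<exists>D. (f has_real_derivative D) (at x) \<and> d x = \<bar>D\<bar>)"
        using ae
      proof eventually_elim
        case (elim x)
        show ?case
        proof
          assume "a < x \<and> x < b"
          with elim ab obtain D where "(v has_real_derivative D) (at x)" "d x = \<bar>D\<bar>" by auto
          then show "\<exists>D. (f has_real_derivative D) (at x) \<and> d x = \<bar>D\<bar>"
            using f DERIV_minus by (metis abs_minus_cancel)
        qed
      qed
      ultimately show ?thesis using m ab by (intro nn_integral_derivative_mono) auto
    qed
    show "(\<forall>a b. 0 < a \<and> a \<le> b \<and> b < \<eta> \<longrightarrow> V a \<le> V b \<and> (\<integral>\<^sup>+r. indicator {a..b} r * ennreal (d r) \<partial>lborel) \<le> ennreal (V b)) \<or>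
      (\<forall>a b. 0 < a \<and> a \<le> b \<and> b < \<eta> \<longrightarrow> V b \<le> V a \<and> (\<integral>\<^sup>+r. indicator {a..b} r * ennreal (d r) \<partial>lborel) \<le> ennreal (V a))"
      using mono
    proof
      assume m: "\<forall>s t. 0 < s \<and> s \<le> t \<and> t < \<eta> \<longrightarrow> v s \<le> v t"
      have "V a \<le> V b \<and> (\<integral>\<^sup>+r. indicator {a..b} r * ennreal (d r) \<partial>lborel) \<le> ennreal (V b)"
        if ab: "0 < a" "a \<le> b" "b < \<eta>" for a b
      proof -
        have "mono_on {a..b} v" using m ab by (auto intro!: mono_onI)
        then have "(\<integral>\<^sup>+r. indicator {a..b} r * ennreal (d r) \<partial>lborel) = ennreal (v b - v a)"
          using ab by (intro int) auto
        also have "\<dots> \<le> ennreal (V b)" using vpos[of a] ab Vv by (intro ennreal_leI) auto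
        finally show ?thesis using m ab Vv by auto
      qed
      then show ?thesis by blast
    next
      assume m: "\<forall>s t. 0 < s \<and> s \<le> t \<and> t < \<eta> \<longrightarrow> v t \<le> v s"
      have "V b \<le> V a \<and> (\<integral>\<^sup>+r. indicator {a..b} r * ennreal (d r) \<partial>lborel) \<le> ennreal (V a)"
        if ab: "0 < a" "a \<le> b" "b < \<eta>" for a b
      proof -
        have "mono_on {a..b} (\<lambda>r. - v r)" using m ab by (auto intro!: mono_onI)
        then have "(\<integral>\<^sup>+r. indicator {a..b} r * ennreal (d r) \<partial>lborel) = ennreal (- v b - - v a)"
          using ab by (intro int) auto
        also have "\<dots> \<le> ennreal (V a)" using vpos[of b] ab Vv by (intro ennreal_leI) auto
        finally show ?thesis using m ab Vv by auto
      qed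
      then show ?thesis by blast
    qed
  qed (use Vm dm in auto)
  moreover have "k * r * d r \<le> V r" for r
    using vpos[of r] by (auto simp: d_def V_def indicator_def)
  ultimately show ?thesis using that Vv ae by blast
qed

text \<open>The sign in \<open>V_weight\<close> follows the monotonicity of the minorant, so in both
  classes the chain rule gives \<open>q * v r powr (q - 1) * \<bar>D\<bar>\<close>. From here on the
  two classes are treated together.\<close>

lemma weight_decomposition:
  assumes q: "q \<ge> 1" and \<eta>: "\<eta> > 0" and w: "w \<in> V_class"
    and K: "q > 1 \<Longrightarrow> (INF r \<in> {0<..\<eta>} \<inter> Z_set (v_fun w \<eta>). ereal (K_fun w r)) > 0"
  obtains v d k where "hardy_weight \<eta> v d" "q > 1 \<Longrightarrow> k > 0" "\<And>r. k * r * d r \<le> v r"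
    "\<And>r. 0 < r \<Longrightarrow> r < \<eta> \<Longrightarrow> v r \<le> w r"
    "AE r in lborel. 0 < r \<and> r < \<eta> \<longrightarrow> V_weight q w \<eta> r = q * v r powr (q - 1) * d r"
proof -
  define v where "v = v_fun w \<eta>"
  obtain c where wc: "w \<in> W_class c" using w by (auto simp: V_class_def)
  have winf: "w \<in> W_class \<infinity>" if "w \<notin> W_class 0" using w that by (auto simp: V_class_def)
  have tm: "touching_minorant \<eta> w v"
    using touching_minorant_phi[of w 0 \<eta>] touching_minorant_psi[of w \<eta>] winf by (auto simp: v_def v_fun_def)
  have inc: "v s \<le> v t" if "w \<in> W_class 0" "0 < s" "s \<le> t" "t < \<eta>" for s t
    using phi_mono[of w 0 s t \<eta>] that by (auto simp: v_def v_fun_def)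
  have dec: "v t \<le> v s" if "w \<notin> W_class 0" "0 < s" "s \<le> t" "t < \<eta>" for s t
    using psi_antimono[of w s t \<eta>] winf that by (auto simp: v_def v_fun_def)
  obtain k where k: "0 \<le> k" "q > 1 \<Longrightarrow> 0 < k"
    "k > 0 \<Longrightarrow> \<forall>r \<in> {0<..\<eta>} \<inter> Z_set v. k \<le> K_fun w r"
  proof (cases "q > 1")
    case True
    \<comment> \<open>The infimum may be infinite, for instance over an empty index set, so
      \<open>k\<close> is a real number strictly between \<open>0\<close> and it. For q = 1 the
      value \<open>k = 0\<close> makes the bound on \<open>d\<close> trivial.\<close>
    then obtain x where x: "0 < ereal x" "ereal x < (INF r \<in> {0<..\<eta>} \<inter> Z_set v. ereal (K_fun w r))"
      using ereal_dense2[OF K[OF True]] unfolding v_def zero_ereal_def by blast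
    have "x \<le> K_fun w r" if "r \<in> {0<..\<eta>} \<inter> Z_set v" for r
      using less_le_trans[OF x(2) INF_lower[OF that]] by simp
    moreover have "0 < x" using x(1) by simp
    ultimately show ?thesis using that[of x] by (meson less_imp_le)
  qed (use that[of 0] in auto)
  have kv: "k * r * \<bar>D\<bar> \<le> v r" if "0 < r" "r < \<eta>" "(v has_real_derivative D) (at r)" "(w has_real_derivative E) (at r)" for r D E
  proof (cases "k > 0")
    case True
    then show ?thesis
      using K_fun_lower_bound[OF w tm[unfolded v_def] that(1,2) that(3)[unfolded v_def] that(4) True] k(3)
      by (simp add: v_def)
  next
    case False
    then have "k = 0" using k(1) by simp
    then show ?thesis using tm that by (auto simp: touching_minorant_def less_imp_le)
  qed
  have mono: "(\<forall>s t. 0 < s \<and> s \<le> t \<and> t < \<eta> \<longrightarrow> v s \<le> v t) \<or> (\<forall>s t. 0 < s \<and> s \<le> t \<and> t < \<eta> \<longrightarrow> v t \<le> v s)"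
    using inc dec by blast
  obtain V d where Vd: "hardy_weight \<eta> V d" "\<And>r. k * r * d r \<le> V r" "\<And>r. 0 < r \<Longrightarrow> r < \<eta> \<Longrightarrow> V r = v r"
    and ae: "AE r in lborel. 0 < r \<and> r < \<eta> \<longrightarrow> (\<exists>D. (v has_real_derivative D) (at r) \<and> d r = \<bar>D\<bar>)"
    by (rule hardy_weight_of_minorant[OF tm wc mono k(1)], rule kv, assumption+, blast)
  have "AE r in lborel. 0 < r \<and> r < \<eta> \<longrightarrow> V_weight q w \<eta> r = q * V r powr (q - 1) * d r"
    using ae
  proof eventually_elim
    case (elim r)
    show ?case
    proof
      assume r: "0 < r \<and> r < \<eta>"
      with elim obtain D where D: "(v has_real_derivative D) (at r)" "d r = \<bar>D\<bar>" by blast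
      have pos: "0 < v r" using tm r by (auto simp: touching_minorant_def)
      have "((\<lambda>s. v s powr q) has_real_derivative q * v r powr (q - 1) * D) (at r)"
        using DERIV_fun_powr[OF D(1) pos, of q] by simp
      then have der: "deriv (\<lambda>s. v s powr q) r = q * v r powr (q - 1) * D"
        by (rule DERIV_imp_deriv)
      have rI: "r \<in> interior {r / 2..(r + \<eta>) / 2}" using r by (auto simp: interior_atLeastAtMost_real)
      show "V_weight q w \<eta> r = q * V r powr (q - 1) * d r"
      proof (cases "w \<in> W_class 0")
        case True
        have "mono_on {r / 2..(r + \<eta>) / 2} v" using inc[OF True] r by (auto intro!: mono_onI)
        from mono_on_imp_deriv_nonneg[OF this D(1) rI] have "D \<ge> 0" .
        then show ?thesis using der True D(2) Vd(3) r by (simp add: V_weight_def v_def v_fun_def)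
      next
        case False
        have "mono_on {r / 2..(r + \<eta>) / 2} (\<lambda>r. - v r)" using dec[OF False] r by (auto intro!: mono_onI)
        from mono_on_imp_deriv_nonneg[OF this DERIV_minus[OF D(1)] rI] have "D \<le> 0" by simp
        then show ?thesis using der False D(2) Vd(3) r by (simp add: V_weight_def v_def v_fun_def)
      qed
    qed
  qed
  moreover have "V r \<le> w r" if "0 < r" "r < \<eta>" for r
    using tm that Vd(3) by (auto simp: touching_minorant_def)
  ultimately show ?thesis using that Vd(1,2) k(2) by blast
qed

section \<open>Summing over the cones\<close>

text \<open>On the cube of slopes every coordinate of \<open>slope e y\<close> has modulus at most
  1, so its norm is at most n. Restoring the inverse n-th power omitted from
  \<open>cone_grad\<close> costs at most n^n.\<close>

lemma (in cone_setting) cone_grad_le: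
  "cone_grad \<le> ennreal (real DIM('a) ^ DIM('a)) *
     (\<integral>\<^sup>+x. ennreal (v (norm x) * norm (g x)) * ennreal (norm x powr (1 - real DIM('a))) \<partial>lborel)"
proof -
  let ?n = "DIM('a)"
  let ?f = "\<lambda>x. ennreal (v (norm x) * norm (g x))"
  have "cone_grad \<le> (\<integral>\<^sup>+y. ennreal (real ?n ^ ?n) * (cube e y * ennreal (1 / norm (slope e y) ^ ?n) *
      (\<integral>\<^sup>+r. indicator {0<..} r * ?f (r *\<^sub>R dir e y) \<partial>lborel)) \<partial>slopes e)"
    unfolding cone_grad_def
  proof (rule nn_integral_mono)
    fix y
    have ray: "ray_grad y = (\<integral>\<^sup>+r. indicator {0<..} r * ?f (r *\<^sub>R dir e y) \<partial>lborel)"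
      unfolding ray_grad_def
    proof (rule nn_integral_cong)
      fix r show "ennreal (v r * norm (g (r *\<^sub>R dir e y))) = indicator {0<..} r * ?f (r *\<^sub>R dir e y)"
        using hw norm_dir[OF e] by (cases "r > 0") (auto simp: hardy_weight_def)
    qed
    show "cube e y * ray_grad y \<le> ennreal (real ?n ^ ?n) * (cube e y * ennreal (1 / norm (slope e y) ^ ?n) *
      (\<integral>\<^sup>+r. indicator {0<..} r * ?f (r *\<^sub>R dir e y) \<partial>lborel))"
    proof (cases "cube e y = 0")
      case False
      have s: "1 \<le> norm (slope e y)" "norm (slope e y) \<le> ?n"
        using norm_slope_ge_1[OF e] norm_slope_le[OF e False] by auto
      then have "norm (slope e y) ^ ?n \<le> real ?n ^ ?n" by (intro power_mono) auto
      moreover have "0 < norm (slope e y) ^ ?n" using s(1) by (intro zero_less_power) linarith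
      ultimately have "1 \<le> real ?n ^ ?n * (1 / norm (slope e y) ^ ?n)" by (simp add: field_simps)
      then have "1 \<le> ennreal (real ?n ^ ?n) * ennreal (1 / norm (slope e y) ^ ?n)"
        by (subst ennreal_mult[symmetric]) auto
      then have "1 * (cube e y * ray_grad y) \<le> (ennreal (real ?n ^ ?n) * ennreal (1 / norm (slope e y) ^ ?n)) * (cube e y * ray_grad y)"
        by (rule mult_right_mono) simp
      then show ?thesis unfolding ray by (simp only: mult_1 mult_ac)
    qed simp
  qed
  also have "\<dots> = ennreal (real ?n ^ ?n) * (\<integral>\<^sup>+x. indicator (axis_cone e) x * (?f x * ennreal (norm x powr (1 - real ?n))) \<partial>lborel)"
    by (subst nn_integral_cone[OF _ e]) (measurable, rule nn_integral_cmult, unfold dir_def slope_def, measurable)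
  also have "\<dots> \<le> ennreal (real ?n ^ ?n) * (\<integral>\<^sup>+x. ?f x * ennreal (norm x powr (1 - real ?n)) \<partial>lborel)"
    by (intro mult_left_mono nn_integral_mono) (auto simp: indicator_def)
  finally show ?thesis .
qed

text \<open>Below the threshold \<open>N\<close> the first term suffices; above it
  \<open>x / N\<close> is at least 1 and a larger exponent only increases the power.
  \<open>N\<close> will be the bound on the gradient integral.\<close>

lemma powr_le_interpolate:
  fixes x N \<alpha> \<beta> :: real
  assumes "0 \<le> x" "0 < N" "0 \<le> \<alpha>" "\<alpha> \<le> \<beta>"
  shows "x powr \<alpha> \<le> N powr \<alpha> + N powr (\<alpha> - \<beta>) * x powr \<beta>"
proof (cases "x \<le> N")
  case True
  then have "x powr \<alpha> \<le> N powr \<alpha>" using assms by (intro powr_mono2) auto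
  then show ?thesis by (simp add: add_increasing2)
next
  case False
  then have x: "0 < x" "1 \<le> x / N" using assms by auto
  have "(x / N) powr \<alpha> \<le> (x / N) powr \<beta>" using x assms by (intro powr_mono) auto
  then have "N powr \<alpha> * (x / N) powr \<alpha> \<le> N powr \<alpha> * (x / N) powr \<beta>" by (intro mult_left_mono) auto
  moreover have "N powr \<alpha> * (x / N) powr \<alpha> = x powr \<alpha>" using assms x by (simp add: powr_divide)
  moreover have "N powr \<alpha> * (x / N) powr \<beta> = N powr (\<alpha> - \<beta>) * x powr \<beta>" using assms x by (simp add: powr_divide powr_diff)
  ultimately show ?thesis by (simp add: add_increasing)
qed

text \<open>The integrand is q (v|u|)^(q-1) |u| d. Interpolation at \<open>N\<close> leaves
  \<open>T1\<close>, of order N, with coefficient N^(q-1), and \<open>Tp\<close>, of order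
  N^(1+1/m), with coefficient N^(q-1-1/m), so both pieces are of order N^q. A positive upper bound
  \<open>N\<close> replaces the gradient integral because negative powers of it occur.\<close>

lemma (in cone_setting) cone_estimate:
  assumes q: "1 \<le> q" "1 - 1 / q \<le> 1 / DIM('a)"
    and k: "q > 1 \<Longrightarrow> k > 0" "\<And>r. k * r * d r \<le> v r"
    and N: "0 < N" "cone_grad \<le> ennreal N"
    and c: "c = (if q = 1 then 0 else 1 + 2 / k)"
  shows "(\<integral>\<^sup>+x. indicator (axis_cone e) x * (ennreal (\<bar>u x\<bar> powr q * (q * v (norm x) powr (q - 1) * d (norm x))) *
      ennreal (norm x powr (1 - real DIM('a)))) \<partial>lborel) \<le> ennreal (q * (1 + c) * N powr q)"
proof -
  let ?n = "DIM('a)"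
  let ?f = "\<lambda>x. ennreal (\<bar>u x\<bar> powr q * (q * v (norm x) powr (q - 1) * d (norm x)))"
  define m where "m = ?n - 1"
  have m: "Suc m = ?n" "0 < m" using dim by (auto simp: m_def)
  define U where "U r y = \<bar>u (r *\<^sub>R dir e y)\<bar>" for r y
  define T1 where "T1 = (\<integral>\<^sup>+y. cube e y * (\<integral>\<^sup>+r. ennreal (U r y * d r) \<partial>lborel) \<partial>slopes e)"
  define Tp where "Tp = (\<integral>\<^sup>+y. cube e y * (\<integral>\<^sup>+r. ennreal ((v r * U r y) powr (1 / m) * (U r y * d r)) \<partial>lborel) \<partial>slopes e)"
  have T1: "T1 \<le> ennreal N" using cone_hardy N(2) unfolding T1_def U_def by (rule order_trans)
  have qm: "q - 1 \<le> 1 / m"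
  proof -
    have n: "real ?n = real m + 1" using m(1) by linarith
    have "q * (1 - 1 / q) \<le> q * (1 / (real m + 1))" using q unfolding n by (intro mult_left_mono) auto
    moreover have "q * (1 - 1 / q) = q - 1" using q(1) by (simp add: right_diff_distrib)
    ultimately have "(q - 1) * (real m + 1) \<le> q" by (simp add: pos_le_divide_eq)
    then have "(q - 1) * real m \<le> 1" by (simp add: distrib_left)
    then show ?thesis using m(2) by (simp add: pos_le_divide_eq)
  qed
  define c1 where "c1 = (if q = 1 then 0 else N powr (q - 1 - 1 / m))"
  have c1: "0 \<le> c1" by (simp add: c1_def)
  have c0: "0 \<le> c" using k(1) q(1) by (auto simp: c)
  have pt: "\<bar>u x\<bar> powr q * (q * v r powr (q - 1) * d r) \<le>
      q * (N powr (q - 1) * (\<bar>u x\<bar> * d r)) + q * (c1 * ((v r * \<bar>u x\<bar>) powr (1 / m) * (\<bar>u x\<bar> * d r)))" for x r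
  proof -
    have "\<bar>u x\<bar> powr q * v r powr (q - 1) = (v r * \<bar>u x\<bar>) powr (q - 1) * \<bar>u x\<bar>"
    proof (cases "u x = 0")
      case False
      have "\<bar>u x\<bar> powr q = \<bar>u x\<bar> powr (q - 1) * \<bar>u x\<bar>"
        using False by (simp add: powr_diff)
      then show ?thesis using v_nonneg[of r] by (simp add: powr_mult mult_ac)
    qed simp
    then have "\<bar>u x\<bar> powr q * (q * v r powr (q - 1) * d r) = q * ((v r * \<bar>u x\<bar>) powr (q - 1) * (\<bar>u x\<bar> * d r))"
      by (simp add: mult_ac)
    also have "\<dots> \<le> q * ((N powr (q - 1) + c1 * (v r * \<bar>u x\<bar>) powr (1 / m)) * (\<bar>u x\<bar> * d r))"
    proof (intro mult_left_mono mult_right_mono)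
      show "(v r * \<bar>u x\<bar>) powr (q - 1) \<le> N powr (q - 1) + c1 * (v r * \<bar>u x\<bar>) powr (1 / m)"
      proof (cases "q = 1")
        case True
        \<comment> \<open>Since \<open>0 powr 0 = 0\<close>, the left side is \<open>0\<close> or
          \<open>1\<close> here; the bound \<open>1\<close> covers both.\<close>
        then show ?thesis using N(1) by (simp add: c1_def powr_def)
      next
        case False
        then show ?thesis unfolding c1_def
          using powr_le_interpolate[of "v r * \<bar>u x\<bar>" N "q - 1" "1 / m"] v_nonneg[of r] N(1) q(1) qm by simp
      qed
    qed (use d_nonneg q in auto)
    finally show ?thesis by (simp add: algebra_simps)
  qed
  have [measurable]: "(\<lambda>(y, r). U r y) \<in> borel_measurable (slopes e \<Otimes>\<^sub>M lborel)"
    unfolding U_def by measurable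
  have "(\<integral>\<^sup>+x. indicator (axis_cone e) x * (?f x * ennreal (norm x powr (1 - real ?n))) \<partial>lborel) =
     (\<integral>\<^sup>+y. cube e y * ennreal (1 / norm (slope e y) ^ ?n) * (\<integral>\<^sup>+r. indicator {0<..} r * ?f (r *\<^sub>R dir e y) \<partial>lborel) \<partial>slopes e)"
    by (rule nn_integral_cone[OF _ e]) measurable
  also have "\<dots> \<le> (\<integral>\<^sup>+y. ennreal (q * N powr (q - 1)) * (cube e y * (\<integral>\<^sup>+r. ennreal (U r y * d r) \<partial>lborel)) +
      ennreal (q * c1) * (cube e y * (\<integral>\<^sup>+r. ennreal ((v r * U r y) powr (1 / m) * (U r y * d r)) \<partial>lborel)) \<partial>slopes e)"
  proof (rule nn_integral_mono)
    fix y
    have "1 \<le> norm (slope e y) ^ ?n" using norm_slope_ge_1[OF e] by (rule one_le_power)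
    then have "ennreal (1 / norm (slope e y) ^ ?n) \<le> ennreal 1" by (intro ennreal_leI) simp
    then have 1: "cube e y * ennreal (1 / norm (slope e y) ^ ?n) \<le> cube e y"
      using mult_left_mono[of "ennreal (1 / norm (slope e y) ^ ?n)" 1 "cube e y"] by simp
    have "(\<integral>\<^sup>+r. indicator {0<..} r * ?f (r *\<^sub>R dir e y) \<partial>lborel) \<le>
      (\<integral>\<^sup>+r. ennreal (q * N powr (q - 1)) * ennreal (U r y * d r) + ennreal (q * c1) * ennreal ((v r * U r y) powr (1 / m) * (U r y * d r)) \<partial>lborel)"
    proof (rule nn_integral_mono)
      fix r
      show "indicator {0<..} r * ?f (r *\<^sub>R dir e y) \<le> ennreal (q * N powr (q - 1)) * ennreal (U r y * d r) + ennreal (q * c1) * ennreal ((v r * U r y) powr (1 / m) * (U r y * d r))"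
      proof (cases "r > 0")
        case True
        then have "indicator {0<..} r * ?f (r *\<^sub>R dir e y) = ennreal (U r y powr q * (q * v r powr (q - 1) * d r))"
          using norm_dir[OF e, of y] by (simp add: U_def)
        also have "\<dots> \<le> ennreal (q * (N powr (q - 1) * (U r y * d r)) + q * (c1 * ((v r * U r y) powr (1 / m) * (U r y * d r))))"
          unfolding U_def by (intro ennreal_leI pt)
        also have "\<dots> = ennreal (q * N powr (q - 1)) * ennreal (U r y * d r) + ennreal (q * c1) * ennreal ((v r * U r y) powr (1 / m) * (U r y * d r))"
          using q(1) c1 d_nonneg v_nonneg by (simp add: ennreal_mult[symmetric] ennreal_plus[symmetric] U_def mult.assoc del: ennreal_plus)
        finally show ?thesis .
      qed simp
    qed
    also have "\<dots> = ennreal (q * N powr (q - 1)) * (\<integral>\<^sup>+r. ennreal (U r y * d r) \<partial>lborel) +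
        ennreal (q * c1) * (\<integral>\<^sup>+r. ennreal ((v r * U r y) powr (1 / m) * (U r y * d r)) \<partial>lborel)"
      unfolding U_def by (simp add: nn_integral_add nn_integral_cmult)
    finally have "cube e y * ennreal (1 / norm (slope e y) ^ ?n) * (\<integral>\<^sup>+r. indicator {0<..} r * ?f (r *\<^sub>R dir e y) \<partial>lborel) \<le>
      cube e y * (ennreal (q * N powr (q - 1)) * (\<integral>\<^sup>+r. ennreal (U r y * d r) \<partial>lborel) +
        ennreal (q * c1) * (\<integral>\<^sup>+r. ennreal ((v r * U r y) powr (1 / m) * (U r y * d r)) \<partial>lborel))"
      by (intro mult_mono 1) auto
    then show "cube e y * ennreal (1 / norm (slope e y) ^ ?n) * (\<integral>\<^sup>+r. indicator {0<..} r * ?f (r *\<^sub>R dir e y) \<partial>lborel) \<le>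
      ennreal (q * N powr (q - 1)) * (cube e y * (\<integral>\<^sup>+r. ennreal (U r y * d r) \<partial>lborel)) +
      ennreal (q * c1) * (cube e y * (\<integral>\<^sup>+r. ennreal ((v r * U r y) powr (1 / m) * (U r y * d r)) \<partial>lborel))"
      by (simp only: distrib_left mult.left_commute)
  qed
  also have "\<dots> = ennreal (q * N powr (q - 1)) * T1 + ennreal (q * c1) * Tp"
    unfolding T1_def Tp_def by (simp add: nn_integral_add nn_integral_cmult)
  also have "\<dots> \<le> ennreal (q * N powr q) + ennreal (q * c * N powr q)"
  proof (rule add_mono)
    have "ennreal (q * N powr (q - 1)) * T1 \<le> ennreal (q * N powr (q - 1)) * ennreal N"
      by (intro mult_left_mono T1) auto
    also have "\<dots> = ennreal (q * N powr q)"
      using N(1) q(1) by (simp add: ennreal_mult[symmetric] powr_diff)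
    finally show "ennreal (q * N powr (q - 1)) * T1 \<le> ennreal (q * N powr q)" .
    show "ennreal (q * c1) * Tp \<le> ennreal (q * c * N powr q)"
    proof (cases "q = 1")
      case True
      then show ?thesis by (simp add: c1_def)
    next
      case False
      then have q1: "q > 1" using q(1) by simp
      have cpos: "0 < c" using k(1)[OF q1] False by (simp add: c add_pos_pos)
      have "Tp ^ m \<le> cone_grad * (ennreal (1 + 2 / k) * cone_grad) ^ m"
        unfolding Tp_def U_def by (rule cone_sobolev[OF k(1)[OF q1] k(2) m(1)])
      also have "\<dots> \<le> ennreal N * (ennreal c * ennreal N) ^ m"
        using False N(2) by (intro mult_mono power_mono) (auto simp: c)
      also have "\<dots> = ennreal (c * N powr (1 + 1 / m)) ^ m"
      proof -
        have "(N powr (1 + 1 / m)) ^ m = N powr (real m + 1)"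
          using N(1) m(2) by (simp add: powr_realpow[symmetric] powr_powr distrib_right)
        then have "(c * N powr (1 + 1 / m)) ^ m = N * (c * N) ^ m"
          using N(1) by (simp add: power_mult_distrib powr_add powr_realpow)
        then show ?thesis using cpos N(1) by (simp add: ennreal_mult[symmetric] ennreal_power)
      qed
      finally have "Tp \<le> ennreal (c * N powr (1 + 1 / m))"
        using m(2) by (simp add: ennreal_power_mono_iff)
      then have "ennreal (q * c1) * Tp \<le> ennreal (q * c1) * ennreal (c * N powr (1 + 1 / m))"
        by (rule mult_left_mono) simp
      also have "\<dots> = ennreal (q * c * (N powr (q - 1 - 1 / m) * N powr (1 + 1 / m)))"
        using False cpos q1 by (simp add: ennreal_mult[symmetric] c1_def mult_ac)
      also have "N powr (q - 1 - 1 / m) * N powr (1 + 1 / m) = N powr q"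
        by (simp add: powr_add[symmetric])
      finally show ?thesis .
    qed
  qed
  also have "\<dots> = ennreal (q * (1 + c) * N powr q)"
    using q(1) c0 by (simp add: ennreal_plus[symmetric] algebra_simps del: ennreal_plus)
  finally show ?thesis .
qed

section \<open>Null sets of radii, and test functions\<close>

lemma AE_norm:
  assumes "AE r in lborel. P r"
  shows "AE x in lborel. x \<noteq> (0::'a::euclidean_space) \<longrightarrow> P (norm x)"
proof -
  obtain Z where Z: "Z \<in> null_sets lborel" "{r. \<not> P r} \<subseteq> Z"
    using assms by (auto elim!: AE_E simp: null_sets_def)
  then have [measurable]: "Z \<in> sets borel" by auto
  \<comment> \<open>The power of the norm is positive off the origin and so does not affect null
    sets. With it, the integral over a cone reduces to integrals of \<open>indicator Z\<close> along
    rays, which vanish.\<close>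
  let ?f = "\<lambda>x::'a. indicator Z (norm x) * ennreal (norm x powr (1 - real DIM('a)))"
  have "(\<integral>\<^sup>+x. indicator (axis_cone e) x * ?f x \<partial>lborel) = 0" if "e \<in> Basis" for e
  proof -
    have "(\<integral>\<^sup>+r. indicator {0<..} r * indicator Z (norm (r *\<^sub>R dir e y)) \<partial>lborel) = 0" for y
    proof -
      have "(\<integral>\<^sup>+r. indicator {0<..} r * indicator Z (norm (r *\<^sub>R dir e y)) \<partial>lborel) \<le> (\<integral>\<^sup>+r. indicator Z r \<partial>lborel)"
        using norm_dir[OF that, of y] by (intro nn_integral_mono) (auto simp: indicator_def)
      then show ?thesis using Z(1) by (auto simp: null_sets_def)
    qed
    then show ?thesis by (subst nn_integral_cone[OF _ that]) auto
  qed
  then have "(\<integral>\<^sup>+x. ?f x \<partial>lborel) \<le> 0"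
    using nn_integral_le_cones[of ?f] by simp
  then have "AE x in lborel. ?f x = 0" by (subst (asm) le_zero_eq, subst (asm) nn_integral_0_iff_AE) auto
  then show ?thesis
  proof eventually_elim
    case (elim x)
    show ?case
    proof
      assume "x \<noteq> 0"
      then have "norm x \<notin> Z" using elim by (auto simp: indicator_def)
      then show "P (norm x)" using Z(2) by auto
    qed
  qed
qed

lemma test_fun_gradient:
  assumes "u \<in> test_fun \<Omega>"
  shows "(u has_derivative (\<lambda>h. grad u x \<bullet> h)) (at x)" "continuous_on UNIV (grad u)"
proof -
  have "Ck (Suc 0) u" using assms by (auto simp: test_fun_def)
  then have d: "u differentiable_on UNIV" and c: "\<And>i. i \<in> Basis \<Longrightarrow> continuous_on UNIV (\<lambda>x. frechet_derivative u (at x) i)"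
    by auto
  show "continuous_on UNIV (grad u)"
    unfolding grad_def[abs_def] using c by (intro continuous_intros) auto
  have fd: "(u has_derivative frechet_derivative u (at x)) (at x)"
    using d by (simp add: differentiable_on_def frechet_derivative_works)
  then have lin: "linear (frechet_derivative u (at x))" by (rule has_derivative_linear)
  have "frechet_derivative u (at x) h = grad u x \<bullet> h" for h
  proof -
    have "frechet_derivative u (at x) h = frechet_derivative u (at x) (\<Sum>i\<in>Basis. (h \<bullet> i) *\<^sub>R i)"
      by (simp add: euclidean_representation)
    also have "\<dots> = (\<Sum>i\<in>Basis. (h \<bullet> i) * frechet_derivative u (at x) i)"
      using lin by (simp add: linear_sum linear_cmul)
    also have "\<dots> = grad u x \<bullet> h"
      unfolding grad_def inner_sum_left
      by (intro sum.cong refl) (simp add: inner_commute mult.commute)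
    finally show ?thesis .
  qed
  then have "frechet_derivative u (at x) = (\<lambda>h. grad u x \<bullet> h)" by (rule ext)
  with fd show "(u has_derivative (\<lambda>h. grad u x \<bullet> h)) (at x)" by (simp only:)
qed

lemma test_fun_support:
  fixes u :: "'a::euclidean_space \<Rightarrow> real"
  assumes u: "u \<in> test_fun (ball 0 \<eta> - {0})" and \<eta>: "\<eta> > 0"
  obtains a b where "0 < a" "a < b" "b < \<eta>" "\<And>x. norm x \<le> a \<or> b \<le> norm x \<Longrightarrow> u x = 0"
    "\<And>x. norm x < a \<or> b < norm x \<Longrightarrow> grad u x = 0"
proof -
  let ?K = "closure {x. u x \<noteq> 0}"
  have K: "compact ?K" "?K \<subseteq> ball 0 \<eta> - {0}" using u by (auto simp: test_fun_def)
  obtain a b where ab: "0 < a" "a < b" "b < \<eta>" "\<And>x. norm x \<le> a \<or> b \<le> norm x \<Longrightarrow> u x = 0"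
  proof (cases "?K = {}")
    case True
    then have "u x = 0" for x using closure_subset[of "{x. u x \<noteq> 0}"] by auto
    then show ?thesis using that[of "\<eta> / 3" "\<eta> / 2"] \<eta> by auto
  next
    case False
    have c: "continuous_on ?K norm" by (intro continuous_intros)
    obtain x where x: "x \<in> ?K" "\<And>y. y \<in> ?K \<Longrightarrow> norm x \<le> norm y" using continuous_attains_inf[OF K(1) False c] by blast
    obtain z where z: "z \<in> ?K" "\<And>y. y \<in> ?K \<Longrightarrow> norm y \<le> norm z" using continuous_attains_sup[OF K(1) False c] by blast
    have x0: "0 < norm x" using x K(2) by auto
    have z0: "norm z < \<eta>" using z K(2) by auto
    have xz: "norm x \<le> norm z" using x z by auto
    show ?thesis
    \<comment> \<open>Halving the least norm in the support and going half way from the largest one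
      to \<eta> leaves a margin, so that \<open>u\<close> vanishes at the end radii as well.\<close>
    proof (rule that[of "norm x / 2" "(norm z + \<eta>) / 2"])
      fix y :: 'a assume y: "norm y \<le> norm x / 2 \<or> (norm z + \<eta>) / 2 \<le> norm y"
      show "u y = 0"
      proof (rule ccontr)
        assume "u y \<noteq> 0"
        then have "y \<in> ?K" using closure_subset[of "{x. u x \<noteq> 0}"] by auto
        then show False using x(2)[of y] z(2)[of y] y x0 z0 by auto
      qed
    qed (use x0 z0 xz \<eta> in simp_all)
  qed
  have "grad u x = 0" if x: "norm x < a \<or> b < norm x" for x
  proof -
    have o: "open {x::'a. norm x < a \<or> b < norm x}"
      by (intro open_Collect_disj open_Collect_less continuous_intros)
    have "((\<lambda>_. 0) has_derivative (\<lambda>h. grad u x \<bullet> h)) (at x)"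
      by (rule has_derivative_transform_within_open[OF test_fun_gradient(1)[OF u] o]) (use x ab in auto)
    then have "(\<lambda>h. grad u x \<bullet> h) = (\<lambda>h. 0)"
      by (rule has_derivative_unique) (rule has_derivative_const)
    then have "grad u x \<bullet> grad u x = 0" by (rule fun_cong)
    then show ?thesis by simp
  qed
  with ab that show ?thesis by blast
qed

section \<open>Assembling the constant\<close>

lemma weighted_sobolev:
  fixes q \<eta> :: real and w :: "real \<Rightarrow> real"
  assumes dim: "DIM('a::euclidean_space) \<ge> 2"
    and q: "q \<ge> 1" "1 - 1 / q \<le> 1 / real DIM('a)"
    and \<eta>: "\<eta> > 0" and w: "w \<in> V_class"
    and K: "q > 1 \<Longrightarrow> (INF r \<in> {0<..\<eta>} \<inter> Z_set (v_fun w \<eta>). ereal (K_fun w r)) > 0"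
  shows "\<exists>C>0. \<forall>u \<in> test_fun (ball 0 \<eta> - {0 :: 'a}).
    (LINT x:ball 0 \<eta>|lebesgue. norm (grad u x) * w (norm x) * norm x powr (1 - real DIM('a)))
    \<ge> C * (LINT x:ball 0 \<eta>|lebesgue.
        \<bar>u x\<bar> powr q * V_weight q w \<eta> (norm x) * norm x powr (1 - real DIM('a))) powr (1 / q)"
proof -
  let ?n = "DIM('a)"
  obtain v d k where hw: "hardy_weight \<eta> v d" and k: "q > 1 \<Longrightarrow> k > 0" "\<And>r. k * r * d r \<le> v r"
    and vw: "\<And>r. 0 < r \<Longrightarrow> r < \<eta> \<Longrightarrow> v r \<le> w r"
    and ae: "AE r in lborel. 0 < r \<and> r < \<eta> \<longrightarrow> V_weight q w \<eta> r = q * v r powr (q - 1) * d r"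
    using weight_decomposition[OF q(1) \<eta> w K] by blast
  obtain wc where wc: "w \<in> W_class wc" using w by (auto simp: V_class_def)
  have [measurable]: "v \<in> borel_measurable borel" "d \<in> borel_measurable borel"
    and vd: "\<And>r. 0 \<le> v r" "\<And>r. 0 \<le> d r" "\<And>r. r \<notin> {0<..<\<eta>} \<Longrightarrow> v r = 0" "\<And>r. r \<notin> {0<..<\<eta>} \<Longrightarrow> d r = 0"
    using hw by (auto simp: hardy_weight_def)
  define c where "c = (if q = 1 then 0 else 1 + 2 / k)"
  have c: "0 \<le> c" using k(1) q(1) by (auto simp: c_def)
  \<comment> \<open>\<open>C0\<close> counts the 2n cones, each bounded by
    \<open>q * (1 + c) * N powr q\<close>; \<open>M\<close> is the factor n^n of
    \<open>cone_grad_le\<close>; \<open>C\<close> inverts their joint effect after the q-th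
    root.\<close>
  define C0 where "C0 = 2 * real ?n * (q * (1 + c))"
  have C0: "0 < C0" using q(1) c by (simp add: C0_def add_pos_nonneg)
  define M where "M = real ?n ^ ?n"
  have M: "0 < M" by (simp add: M_def)
  define C where "C = 1 / (C0 powr (1 / q) * M)"
  have C: "0 < C" using C0 M by (simp add: C_def)
  have main: "C * (LINT x:ball 0 \<eta>|lebesgue. \<bar>u x\<bar> powr q * V_weight q w \<eta> (norm x) * norm x powr (1 - real ?n)) powr (1 / q)
    \<le> (LINT x:ball 0 \<eta>|lebesgue. norm (grad u x) * w (norm x) * norm x powr (1 - real ?n))"
    (is "C * ?J powr (1 / q) \<le> ?W") if u: "u \<in> test_fun (ball 0 \<eta> - {0 :: 'a})" for u
  proof -
    obtain a b where ab: "0 < a" "a < b" "b < \<eta>" and supp: "\<And>x. norm x \<le> a \<or> b \<le> norm x \<Longrightarrow> u x = 0"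
      and gsupp: "\<And>x. norm x < a \<or> b < norm x \<Longrightarrow> grad u x = 0"
      using test_fun_support[OF u \<eta>] by blast
    note du = test_fun_gradient(1)[OF u] and cg = test_fun_gradient(2)[OF u]
    have [measurable]: "grad u \<in> borel_measurable borel" by (rule borel_measurable_continuous_onI[OF cg])
    have [measurable]: "u \<in> borel_measurable borel"
      using du by (intro borel_measurable_continuous_onI continuous_at_imp_continuous_on)
        (auto intro: has_derivative_continuous)
    define A where "A = {x::'a. a \<le> norm x \<and> norm x \<le> b}"
    have "A = cball 0 b - ball 0 a" by (auto simp: A_def)
    then have A: "compact A" by (simp add: compact_diff)
    define L where "L x = norm (grad u x) * w (norm x) * norm x powr (1 - real ?n)" for x
    have "continuous_on A L"
    proof -
      have "continuous_on A (\<lambda>x. w (norm x))"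
        by (rule continuous_on_compose2[OF W_class_continuous_on[OF wc ab(1), of b]])
          (auto simp: A_def intro!: continuous_intros)
      then show ?thesis unfolding L_def
        using ab cg by (intro continuous_intros) (auto simp: A_def intro: continuous_on_subset)
    qed
    \<comment> \<open>A non-integrable function would receive the integral \<open>0\<close>, which
      could not serve as an upper bound. Continuity on a compact annulus, away from a possible
      singularity of \<open>w\<close>, excludes this.\<close>
    then have intA: "integrable lborel (\<lambda>x. indicator A x *\<^sub>R L x)"
      using borel_integrable_compact[OF A] unfolding set_integrable_def by blast
    have L0: "0 \<le> L x" "x \<notin> A \<Longrightarrow> L x = 0" for x
    proof -
      have "0 \<le> w (norm x)" if "x \<noteq> 0" using W_class_pos[OF wc, of "norm x"] that by simp
      then show "0 \<le> L x" by (cases "x = 0") (auto simp: L_def)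
      show "L x = 0" if "x \<notin> A" using gsupp[of x] that by (auto simp: A_def L_def not_le)
    qed
    have LA: "(\<lambda>x. indicator (ball 0 \<eta>) x *\<^sub>R L x) = (\<lambda>x. indicator A x *\<^sub>R L x)" "L = (\<lambda>x. indicator A x *\<^sub>R L x)"
      using L0(2) ab by (auto simp: fun_eq_iff indicator_def A_def)
    have Lint: "integrable lborel L" by (subst LA(2)) (rule intA)
    have W: "?W = (\<integral>x. L x \<partial>lborel)"
    proof -
      have "?W = (\<integral>x. indicator A x *\<^sub>R L x \<partial>lebesgue)"
        unfolding set_lebesgue_integral_def L_def[symmetric] LA(1) ..
      also have "\<dots> = (\<integral>x. indicator A x *\<^sub>R L x \<partial>lborel)"
        by (rule integral_completion) (use intA in auto)
      finally show ?thesis using LA(2) by simp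
    qed
    have W0: "0 \<le> ?W" unfolding W using L0(1) by (intro Bochner_Integration.integral_nonneg) auto
    have Wnn: "(\<integral>\<^sup>+x. ennreal (L x) \<partial>lborel) = ennreal ?W"
      unfolding W using Lint L0(1) by (intro nn_integral_eq_integral) auto
    have vg: "ennreal (v (norm x) * norm (grad u x)) * ennreal (norm x powr (1 - real ?n)) \<le> ennreal (L x)" for x
    proof (cases "norm x \<in> {0<..<\<eta>}")
      case True
      then have "v (norm x) * norm (grad u x) * norm x powr (1 - real ?n) \<le> L x"
        unfolding L_def using vw[of "norm x"] by (intro mult_right_mono) (auto simp: mult.commute[of "norm _"] intro: mult_right_mono)
      then show ?thesis using vd(1) by (simp add: ennreal_mult[symmetric] ennreal_leI)
    next
      case False
      from vd(3)[OF this] show ?thesis by simp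
    qed
    define R where "R x = \<bar>u x\<bar> powr q * (q * v (norm x) powr (q - 1) * d (norm x)) * norm x powr (1 - real ?n)" for x
    have R0: "0 \<le> R x" for x using q(1) vd by (simp add: R_def)
    have [measurable]: "R \<in> borel_measurable borel" unfolding R_def by measurable
    have bound: "(\<integral>\<^sup>+x. ennreal (R x) \<partial>lborel) \<le> ennreal (C0 * N powr q)" if N: "0 < N" "M * ?W \<le> N" for N
    proof -
      have 1: "(\<integral>\<^sup>+x. indicator (axis_cone e) x * ennreal (R (s *\<^sub>R x)) \<partial>lborel) \<le> ennreal (q * (1 + c) * N powr q)"
        if e: "e \<in> Basis" and s: "s = 1 \<or> s = -1" for e :: 'a and s :: real
      proof -
        have n: "norm (s *\<^sub>R x) = norm x" for x :: 'a using s by auto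
        \<comment> \<open>The value \<open>s = -1\<close> gives the reflected function and thereby
          the cone around \<open>- e\<close>.\<close>
        interpret cone_setting e \<eta> v d "\<lambda>x. u (s *\<^sub>R x)" "\<lambda>x. s *\<^sub>R grad u (s *\<^sub>R x)" a b
        proof
          show "((\<lambda>x. u (s *\<^sub>R x)) has_derivative (\<lambda>h. (s *\<^sub>R grad u (s *\<^sub>R x)) \<bullet> h)) (at x)" for x
          proof -
            have "((\<lambda>x. s *\<^sub>R x) has_derivative (\<lambda>h. s *\<^sub>R h)) (at x)" by (auto intro!: derivative_eq_intros)
            from has_derivative_compose[OF this du] show ?thesis by simp
          qed
          show "continuous_on UNIV (\<lambda>x. s *\<^sub>R grad u (s *\<^sub>R x))"
            by (intro continuous_intros continuous_on_compose2[OF cg]) auto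
          show "u (s *\<^sub>R x) = 0" if "norm x \<le> a \<or> b \<le> norm x" for x
            using supp[of "s *\<^sub>R x"] that by (simp only: n)
        qed (use e dim hw ab in auto)
        have "cone_grad \<le> ennreal M * (\<integral>\<^sup>+x. ennreal (v (norm x) * norm (s *\<^sub>R grad u (s *\<^sub>R x))) * ennreal (norm x powr (1 - real ?n)) \<partial>lborel)"
          using cone_grad_le by (simp add: M_def)
        also have "\<dots> \<le> ennreal M * (\<integral>\<^sup>+x. ennreal (L (s *\<^sub>R x)) \<partial>lborel)"
        proof (intro mult_left_mono nn_integral_mono)
          fix x :: 'a
          show "ennreal (v (norm x) * norm (s *\<^sub>R grad u (s *\<^sub>R x))) * ennreal (norm x powr (1 - real ?n)) \<le> ennreal (L (s *\<^sub>R x))"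
            using vg[of "s *\<^sub>R x"] by (simp only: n)
        qed simp
        also have "(\<integral>\<^sup>+x. ennreal (L (s *\<^sub>R x)) \<partial>lborel) = ennreal ?W"
          using s Wnn nn_integral_lborel_uminus[of "\<lambda>x. ennreal (L x)"] Lint by auto
        also have "ennreal M * ennreal ?W = ennreal (M * ?W)" using M W0 by (simp add: ennreal_mult)
        also have "\<dots> \<le> ennreal N" using N by (intro ennreal_leI)
        finally have "cone_grad \<le> ennreal N" .
        note est = cone_estimate[OF q k N(1) this c_def]
        have "ennreal (R (s *\<^sub>R x)) = ennreal (\<bar>u (s *\<^sub>R x)\<bar> powr q * (q * v (norm x) powr (q - 1) * d (norm x))) *
            ennreal (norm x powr (1 - real ?n))" for x
          unfolding R_def n using q(1) vd by (intro ennreal_mult) auto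
        then show ?thesis using est by (simp only:)
      qed
      have "(\<integral>\<^sup>+x. ennreal (R x) \<partial>lborel) \<le> (\<Sum>e\<in>Basis. (\<integral>\<^sup>+x. indicator (axis_cone e) x * ennreal (R x) \<partial>lborel) +
        (\<integral>\<^sup>+x. indicator (axis_cone e) x * ennreal (R (- x)) \<partial>lborel))"
        by (rule nn_integral_le_cones) measurable
      also have "\<dots> \<le> (\<Sum>e\<in>(Basis::'a set). ennreal (q * (1 + c) * N powr q) + ennreal (q * (1 + c) * N powr q))"
        using 1[of _ 1] 1[of _ "-1"] by (intro sum_mono add_mono) auto
      also have "\<dots> = ennreal (C0 * N powr q)"
        using q(1) c by (simp add: C0_def ennreal_plus[symmetric] ennreal_of_nat_eq_real_of_nat ennreal_mult[symmetric] mult_ac del: ennreal_plus)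
      finally show ?thesis .
    qed
    define F where "F x = indicator (ball 0 \<eta>) x *\<^sub>R (\<bar>u x\<bar> powr q * V_weight q w \<eta> (norm x) * norm x powr (1 - real ?n))" for x
    have J: "?J = (\<integral>x. F x \<partial>lebesgue)" by (simp add: set_lebesgue_integral_def F_def)
    \<comment> \<open>The radii at which \<open>deriv\<close> is unspecified form a null set, and by
      \<open>AE_norm\<close> so do the points at these radii.\<close>
    have FR: "AE x in lebesgue. F x = R x"
    proof (rule AE_completion)
      show "AE x in lborel. F x = R x"
        using AE_norm[OF ae] AE_lborel_singleton[of 0]
      proof eventually_elim
        case (elim x)
        show ?case
        proof (cases "x \<in> ball 0 \<eta>")
          case True
          with elim have "V_weight q w \<eta> (norm x) = q * v (norm x) powr (q - 1) * d (norm x)" by auto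
          then show ?thesis using True by (simp add: F_def R_def)
        next
          case False
          then have "u x = 0" using supp[of x] ab by auto
          then show ?thesis using False q(1) by (simp add: F_def R_def)
        qed
      qed
    qed
    have Jle: "0 \<le> ?J \<and> ?J \<le> C0 * N powr q" if N: "0 < N" "M * ?W \<le> N" for N
    proof (cases "integrable lebesgue F")
      \<comment> \<open>By convention the integral is \<open>0\<close> in this case, and the bound
        is immediate.\<close>
      case False
      then show ?thesis unfolding J using C0 by (simp add: not_integrable_integral_eq)
    next
      case True
      have Rm: "R \<in> borel_measurable lebesgue" by (rule measurable_completion) simp
      have JR: "?J = (\<integral>x. R x \<partial>lebesgue)"
        unfolding J using FR True Rm by (intro integral_cong_AE) auto
      also have "\<dots> = enn2real (\<integral>\<^sup>+x. ennreal (R x) \<partial>lebesgue)"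
        using R0 Rm by (intro integral_eq_nn_integral) auto
      also have "\<dots> = enn2real (\<integral>\<^sup>+x. ennreal (R x) \<partial>lborel)" by (simp add: nn_integral_completion)
      also have "\<dots> \<le> C0 * N powr q"
        using bound[OF N] C0 by (intro enn2real_leI) auto
      finally show ?thesis using JR R0 by (simp add: Bochner_Integration.integral_nonneg)
    qed
    show ?thesis
    \<comment> \<open>The left-hand integral may vanish, whereas the cone estimates need a positive
      \<open>N\<close>; the added \<epsilon> provides it.\<close>
    proof (rule field_le_epsilon)
      fix \<epsilon> :: real assume \<epsilon>: "0 < \<epsilon>"
      define N where "N = M * (?W + \<epsilon>)"
      have N: "0 < N" "M * ?W \<le> N" using M W0 \<epsilon> by (auto simp: N_def intro: mult_left_mono mult_pos_pos)
      have "?J powr (1 / q) \<le> (C0 * N powr q) powr (1 / q)"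
        using Jle[OF N] q(1) by (intro powr_mono2) auto
      also have "\<dots> = C0 powr (1 / q) * N"
        using C0 N(1) q(1) by (simp add: powr_mult powr_powr)
      finally have "C * ?J powr (1 / q) \<le> C * (C0 powr (1 / q) * N)" using C by (intro mult_left_mono) auto
      also have "\<dots> = ?W + \<epsilon>" using C0 M by (simp add: C_def N_def)
      finally show "C * ?J powr (1 / q) \<le> ?W + \<epsilon>" .
    qed
  qed
  show ?thesis using C main by blast
qed

theorem theorem2p2:
  fixes q \<eta> :: real and w :: "real \<Rightarrow> real"
  assumes "CARD('n::finite) > 1"
    and "q \<ge> 1" and "0 \<le> 1 - 1 / q" and "1 - 1 / q \<le> 1 / real CARD('n)"
    and "\<eta> > 0"
    and "w \<in> V_class"
    and "q > 1 \<Longrightarrow> (INF r \<in> {0<..\<eta>} \<inter> Z_set (v_fun w \<eta>). ereal (K_fun w r)) > 0"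
  shows "\<exists>C>0. \<forall>u \<in> test_fun (ball 0 \<eta> - {0 :: real ^ 'n}).
    (LINT x:ball 0 \<eta>|lebesgue. norm (grad u x) * w (norm x) * norm x powr (1 - real CARD('n)))
    \<ge> C * (LINT x:ball 0 \<eta>|lebesgue.
        \<bar>u x\<bar> powr q * V_weight q w \<eta> (norm x) * norm x powr (1 - real CARD('n))) powr (1 / q)"
  using weighted_sobolev[where 'a = "real ^ 'n", of q \<eta> w] assms by simp

end
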